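(* Let $\alpha,\beta:\mathbb{N}\to\mathbb{R}_{>0}$ be functions and fix an integer $r\ge0$. Consider partitions $\lambda\vdash n$ whose numbers of rows and columns are at most $\alpha(n)$, and $\mu\vdash k$ whose numbers of rows and columns are at most $\beta(k)$, such that $k\beta(k)=o\big(n/\alpha(n)\big)$. Then, as $n\to\infty$, $$A_{\lambda/\mu}=\sum_{\substack{\sigma\in S_k\\ \ell_T(\sigma)\le r}}\frac{\chi^\lambda(\sigma)}{f^\lambda}\,\frac{\chi^\mu(\sigma)}{f^\mu}+\mathcal{O}\!\left(\left(k\beta(k)n^{-1}\alpha(n)\right)^{r+1}\right).$$
   Context: For a partition $\nu$, $f^\nu$ denotes the number of standard Young tableaux of shape $\nu$; for $\mu\subseteq\lambda$, $f^{\lambda/\mu}$ denotes the number of standard Young tableaux of skew shape $\lambda/\mu$. $A_{\lambda/\mu}:=|\mu|!\,\frac{f^{\lambda/\mu}}{f^\lambda f^\mu}$. $\chi^\lambda$ is the irreducible character of $S_{|\lambda|}$ indexed by $\lambda$; for $\sigma\in S_k$ with $k\le n$, $\chi^\lambda(\sigma)$ is evaluated on $\sigma$ viewed in $S_n$ via the embedding fixing all $j>k$. $\ell_T(\sigma)$ is the minimal number of (not necessarily adjacent) transpositions whose product is $\sigma$. *)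

theory Defs
  imports "HOL-Combinatorics.Combinatorics" "HOL-Library.Landau_Symbols" "HOL-Library.FuncSet"
    Complex_Main
begin

definition is_partition :: "nat list \<Rightarrow> bool" where
  "is_partition lam \<longleftrightarrow> sorted (rev lam) \<and> 0 \<notin> set lam"

definition nrows :: "nat list \<Rightarrow> nat" where "nrows lam = length lam"
definition ncols :: "nat list \<Rightarrow> nat" where "ncols lam = (if lam = [] then 0 else hd lam)"

definition young :: "nat list \<Rightarrow> (nat \<times> nat) set" where
  "young lam = {(i, j). i < length lam \<and> j < lam ! i}"

definition contained :: "nat list \<Rightarrow> nat list \<Rightarrow> bool" where
  "contained mu lam \<longleftrightarrow> young mu \<subseteq> young lam"

definition skew_syt :: "nat list \<Rightarrow> nat list \<Rightarrow> (nat \<times> nat \<Rightarrow> nat) set" where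
  "skew_syt lam mu =
     (let D = young lam - young mu in
      {T. bij_betw T D {1..card D} \<and> (\<forall>c. c \<notin> D \<longrightarrow> T c = 0) \<and>
          (\<forall>i j. (i, j) \<in> D \<and> (i, Suc j) \<in> D \<longrightarrow> T (i, j) < T (i, Suc j)) \<and>
          (\<forall>i j. (i, j) \<in> D \<and> (Suc i, j) \<in> D \<longrightarrow> T (i, j) < T (Suc i, j))})"

definition f_skew :: "nat list \<Rightarrow> nat list \<Rightarrow> nat" where
  "f_skew lam mu = card (skew_syt lam mu)"

definition f_shape :: "nat list \<Rightarrow> nat" where
  "f_shape lam = f_skew lam []"

definition A_skew :: "nat list \<Rightarrow> nat list \<Rightarrow> real" where
  "A_skew lam mu = fact (sum_list mu) * real (f_skew lam mu) / (real (f_shape lam) * real (f_shape mu))"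

text \<open>Permutation character of the Young subgroup S_a (a a composition of n, entries in int;
  zero if some entry is negative): number of ordered set partitions (B_0,...,B_{l-1}) of
  {1..n} with |B_i| = a_i that are invariant under sigma.\<close>
definition young_perm_char :: "nat \<Rightarrow> int list \<Rightarrow> (nat \<Rightarrow> nat) \<Rightarrow> int" where
  "young_perm_char n a \<sigma> =
     (if (\<exists>x\<in>set a. x < 0) then 0 else
      int (card {B \<in> {1..n} \<rightarrow>\<^sub>E {0..<length a}.
              (\<forall>i<length a. int (card {x\<in>{1..n}. B x = i}) = a ! i) \<and>
              (\<forall>x\<in>{1..n}. B (\<sigma> x) = B x)}))"

text \<open>Irreducible character chi^lambda of S_n (n = |lambda|), evaluated at a permutation sigma
  of {1..n} (permutations of {1..k}, k \<le> n, are viewed in S_n by fixing j > k).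
  Defined by the determinantal (Jacobi-Trudi / Frobenius) formula
  chi^lambda = det [ psi^(lambda_i - i + j) ].\<close>
definition irr_char :: "nat list \<Rightarrow> (nat \<Rightarrow> nat) \<Rightarrow> int" where
  "irr_char lam \<sigma> =
     (let l = length lam; n = sum_list lam in
      (\<Sum>w | w permutes {0..<l}.
          sign w * young_perm_char n (map (\<lambda>i. int (lam ! i) - int i + int (w i)) [0..<l]) \<sigma>))"

definition ellT :: "(nat \<Rightarrow> nat) \<Rightarrow> nat" where
  "ellT \<sigma> = (LEAST m. \<exists>ts. length ts = m \<and> (\<forall>(a, b)\<in>set ts. a \<noteq> b) \<and> \<sigma> = apply_transps ts)"

end

(* Restricting chi^lambda to S_k and using orthonormality,
     A_(lambda/mu) = sum over sigma in S_k of (chi^lambda(sigma) / f^lambda) (chi^mu(sigma) / f^mu),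
   so the theorem is a bound for the terms of reflection length i > r. The characters being given by
   a determinant, orthonormality comes from the triangularity of <chi^mu, psi^b> in dominance order
   (Pieri rule with a sign-reversing involution), and comparing triangularity with respect to psi^b
   and to sgn psi^b identifies chi^lambda / f^lambda with the normalised trace of a Young symmetrizer:
   n! chi^lambda(sigma) / f^lambda is a signed count of bijective fillings T of lambda together with
   factorisations sigma = q p, where q preserves the columns and p the rows of T.

   For a fixed factorisation on the support of sigma (m <= 2 i points) a filling is determined by the
   column of each q-cycle and the row of each p-cycle, and by an Euler characteristic argument at
   most i of these data are not paired up into a free choice of a box. If lambda has at most a rows
   and columns, this gives at most n^m (a/n)^i n^(-(|p| + |q| - i)/2) fillings, and summing over p by
   the AM-GM inequality yields |chi^lambda(sigma)| / f^lambda <= (C a sqrt(i) / n)^i. As S_k has at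
   most (C k^2 / i)^i permutations of length i, the layer of length i contributes at most x^i, where
   x = C k beta(k) alpha(n) / n tends to 0. *)

theory Submission
  imports Defs
begin

text \<open>The ratio chi^lambda / f^lambda is bounded without any estimate of f^lambda: the sum of
  the Young symmetrizers over all fillings is a class function with value n! at the identity, so
  once it is proportional to chi^lambda the normalisation is automatic. No module supplies this
  proportionality, and sgn chi^lambda is never identified with the character of the conjugate shape;
  instead the coefficients of the class function are killed by two dominance relations that hold
  together only for lambda itself. The final estimate may lose only factors C^i. Each of the two
  characters costs i^(i/2), which is exactly compensated by the factor i^(-i) in the number of
  permutations of length i. Counting the factorisations sigma = q p crudely by m! would destroy this
  balance; hence the summation over p with the generating function of cycles. The pairing behind the
  Euler characteristic is a matching in the bipartite graph whose vertices are the cycles of p and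
  of q and whose edges are the points. It is built along a shortest factorisation of sigma into
  transpositions.\<close>

section \<open>Cycles of permutations\<close>

text \<open>Fixed points in \<open>Z\<close> count as cycles, so the value depends on
  \<open>Z\<close>; the defect \<open>card Z - cyc Z p\<close> does not, by
  \<open>cyc_fixed_superset\<close>.\<close>

definition cyc :: "'a set \<Rightarrow> ('a \<Rightarrow> 'a) \<Rightarrow> nat" where
  "cyc Z p = card (orbit p ` Z)"

lemma orbit_eq_iff:
  assumes "permutation p"
  shows "orbit p x = orbit p y \<longleftrightarrow> x \<in> orbit p y"
  by (metis assms orbit_cyclic_eq3 cyclic_on_orbit' permutation_self_in_orbit)

lemma orbit_closed:
  assumes "x \<in> A" "\<And>z. z \<in> A \<Longrightarrow> p z \<in> A"
  shows "orbit p x \<subseteq> A"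
proof
  fix y assume "y \<in> orbit p x"
  then show "y \<in> A" by induction (use assms in auto)
qed

lemma permutation_transpose_comp:
  "permutation p \<Longrightarrow> permutation (transpose x y \<circ> p)"
  by (simp add: permutation_compose permutation_swap_id)

text \<open>The transposition only exchanges two points of one cycle of \<open>p\<close>, so it
  cannot lead out of any cycle: multiplication refines the orbits.\<close>

lemma orbit_transpose_subset:
  assumes p: "permutation p" and y: "y \<in> orbit p x"
  shows "orbit (transpose x y \<circ> p) z \<subseteq> orbit p z"
proof (rule orbit_closed)
  show "z \<in> orbit p z" by (rule permutation_self_in_orbit[OF p])
  fix w assume "w \<in> orbit p z"
  then have "p w \<in> orbit p z" by (rule orbit.step)
  moreover have "x \<in> orbit p y"
    using orbit_swap[OF permutation_self_in_orbit[OF p] y] .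
  ultimately show "(transpose x y \<circ> p) w \<in> orbit p z"
    using y by (auto simp: transpose_def intro: orbit_trans)
qed

text \<open>If \<open>y\<close> were missed, the new permutation would follow \<open>p\<close> along
  the whole cycle of \<open>x\<close>; but it sends the predecessor of \<open>x\<close> on that
  cycle to \<open>y\<close>.\<close>

lemma orbit_transpose_joins:
  assumes p: "permutation p" and y: "y \<notin> orbit p x"
  shows "y \<in> orbit (transpose x y \<circ> p) x"
proof (rule ccontr)
  let ?q = "transpose x y \<circ> p"
  assume ny: "y \<notin> orbit ?q x"
  have step: "p w \<in> orbit ?q x" if "p w \<in> orbit p x" "?q w \<in> orbit ?q x" for w
    using that y ny by (auto simp: transpose_def split: if_splits)
  have sub: "z \<in> orbit ?q x" if "z \<in> orbit p x" for z
    using that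
  proof induction
    case base show ?case by (rule step[OF orbit.base orbit.base])
  next
    case (step w) then show ?case
      by (intro \<open>\<And>w. \<lbrakk>p w \<in> orbit p x; ?q w \<in> orbit ?q x\<rbrakk> \<Longrightarrow> p w \<in> orbit ?q x\<close> orbit.step)
  qed
  define z where "z = inv p x"
  have pz: "p z = x" using p by (simp add: z_def permutation_inverse_works)
     (metis comp_apply id_apply p permutation_inverse_works(2))
  have "z \<in> orbit p x"
    using permutation_orbit_step[OF p, of z] permutation_self_in_orbit[OF p, of z] pz by simp
  then have "?q z \<in> orbit ?q x" using orbit.step[OF sub] by blast
  then show False using ny pz by simp
qed

lemma orbit_transpose_merge:
  assumes p: "permutation p" and y: "y \<notin> orbit p x"
  shows "orbit (transpose x y \<circ> p) z =
    (if z \<in> orbit p x \<union> orbit p y then orbit p x \<union> orbit p y else orbit p z)"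
proof -
  let ?q = "transpose x y \<circ> p"
  let ?U = "orbit p x \<union> orbit p y"
  have q: "permutation ?q" using p by (rule permutation_transpose_comp)
  have yq: "y \<in> orbit ?q x" using orbit_transpose_joins[OF p y] .
  \<comment> \<open>The transposition is an involution, so \<open>p\<close> arises from
    \<open>?q\<close> in the same way and the refinement lemma applies with the roles
    exchanged.\<close>
  have pq: "transpose x y \<circ> ?q = p" by (simp add: fun_eq_iff)
  have sub: "orbit p w \<subseteq> orbit ?q w" for w
    using orbit_transpose_subset[OF q yq, of w] by (simp only: pq)
  have self: "w \<in> orbit p w" for w using permutation_self_in_orbit[OF p] .
  show ?thesis
  proof (cases "z \<in> ?U")
    case True
    have "orbit ?q z \<subseteq> ?U"
    proof (rule orbit_closed[OF True])
      fix w assume "w \<in> ?U"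
      then have "p w \<in> ?U" by (auto intro: orbit.step)
      then show "?q w \<in> ?U" using self by (auto simp: transpose_def)
    qed
    moreover have "?U \<subseteq> orbit ?q z"
    proof -
      have e: "orbit ?q y = orbit ?q x" using orbit_eq_iff[OF q] yq by blast
      have "z \<in> orbit ?q x" using True sub e by blast
      then have "orbit ?q z = orbit ?q x" using orbit_eq_iff[OF q] by blast
      then show ?thesis using sub[of x] sub[of y] e by auto
    qed
    ultimately show ?thesis using True by auto
  next
    case False
    have "orbit ?q z \<subseteq> orbit p z"
    proof (rule orbit_closed[OF self])
      fix w assume "w \<in> orbit p z"
      then have pw: "p w \<in> orbit p z" by (rule orbit.step)
      then have "p w \<notin> {x, y}"
        using False orbit_swap[OF self] by auto
      then show "?q w \<in> orbit p z" using pw by (simp add: transpose_def)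
    qed
    then show ?thesis using False sub[of z] by auto
  qed
qed

lemma cyc_transpose_merge:
  assumes fin: "finite Z" and pZ: "p permutes Z" and x: "x \<in> Z" and yZ: "y \<in> Z"
    and y: "y \<notin> orbit p x"
  shows "cyc Z (transpose x y \<circ> p) + 1 = cyc Z p"
proof -
  let ?q = "transpose x y \<circ> p"
  let ?U = "orbit p x \<union> orbit p y"
  have p: "permutation p" using fin pZ permutation_permutes by blast
  have self: "w \<in> orbit p w" for w using permutation_self_in_orbit[OF p] .
  have ne: "orbit p x \<noteq> orbit p y" using y self by auto
  have mem: "z \<in> ?U \<longleftrightarrow> orbit p z \<in> {orbit p x, orbit p y}" for z
    using orbit_eq_iff[OF p] by auto
  \<comment> \<open>Two orbits are replaced by their union, which is not itself an orbit of
    \<open>p\<close>; hence the count drops by exactly one.\<close>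
  have img: "orbit ?q ` Z = insert ?U (orbit p ` Z - {orbit p x, orbit p y})"
  proof
    show "orbit ?q ` Z \<subseteq> insert ?U (orbit p ` Z - {orbit p x, orbit p y})"
      using mem by (auto simp: orbit_transpose_merge[OF p y])
    show "insert ?U (orbit p ` Z - {orbit p x, orbit p y}) \<subseteq> orbit ?q ` Z"
    proof
      fix O' assume "O' \<in> insert ?U (orbit p ` Z - {orbit p x, orbit p y})"
      then consider "O' = ?U" | z where "z \<in> Z" "O' = orbit p z" "O' \<notin> {orbit p x, orbit p y}" by auto
      then show "O' \<in> orbit ?q ` Z"
      proof cases
        case 1 then show ?thesis using x self
          by (intro image_eqI[of _ _ x]) (auto simp: orbit_transpose_merge[OF p y])
      next
        case 2 then show ?thesis using mem[of z]
          by (intro image_eqI[of _ _ z]) (auto simp: orbit_transpose_merge[OF p y])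
      qed
    qed
  qed
  have "?U \<notin> orbit p ` Z"
  proof
    assume "?U \<in> orbit p ` Z"
    then obtain z where "?U = orbit p z" by auto
    then have "orbit p x = orbit p z" "orbit p y = orbit p z"
      using self orbit_eq_iff[OF p] by blast+
    then show False using ne by simp
  qed
  then have 1: "card (orbit ?q ` Z) = Suc (card (orbit p ` Z - {orbit p x, orbit p y}))"
    unfolding img using fin by simp
  have 2: "card (orbit p ` Z - {orbit p x, orbit p y}) = card (orbit p ` Z) - 2"
    using ne x yZ fin by (subst card_Diff_subset) auto
  have "card (orbit p ` Z) \<ge> card {orbit p x, orbit p y}"
    using x yZ fin by (intro card_mono) auto
  then have "card (orbit p ` Z) \<ge> 2" using ne by simp
  then show ?thesis unfolding cyc_def using 1 2 by linarith
qed

lemma cyc_transpose_le: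
  assumes fin: "finite Z" and pZ: "p permutes Z" and x: "x \<in> Z" and yZ: "y \<in> Z"
  shows "cyc Z (transpose x y \<circ> p) \<le> cyc Z p + 1"
proof (cases "y \<in> orbit p x")
  case False
  from cyc_transpose_merge[OF assms this] show ?thesis by simp
next
  case True
  let ?q = "transpose x y \<circ> p"
  have p: "permutation p" using fin pZ permutation_permutes by blast
  have q: "permutation ?q" using p by (rule permutation_transpose_comp)
  have qZ: "?q permutes Z" using pZ x yZ by (simp add: permutes_compose permutes_swap_id)
  have pq: "transpose x y \<circ> ?q = p" by (simp add: fun_eq_iff)
  show ?thesis
  proof (cases "y \<in> orbit ?q x")
    case False
    from cyc_transpose_merge[OF fin qZ x yZ this] show ?thesis unfolding pq by simp
  next
    \<comment> \<open>Each of the two permutations refines the orbits of the other, so the orbits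
      coincide.\<close>
    case True2: True
    have "orbit p w = orbit ?q w" for w
      using orbit_transpose_subset[OF p True, of w] orbit_transpose_subset[OF q True2, of w]
      unfolding pq by auto
    then show ?thesis by (simp add: cyc_def)
  qed
qed

lemma cyc_transpose_ge:
  assumes fin: "finite Z" and pZ: "p permutes Z" and x: "x \<in> Z" and yZ: "y \<in> Z"
  shows "cyc Z p \<le> cyc Z (transpose x y \<circ> p) + 1"
proof -
  have qZ: "transpose x y \<circ> p permutes Z"
    using pZ x yZ by (simp add: permutes_compose permutes_swap_id)
  have pq: "transpose x y \<circ> (transpose x y \<circ> p) = p" by (simp add: fun_eq_iff)
  show ?thesis using cyc_transpose_le[OF fin qZ x yZ] unfolding pq .
qed

lemma cyc_insert_fixed:
  assumes fin: "finite Z" and pZ: "p permutes Z" and a: "a \<notin> Z"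
  shows "cyc (insert a Z) p = cyc Z p + 1"
proof -
  have fa: "p a = a" using pZ a by (simp add: permutes_not_in)
  have oa: "orbit p a = {a}" using fa by (simp add: orbit_eq_singleton_iff)
  have "orbit p a \<notin> orbit p ` Z"
  proof
    assume "orbit p a \<in> orbit p ` Z"
    then obtain z where z: "z \<in> Z" "orbit p z = {a}" using oa by auto
    have "orbit p z \<subseteq> Z" using permutes_orbit_subset[OF pZ z(1)] .
    then show False using z a by auto
  qed
  then show ?thesis using fin by (simp add: cyc_def)
qed

text \<open>\<open>a\<close> starts as a cycle of its own and is spliced into the cycle of
  \<open>b\<close>, so the additional cycle is lost again.\<close>

lemma cyc_insert_transpose:
  assumes fin: "finite Z" and pZ: "p permutes Z" and a: "a \<notin> Z" and b: "b \<in> Z"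
  shows "cyc (insert a Z) (transpose a b \<circ> p) = cyc Z p"
proof -
  have pa: "p permutes insert a Z" using pZ by (rule permutes_imp_permutes_insert)
  have "p a = a" using pZ a by (simp add: permutes_not_in)
  then have oa: "orbit p a = {a}" by (simp add: orbit_eq_singleton_iff)
  have "cyc (insert a Z) (transpose a b \<circ> p) + 1 = cyc (insert a Z) p"
    by (rule cyc_transpose_merge) (use fin pa a b oa in auto)
  then show ?thesis using cyc_insert_fixed[OF fin pZ a] by simp
qed

lemma cyc_fixed_superset:
  assumes fin: "finite Z'" and sub: "Z \<subseteq> Z'" and pZ: "p permutes Z"
  shows "cyc Z' p + card Z = cyc Z p + card Z'"
proof -
  have "finite A \<Longrightarrow> A \<subseteq> Z' - Z \<Longrightarrow> cyc (Z \<union> A) p = cyc Z p + card A" for A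
  proof (induction A rule: finite_induct)
    case empty then show ?case by simp
  next
    case (insert a A)
    have "cyc (insert a (Z \<union> A)) p = cyc (Z \<union> A) p + 1"
    proof (rule cyc_insert_fixed)
      show "finite (Z \<union> A)" using insert fin sub by (meson Diff_subset finite_Un finite_subset)
      show "p permutes Z \<union> A" using pZ by (rule permutes_subset) auto
      show "a \<notin> Z \<union> A" using insert by auto
    qed
    then show ?case using insert by simp
  qed
  from this[of "Z' - Z"] have "cyc Z' p = cyc Z p + card (Z' - Z)"
    using fin sub by (simp add: Un_absorb1)
  moreover have "card (Z' - Z) + card Z = card Z'"
    using fin sub finite_subset[OF sub fin] card_mono[OF fin sub] by (simp add: card_Diff_subset)
  ultimately show ?thesis by simp
qed

lemma cyc_id: "finite Z \<Longrightarrow> cyc Z id = card Z"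
proof -
  have "orbit id x = {x}" for x :: 'a by (simp add: orbit_eq_singleton_iff)
  then show ?thesis by (simp add: cyc_def card_image)
qed

lemma cyc_inv:
  assumes "finite Z" "p permutes Z"
  shows "cyc Z (inv p) = cyc Z p"
  unfolding cyc_def using orbit_inv_eq assms permutation_permutes by (metis image_cong)

lemma cyc_le_card: "finite Z \<Longrightarrow> cyc Z p \<le> card Z"
  by (simp add: cyc_def card_image_le)

text \<open>Every permutation of \<open>insert a S\<close> is uniquely
  \<open>transpose a b \<circ> q\<close>: the choice b = a opens a new cycle and gives the factor
  \<open>N\<close>, each other choice keeps the number of cycles. The ring is general because one
  application takes for \<open>N\<close> a real number found by optimisation.\<close>

lemma sum_pow_cyc:
  fixes N :: "'b::comm_semiring_1"
  assumes "finite S"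
  shows "(\<Sum>p | p permutes S. N ^ cyc S p) = (\<Prod>j<card S. N + of_nat j)"
  using assms
proof (induction S rule: finite_induct)
  case empty
  have "{p. p permutes ({}::'a set)} = {id}" by auto
  then show ?case by (simp add: cyc_def)
next
  case (insert a S)
  have "(\<Sum>p | p permutes insert a S. N ^ cyc (insert a S) p)
      = (\<Sum>b\<in>insert a S. \<Sum>q | q permutes S. N ^ cyc (insert a S) (transpose a b \<circ> q))"
    by (rule sum_over_permutations_insert) (use insert in auto)
  also have "\<dots> = (\<Sum>q | q permutes S. N ^ cyc (insert a S) q)
      + (\<Sum>b\<in>S. \<Sum>q | q permutes S. N ^ cyc (insert a S) (transpose a b \<circ> q))"
    using insert by simp
  also have "(\<Sum>q | q permutes S. N ^ cyc (insert a S) q) = N * (\<Sum>q | q permutes S. N ^ cyc S q)"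
    using insert.hyps by (simp add: cyc_insert_fixed sum_distrib_left)
  also have "(\<Sum>b\<in>S. \<Sum>q | q permutes S. N ^ cyc (insert a S) (transpose a b \<circ> q))
     = (\<Sum>b\<in>S. \<Sum>q | q permutes S. N ^ cyc S q)"
    using insert by (intro sum.cong refl) (simp add: cyc_insert_transpose)
  finally show ?case using insert by (simp add: algebra_simps)
qed

section \<open>Reflection length as the defect \<open>card Z - cyc Z p\<close>\<close>

section \<open>Reflection length\<close>

text \<open>Besides bounding the reflection length from above, this keeps the transpositions inside
  \<open>Z\<close>, as the construction of common transversals demands.\<close>

lemma exists_transps_cyc:
  assumes "finite Z" "p permutes Z"
  shows "\<exists>ts. set ts \<subseteq> Z \<times> Z \<and> (\<forall>(a, b)\<in>set ts. a \<noteq> b) \<and> apply_transps ts = p \<and>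
    length ts + cyc Z p = card Z"
  using assms
proof (induction Z arbitrary: p rule: finite_induct)
  case empty
  then have "p = id" by simp
  then show ?case by (intro exI[of _ "[]"]) (simp add: cyc_def)
next
  case (insert a Z)
  from insert.prems have "p \<in> (\<lambda>(b, p). transpose a b \<circ> p) ` {(b, p). b \<in> insert a Z \<and> p \<in> {p. p permutes Z}}"
    unfolding permutes_insert[of a Z, symmetric] by simp
  then obtain b q where b: "b \<in> insert a Z" and q: "q permutes Z" and p: "p = transpose a b \<circ> q"
    by auto
  from insert.IH[OF q] obtain ts where ts: "set ts \<subseteq> Z \<times> Z" "\<forall>(a, b)\<in>set ts. a \<noteq> b"
    "apply_transps ts = q" "length ts + cyc Z q = card Z" by blast
  show ?case
  proof (cases "b = a")
    case True
    then have "p = q" using p by simp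
    then show ?thesis using ts insert q
      by (intro exI[of _ ts]) (auto simp: cyc_insert_fixed)
  next
    case False
    then have "b \<in> Z" using b by simp
    have "apply_transps ((a, b) # ts) = p" using ts(3) p by simp
    moreover have "length ((a, b) # ts) + cyc (insert a Z) p = card (insert a Z)"
      unfolding p cyc_insert_transpose[OF insert.hyps(1) q insert.hyps(2) \<open>b \<in> Z\<close>]
      using ts(4) insert.hyps by simp
    ultimately show ?thesis using ts(1,2) \<open>b \<in> Z\<close> False
      by (intro exI[of _ "(a, b) # ts"]) auto
  qed
qed

text \<open>The identity has \<open>card Z\<close> cycles, and each transposition lowers the number
  by at most one.\<close>

lemma card_le_cyc_transps:
  assumes "finite Z" "set ts \<subseteq> Z \<times> Z"
  shows "card Z \<le> cyc Z (apply_transps ts) + length ts"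
  using assms(2)
proof (induction ts)
  case Nil
  show ?case unfolding apply_transps_Nil cyc_id[OF assms(1)] by simp
next
  case (Cons t ts)
  have "cyc Z (apply_transps ts) \<le> cyc Z (transpose (fst t) (snd t) \<circ> apply_transps ts) + 1"
    by (rule cyc_transpose_ge) (use Cons.prems assms in \<open>auto intro!: permutes_apply_transps\<close>)
  moreover have "card Z \<le> cyc Z (apply_transps ts) + length ts"
    using Cons by simp
  ultimately show ?case unfolding apply_transps_Cons length_Cons by linarith
qed

lemma ellT_witness:
  assumes "finite Z" "p permutes Z"
  shows "\<exists>ts. length ts = ellT p \<and> (\<forall>(a, b)\<in>set ts. a \<noteq> b) \<and> p = apply_transps ts"
proof -
  from exists_transps_cyc[OF assms] obtain ts where
    "\<forall>(a, b)\<in>set ts. a \<noteq> b" "apply_transps ts = p" by blast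
  then show ?thesis unfolding ellT_def
    by (intro LeastI[where P = "\<lambda>m. \<exists>ts. length ts = m \<and> (\<forall>(a, b)\<in>set ts. a \<noteq> b) \<and> p = apply_transps ts"])
      auto
qed

lemma ellT_plus_cyc:
  assumes fin: "finite Z" and p: "p permutes Z"
  shows "ellT p + cyc Z p = card Z"
proof (rule antisym)
  from exists_transps_cyc[OF assms] obtain ts where ts:
    "\<forall>(a, b)\<in>set ts. a \<noteq> b" "apply_transps ts = p" "length ts + cyc Z p = card Z" by blast
  have "ellT p \<le> length ts" unfolding ellT_def by (rule Least_le) (use ts in auto)
  then show "ellT p + cyc Z p \<le> card Z" using ts by simp
next
  from ellT_witness[OF assms] obtain ts where ts: "length ts = ellT p" "p = apply_transps ts" by blast
  \<comment> \<open>A shortest factorisation may a priori use points outside \<open>Z\<close>; the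
    defect is therefore compared on an enlarged set, where it is the same.\<close>
  define Z' where "Z' = Z \<union> fst ` set ts \<union> snd ` set ts"
  have fin': "finite Z'" using fin by (simp add: Z'_def)
  have "card Z' \<le> cyc Z' p + ellT p"
    using card_le_cyc_transps[OF fin', of ts] ts by (force simp: Z'_def)
  moreover have "cyc Z' p + card Z = cyc Z p + card Z'"
    by (rule cyc_fixed_superset) (use fin' p in \<open>auto simp: Z'_def\<close>)
  ultimately show "card Z \<le> ellT p + cyc Z p" by simp
qed

lemma ellT_compose_le:
  assumes "finite Z" "p permutes Z" "q permutes Z"
  shows "ellT (p \<circ> q) \<le> ellT p + ellT q"
proof -
  from ellT_witness[OF assms(1,2)] obtain ts where
    ts: "length ts = ellT p" "\<forall>(a, b)\<in>set ts. a \<noteq> b" "p = apply_transps ts" by blast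
  from ellT_witness[OF assms(1,3)] obtain us where
    us: "length us = ellT q" "\<forall>(a, b)\<in>set us. a \<noteq> b" "q = apply_transps us" by blast
  have "ellT (p \<circ> q) \<le> length (ts @ us)" unfolding ellT_def
    by (rule Least_le, rule exI[of _ "ts @ us"]) (use ts us in auto)
  then show ?thesis using ts us by simp
qed

lemma card_support_le_ellT:
  assumes "finite Z" "p permutes Z"
  shows "card {x. p x \<noteq> x} \<le> 2 * ellT p"
proof -
  from ellT_witness[OF assms] obtain ts where ts: "length ts = ellT p" "p = apply_transps ts" by blast
  have sub: "{x. apply_transps us x \<noteq> x} \<subseteq> fst ` set us \<union> snd ` set us" for us :: "(nat \<times> nat) list"
    using permutes_not_in[OF permutes_apply_transps[of us "fst ` set us \<union> snd ` set us"]] by force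
  have "card {x. p x \<noteq> x} \<le> card (fst ` set ts \<union> snd ` set ts)"
    using sub[of ts] ts by (intro card_mono) auto
  also have "\<dots> \<le> card (fst ` set ts) + card (snd ` set ts)" by (rule card_Un_le)
  also have "\<dots> \<le> length ts + length ts"
    by (intro add_mono order_trans[OF card_image_le] card_length) auto
  finally show ?thesis using ts by simp
qed

section \<open>Common partial transversals of two cycle partitions\<close>

text \<open>Multiplying by a transposition either refines the orbits, or merges two of them, in which
  case one representative is given up.\<close>

lemma common_transversal:
  assumes fin: "finite Z" and pZ: "p permutes Z" and ts: "set ts \<subseteq> Z \<times> Z"
  shows "\<exists>R\<subseteq>Z. inj_on (orbit p) R \<and> inj_on (orbit (apply_transps ts \<circ> p)) R \<and>
    cyc Z p + cyc Z (apply_transps ts \<circ> p) \<le> length ts + 2 * card R"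
  using ts
proof (induction ts)
  case Nil
  have "\<exists>R. R \<subseteq> Z \<and> inj_on (orbit p) R \<and> orbit p ` Z = orbit p ` R"
    by (rule subset_image_inj[THEN iffD1]) simp
  then obtain R where R: "R \<subseteq> Z" "inj_on (orbit p) R" "orbit p ` Z = orbit p ` R"
    by (elim exE conjE)
  have "cyc Z p = card R" unfolding cyc_def R(3) using R(2) by (rule card_image)
  with R show ?case by (intro exI[of _ R]) simp
next
  case (Cons t ts)
  obtain x y where t: "t = (x, y)" by force
  let ?q = "apply_transps ts \<circ> p"
  have "set ts \<subseteq> Z \<times> Z" using Cons.prems by simp
  from Cons.IH[OF this] obtain R where R: "R \<subseteq> Z" "inj_on (orbit p) R" "inj_on (orbit ?q) R"
    "cyc Z p + cyc Z ?q \<le> length ts + 2 * card R" by (elim exE conjE)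
  have xy: "x \<in> Z" "y \<in> Z" using Cons.prems t by auto
  have qZ: "?q permutes Z"
    using Cons.prems pZ by (intro permutes_compose permutes_apply_transps) auto
  have q: "permutation ?q" using fin qZ permutation_permutes by blast
  have q': "permutation (transpose x y \<circ> ?q)" using q by (rule permutation_transpose_comp)
  have eq: "apply_transps (t # ts) \<circ> p = transpose x y \<circ> ?q" by (simp add: t comp_assoc)
  have fR: "finite R" using R(1) fin by (rule finite_subset)
  show ?case
  proof (cases "y \<in> orbit ?q x")
    case True
    have "inj_on (orbit (transpose x y \<circ> ?q)) R"
    proof (rule inj_onI)
      fix u v assume uv: "u \<in> R" "v \<in> R" "orbit (transpose x y \<circ> ?q) u = orbit (transpose x y \<circ> ?q) v"
      then have "u \<in> orbit (transpose x y \<circ> ?q) v" using permutation_self_in_orbit[OF q'] by blast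
      then have "u \<in> orbit ?q v" using orbit_transpose_subset[OF q True] by blast
      then have "orbit ?q u = orbit ?q v" using orbit_eq_iff[OF q] by blast
      then show "u = v" using R(3) uv by (auto dest: inj_onD)
    qed
    moreover have "cyc Z p + cyc Z (transpose x y \<circ> ?q) \<le> length (t # ts) + 2 * card R"
      using R(4) cyc_transpose_le[OF fin qZ xy] by (simp del: o_apply)
    ultimately show ?thesis unfolding eq using R(1,2) by blast
  next
    case False
    define R' where "R' = R - orbit ?q y"
    have "card (R \<inter> orbit ?q y) \<le> 1"
    proof (rule ccontr)
      assume "\<not> ?thesis"
      then obtain u v where "u \<noteq> v" "u \<in> R \<inter> orbit ?q y" "v \<in> R \<inter> orbit ?q y"
        using card_le_Suc0_iff_eq[of "R \<inter> orbit ?q y"] fR by auto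
      then show False using R(3) orbit_eq_iff[OF q] by (metis IntE inj_onD)
    qed
    moreover have "card R = card R' + card (R \<inter> orbit ?q y)"
      unfolding R'_def using fR card_Diff_subset_Int[of R "orbit ?q y"] card_mono[of R "R \<inter> orbit ?q y"]
      by simp
    ultimately have cR: "card R \<le> card R' + 1" by simp
    have "inj_on (orbit (transpose x y \<circ> ?q)) R'"
    proof (rule inj_onI)
      fix u v assume uv: "u \<in> R'" "v \<in> R'" "orbit (transpose x y \<circ> ?q) u = orbit (transpose x y \<circ> ?q) v"
      have self: "w \<in> orbit ?q w" for w using permutation_self_in_orbit[OF q] .
      have "orbit ?q u = orbit ?q v"
        using uv self[of u] self[of v] orbit_eq_iff[OF q]
        unfolding orbit_transpose_merge[OF q False] R'_def
        by (auto split: if_splits)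
      then show "u = v" using R(3) uv by (auto dest: inj_onD simp: R'_def)
    qed
    moreover have "inj_on (orbit p) R'" using R(2) by (rule inj_on_subset) (auto simp: R'_def)
    moreover have "cyc Z p + cyc Z (transpose x y \<circ> ?q) \<le> length (t # ts) + 2 * card R'"
      using R(4) cR cyc_transpose_merge[OF fin qZ xy False] by simp
    moreover have "R' \<subseteq> Z" using R(1) by (auto simp: R'_def)
    ultimately show ?thesis unfolding eq by blast
  qed
qed

lemma extend_transversal:
  assumes "finite Z" "R \<subseteq> Z" "inj_on g R"
  shows "\<exists>R1. R \<subseteq> R1 \<and> R1 \<subseteq> Z \<and> inj_on g R1 \<and> g ` R1 = g ` Z"
proof -
  have "\<exists>R2. R2 \<subseteq> {z\<in>Z. g z \<notin> g ` R} \<and> inj_on g R2 \<and> g ` {z\<in>Z. g z \<notin> g ` R} = g ` R2"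
    by (rule subset_image_inj[THEN iffD1]) simp
  then obtain R2 where R2: "R2 \<subseteq> {z\<in>Z. g z \<notin> g ` R}" "inj_on g R2" "g ` {z\<in>Z. g z \<notin> g ` R} = g ` R2"
    by (elim exE conjE)
  have "g u \<noteq> g v" if "u \<in> R" "v \<in> R2" for u v
    using R2(1) that by (metis (mono_tags, lifting) imageI mem_Collect_eq subsetD)
  then have "inj_on g (R \<union> R2)" unfolding inj_on_Un using assms R2 by blast
  moreover have "g ` (R \<union> R2) = g ` Z"
    unfolding image_Un R2(3)[symmetric] using assms(2) by blast
  ultimately show ?thesis using assms(2) R2 by (intro exI[of _ "R \<union> R2"]) auto
qed

lemma orbit_invariant:
  assumes "p permutes Z" "x \<in> Z" "\<And>x. x \<in> Z \<Longrightarrow> g (p x) = g x" "y \<in> orbit p x"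
  shows "g y = g x"
  using assms(4)
proof induction
  case base show ?case using assms by simp
next
  case (step y)
  then have "y \<in> Z" using permutes_orbit_subset[OF assms(1,2)] by auto
  then show ?case using step assms by simp
qed

text \<open>The first coordinate of \<open>f\<close> is constant on cycles of \<open>p\<close>, the
  second on cycles of \<open>q\<close>. Completing \<open>R\<close> to transversals
  \<open>R1\<close> and \<open>R2\<close> determines \<open>f\<close>: a point of \<open>R\<close>
  serves one cycle of each kind and receives a full element of \<open>Y\<close>, every other
  representative only one coordinate.\<close>

lemma card_constrained_maps:
  fixes Y :: "('b \<times> 'c) set"
  assumes fin: "finite Z" and p: "p permutes Z" and q: "q permutes Z" and R: "R \<subseteq> Z"
    and ip: "inj_on (orbit p) R" and iq: "inj_on (orbit q) R" and Y: "finite Y"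
  shows "card {f \<in> Z \<rightarrow>\<^sub>E Y. \<forall>x\<in>Z. fst (f (p x)) = fst (f x) \<and> snd (f (q x)) = snd (f x)}
    \<le> card Y ^ card R * card (fst ` Y) ^ (cyc Z p - card R) * card (snd ` Y) ^ (cyc Z q - card R)"
    (is "card ?F \<le> _")
proof -
  obtain R1 where R1: "R \<subseteq> R1" "R1 \<subseteq> Z" "inj_on (orbit p) R1" "orbit p ` R1 = orbit p ` Z"
    using extend_transversal[OF fin R ip] by (elim exE conjE)
  obtain R2 where R2: "R \<subseteq> R2" "R2 \<subseteq> Z" "inj_on (orbit q) R2" "orbit q ` R2 = orbit q ` Z"
    using extend_transversal[OF fin R iq] by (elim exE conjE)
  have fins: "finite R" "finite R1" "finite R2"
    using finite_subset[OF R fin] finite_subset[OF R1(2) fin] finite_subset[OF R2(2) fin] by simp_all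
  have c1: "card (R1 - R) = cyc Z p - card R"
    using R1 fins card_image[OF R1(3)] by (simp add: cyc_def card_Diff_subset)
  have c2: "card (R2 - R) = cyc Z q - card R"
    using R2 fins card_image[OF R2(3)] by (simp add: cyc_def card_Diff_subset)
  define \<Phi> where "\<Phi> f = (restrict f R, restrict (fst \<circ> f) (R1 - R), restrict (snd \<circ> f) (R2 - R))" for f :: "'a \<Rightarrow> 'b \<times> 'c"
  let ?T = "(R \<rightarrow>\<^sub>E Y) \<times> ((R1 - R) \<rightarrow>\<^sub>E fst ` Y) \<times> ((R2 - R) \<rightarrow>\<^sub>E snd ` Y)"
  have pp: "permutation p" "permutation q"
    using permutes_imp_permutation[OF fin p] permutes_imp_permutation[OF fin q] by simp_all
  have "inj_on \<Phi> ?F"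
  proof (rule inj_onI)
    fix f g assume f: "f \<in> ?F" and g: "g \<in> ?F" and eq: "\<Phi> f = \<Phi> g"
    have eR: "f r = g r" if "r \<in> R" for r
    proof -
      have "restrict f R r = restrict g R r" using eq by (simp add: \<Phi>_def)
      then show ?thesis using that by simp
    qed
    have e1: "fst (f r) = fst (g r)" if "r \<in> R1" for r
    proof (cases "r \<in> R")
      case False
      then have "restrict (fst \<circ> f) (R1 - R) r = restrict (fst \<circ> g) (R1 - R) r" using eq by (simp add: \<Phi>_def)
      then show ?thesis using that False by simp
    qed (simp add: eR)
    have e2: "snd (f r) = snd (g r)" if "r \<in> R2" for r
    proof (cases "r \<in> R")
      case False
      then have "restrict (snd \<circ> f) (R2 - R) r = restrict (snd \<circ> g) (R2 - R) r" using eq by (simp add: \<Phi>_def)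
      then show ?thesis using that False by simp
    qed (simp add: eR)
    show "f = g"
    proof
      fix x
      show "f x = g x"
      proof (cases "x \<in> Z")
        case False then show ?thesis using f g by (auto simp: PiE_def extensional_def)
      next
        case True
        obtain r where r: "r \<in> R1" "orbit p x = orbit p r" using R1(4) True by (metis imageE imageI)
        have "r \<in> orbit p x" using r permutation_self_in_orbit[OF pp(1)] by blast
        then have 1: "fst (h r) = fst (h x)" if "h \<in> ?F" for h
          using orbit_invariant[OF p True, of "\<lambda>x. fst (h x)" r] that by auto
        obtain s where s: "s \<in> R2" "orbit q x = orbit q s" using R2(4) True by (metis imageE imageI)
        have "s \<in> orbit q x" using s permutation_self_in_orbit[OF pp(2)] by blast
        then have 2: "snd (h s) = snd (h x)" if "h \<in> ?F" for h
          using orbit_invariant[OF q True, of "\<lambda>x. snd (h x)" s] that by auto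
        show ?thesis using 1[OF f] 1[OF g] 2[OF f] 2[OF g] e1[OF r(1)] e2[OF s(1)]
          by (simp add: prod_eq_iff)
      qed
    qed
  qed
  moreover have "\<Phi> ` ?F \<subseteq> ?T"
  proof
    fix t assume "t \<in> \<Phi> ` ?F"
    then obtain f where f: "f \<in> Z \<rightarrow>\<^sub>E Y" "t = \<Phi> f" by blast
    have "f x \<in> Y" if "x \<in> Z" for x using f that by auto
    then show "t \<in> ?T" unfolding f \<Phi>_def using R R1(2) R2(2) by (auto simp: subset_iff)
  qed
  moreover have "finite ?T" using fins Y by (intro finite_cartesian_product finite_PiE) auto
  ultimately have "card ?F \<le> card ?T" by (intro card_inj_on_le)
  also have "\<dots> = card Y ^ card R * (card (fst ` Y) ^ (cyc Z p - card R) * card (snd ` Y) ^ (cyc Z q - card R))"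
    using fins by (simp add: card_cartesian_product card_PiE c1 c2)
  finally show ?thesis by simp
qed

section \<open>Young subgroups as stabilisers of colourings\<close>

section \<open>Permutation characters of Young subgroups\<close>

definition stab :: "'a set \<Rightarrow> ('a \<Rightarrow> 'b) \<Rightarrow> ('a \<Rightarrow> 'a) set" where
  "stab X C = {\<sigma>. \<sigma> permutes X \<and> (\<forall>x\<in>X. C (\<sigma> x) = C x)}"

text \<open>Types are integer valued: a negative entry leaves no colouring at all, which is the zero
  convention in the determinantal formula.\<close>

definition type_colorings :: "'a set \<Rightarrow> 'b set \<Rightarrow> ('b \<Rightarrow> int) \<Rightarrow> ('a \<Rightarrow> 'b) set" where
  "type_colorings X K t = {C \<in> X \<rightarrow>\<^sub>E K. \<forall>k\<in>K. int (card {x\<in>X. C x = k}) = t k}"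

definition psi :: "'a set \<Rightarrow> nat \<Rightarrow> (nat \<Rightarrow> int) \<Rightarrow> ('a \<Rightarrow> 'a) \<Rightarrow> int" where
  "psi X l a \<sigma> = int (card {B \<in> type_colorings X {..<l} a. \<forall>x\<in>X. B (\<sigma> x) = B x})"

lemma finite_stab: "finite X \<Longrightarrow> finite (stab X C)"
  unfolding stab_def by (rule finite_subset[OF _ finite_permutations]) auto

lemma finite_type_colorings: "finite X \<Longrightarrow> finite K \<Longrightarrow> finite (type_colorings X K t)"
  unfolding type_colorings_def by (rule finite_subset[OF _ finite_PiE]) auto

lemma young_perm_char_eq_psi:
  "young_perm_char n (map a [0..<l]) \<sigma> = psi {1..n} l a \<sigma>"
proof (cases "\<exists>i<l. a i < 0")
  case True
  then obtain i where i: "i < l" "a i < 0" by blast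
  then have "type_colorings {1..n} {..<l} a = {}"
    unfolding type_colorings_def by force
  then show ?thesis using True by (auto simp: young_perm_char_def psi_def)
next
  case False
  then have "\<not> (\<exists>x\<in>set (map a [0..<l]). x < 0)" by auto
  moreover have "{B \<in> {1..n} \<rightarrow>\<^sub>E {0..<length (map a [0..<l])}.
              (\<forall>i<length (map a [0..<l]). int (card {x\<in>{1..n}. B x = i}) = map a [0..<l] ! i) \<and>
              (\<forall>x\<in>{1..n}. B (\<sigma> x) = B x)} =
     {B \<in> type_colorings {1..n} {..<l} a. \<forall>x\<in>{1..n}. B (\<sigma> x) = B x}"
    by (auto simp: type_colorings_def atLeast0LessThan)
  ultimately show ?thesis unfolding young_perm_char_def psi_def by simp
qed

lemma type_colorings_cong:
  "(\<And>k. k \<in> K \<Longrightarrow> s k = t k) \<Longrightarrow> type_colorings X K s = type_colorings X K t"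
  by (auto simp: type_colorings_def)

lemma psi_cong: "(\<And>i. i < l \<Longrightarrow> a i = b i) \<Longrightarrow> psi X l a \<sigma> = psi X l b \<sigma>"
  unfolding psi_def by (subst type_colorings_cong[of _ a b]) auto

lemma psi_neg:
  assumes "i < l" "a i < 0"
  shows "psi X l a \<sigma> = 0"
proof -
  have "type_colorings X {..<l} a = {}"
    unfolding type_colorings_def using assms by force
  then show ?thesis by (simp add: psi_def)
qed

text \<open>Renaming the colours by \<open>w\<close> is a bijection of the invariant colourings;
  this symmetry is what makes the alternating sums below behave like determinants.\<close>

lemma psi_permute:
  assumes w: "w permutes {..<l}" and \<sigma>X: "\<sigma> permutes X"
  shows "psi X l (a \<circ> w) \<sigma> = psi X l a \<sigma>"
proof -
  have \<sigma>: "\<forall>x\<in>X. \<sigma> x \<in> X" using permutes_in_image[OF \<sigma>X] by simp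
  have w': "inv w permutes {..<l}" using w by (rule permutes_inv)
  have "bij_betw (\<lambda>B. restrict (w \<circ> B) X)
      {B \<in> type_colorings X {..<l} (a \<circ> w). \<forall>x\<in>X. B (\<sigma> x) = B x}
      {B \<in> type_colorings X {..<l} a. \<forall>x\<in>X. B (\<sigma> x) = B x}"
  proof (rule bij_betw_byWitness[where f' = "\<lambda>B. restrict (inv w \<circ> B) X"], goal_cases)
    case 1
    show ?case using permutes_inverses[OF w]
      by (auto simp: type_colorings_def PiE_def extensional_def fun_eq_iff restrict_def)
  next
    case 2
    show ?case using permutes_inverses[OF w]
      by (auto simp: type_colorings_def PiE_def extensional_def fun_eq_iff restrict_def)
  next
    case 3
    show ?case
    proof
      fix B' assume "B' \<in> (\<lambda>B. restrict (w \<circ> B) X) `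
        {B \<in> type_colorings X {..<l} (a \<circ> w). \<forall>x\<in>X. B (\<sigma> x) = B x}"
      then obtain B where B': "B' = restrict (w \<circ> B) X" and B: "B \<in> X \<rightarrow>\<^sub>E {..<l}"
        "\<And>k. k < l \<Longrightarrow> int (card {x\<in>X. B x = k}) = a (w k)" "\<forall>x\<in>X. B (\<sigma> x) = B x"
        by (auto simp: type_colorings_def)
      have "int (card {x\<in>X. B' x = k}) = a k" if k: "k < l" for k
      proof -
        have "{x\<in>X. B' x = k} = {x\<in>X. B x = inv w k}"
          using permutes_inverses[OF w] by (auto simp: B')
        moreover have "inv w k < l" using permutes_in_image[OF w', of k] k by simp
        ultimately show ?thesis using B(2) permutes_inverses[OF w] by simp
      qed
      moreover have "B' \<in> X \<rightarrow>\<^sub>E {..<l}"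
        using B(1) permutes_in_image[OF w] by (fastforce simp: B')
      ultimately show "B' \<in> {B \<in> type_colorings X {..<l} a. \<forall>x\<in>X. B (\<sigma> x) = B x}"
        using B(3) \<sigma> by (simp add: type_colorings_def B')
    qed
  next
    case 4
    show ?case
    proof
      fix B' assume "B' \<in> (\<lambda>B. restrict (inv w \<circ> B) X) `
        {B \<in> type_colorings X {..<l} a. \<forall>x\<in>X. B (\<sigma> x) = B x}"
      then obtain B where B': "B' = restrict (inv w \<circ> B) X" and B: "B \<in> X \<rightarrow>\<^sub>E {..<l}"
        "\<And>k. k < l \<Longrightarrow> int (card {x\<in>X. B x = k}) = a k" "\<forall>x\<in>X. B (\<sigma> x) = B x"
        by (auto simp: type_colorings_def)
      have "int (card {x\<in>X. B' x = k}) = a (w k)" if k: "k < l" for k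
      proof -
        have "{x\<in>X. B' x = k} = {x\<in>X. B x = w k}"
          using permutes_inverses[OF w] by (auto simp: B')
        moreover have "w k < l" using permutes_in_image[OF w, of k] k by simp
        ultimately show ?thesis using B(2) by simp
      qed
      moreover have "B' \<in> X \<rightarrow>\<^sub>E {..<l}"
        using B(1) permutes_in_image[OF w'] by (fastforce simp: B')
      ultimately show "B' \<in> {B \<in> type_colorings X {..<l} (a \<circ> w). \<forall>x\<in>X. B (\<sigma> x) = B x}"
        using B(3) \<sigma> by (simp add: type_colorings_def B')
    qed
  qed
  from bij_betw_same_card[OF this] show ?thesis by (simp add: psi_def)
qed

lemma exists_type_coloring:
  assumes "finite K" "finite X" "\<And>k. k \<in> K \<Longrightarrow> t k \<ge> 0" "(\<Sum>k\<in>K. t k) = int (card X)"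
  shows "\<exists>C. C \<in> type_colorings X K t"
  using assms
proof (induction K arbitrary: X rule: finite_induct)
  case empty
  then have "X = {}" by simp
  then show ?case by (simp add: type_colorings_def)
next
  case (insert a K)
  have le: "nat (t a) \<le> card X"
    using insert sum_nonneg[of K t] by simp
  then obtain W where W: "W \<subseteq> X" "card W = nat (t a)" "finite W"
    using obtain_subset_with_card_n by metis
  have "card (X - W) = card X - nat (t a)" using W by (simp add: card_Diff_subset)
  then have "(\<Sum>k\<in>K. t k) = int (card (X - W))" using insert le by simp
  then obtain C where C: "C \<in> type_colorings (X - W) K t"
    using insert.IH[of "X - W"] insert.prems by auto
  define C' where "C' = (\<lambda>x. if x \<in> W then a else C x)"
  have "C' \<in> X \<rightarrow>\<^sub>E insert a K"
    using C W unfolding type_colorings_def C'_def by (auto simp: PiE_def extensional_def Pi_def)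
  moreover have "int (card {x\<in>X. C' x = k}) = t k" if k: "k \<in> insert a K" for k
  proof (cases "k = a")
    case True
    have "{x\<in>X. C' x = k} = W"
      using C W insert.hyps True unfolding type_colorings_def C'_def by (auto simp: PiE_def Pi_def)
    then show ?thesis using W True insert.prems by simp
  next
    case False
    then have "{x\<in>X. C' x = k} = {x\<in>X - W. C x = k}" unfolding C'_def by auto
    then show ?thesis using C False k by (simp add: type_colorings_def)
  qed
  ultimately show ?case by (auto simp: type_colorings_def)
qed

text \<open>Colourings of one type have equal multisets of colours, hence differ by a permutation of
  the points: the action on them is transitive.\<close>

lemma same_type_conjugate:
  assumes X: "finite X" and K: "finite K"
    and C: "C \<in> type_colorings X K t" and C0: "C0 \<in> type_colorings X K t"
  shows "\<exists>g. g permutes X \<and> (\<forall>x\<in>X. C x = C0 (g x))"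
proof -
  have "image_mset C (mset_set X) = image_mset C0 (mset_set X)"
  proof (rule multiset_eqI)
    fix k
    have cnt: "count (image_mset D (mset_set X)) k = card {x\<in>X. D x = k}" for D :: "'a \<Rightarrow> 'b"
      using X by (simp add: count_image_mset_eq_card_vimage)
    show "count (image_mset C (mset_set X)) k = count (image_mset C0 (mset_set X)) k"
    proof (cases "k \<in> K")
      case True
      then have "int (card {x\<in>X. C x = k}) = int (card {x\<in>X. C0 x = k})"
        using C C0 by (simp add: type_colorings_def)
      then show ?thesis unfolding cnt by simp
    next
      case False
      then have "{x\<in>X. C x = k} = {}" "{x\<in>X. C0 x = k} = {}"
        using C C0 by (auto simp: type_colorings_def PiE_def Pi_def)
      then show ?thesis unfolding cnt by (simp only:)
    qed
  qed
  from image_mset_eq_implies_permutes[OF X this] show ?thesis by blast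
qed

lemma type_colorings_comp:
  assumes g: "g permutes X" and C: "C \<in> type_colorings X K t"
  shows "restrict (C \<circ> g) X \<in> type_colorings X K t"
proof -
  have "card {x\<in>X. restrict (C \<circ> g) X x = k} = card {x\<in>X. C x = k}" for k
  proof -
    have "g ` {x\<in>X. C (g x) = k} = {x\<in>X. C x = k}"
    proof (intro equalityI subsetI)
      fix y assume "y \<in> {x\<in>X. C x = k}"
      then have "inv g y \<in> {x\<in>X. C (g x) = k}" "y = g (inv g y)"
        using permutes_inverses[OF g] permutes_in_image[OF permutes_inv[OF g]] by auto
      then show "y \<in> g ` {x\<in>X. C (g x) = k}" by blast
    qed (use permutes_in_image[OF g] in auto)
    moreover have "{x\<in>X. restrict (C \<circ> g) X x = k} = {x\<in>X. C (g x) = k}" by auto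
    ultimately show ?thesis using card_image[OF permutes_inj_on[OF g]] by metis
  qed
  then show ?thesis using C permutes_in_image[OF g]
    by (auto simp: type_colorings_def PiE_def Pi_def)
qed

text \<open>Orbit counting for the transitive action of the symmetric group on colourings of given type.\<close>

lemma sum_card_stab:
  assumes X: "finite X" and K: "finite K" and ne: "type_colorings X K t \<noteq> {}"
  shows "(\<Sum>C\<in>type_colorings X K t. card (stab X C)) = fact (card X)"
proof -
  from ne obtain C0 where C0: "C0 \<in> type_colorings X K t" by blast
  let ?P = "{g. g permutes X}"
  define h where "h g = restrict (C0 \<circ> g) X" for g
  have hT: "h g \<in> type_colorings X K t" if "g permutes X" for g
    unfolding h_def by (rule type_colorings_comp[OF that C0])
  have "card (stab X C) = card {g\<in>?P. h g = C}" if C: "C \<in> type_colorings X K t" for C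
  proof -
    obtain g0 where g0: "g0 permutes X" "\<And>x. x \<in> X \<Longrightarrow> C x = C0 (g0 x)"
      using same_type_conjugate[OF X K C C0] by blast
    have ext: "C \<in> extensional X" using C by (simp add: type_colorings_def PiE_def)
    have hC: "h g = C \<longleftrightarrow> (\<forall>x\<in>X. C0 (g x) = C x)" for g
      using ext by (auto simp: h_def fun_eq_iff restrict_def extensional_def)
    \<comment> \<open>The permutations that carry \<open>C0\<close> to \<open>C\<close> form a coset
      of the stabiliser of \<open>C\<close>.\<close>
    have "bij_betw (\<lambda>\<sigma>. g0 \<circ> \<sigma>) (stab X C) {g\<in>?P. h g = C}"
    proof (rule bij_betw_byWitness[where f' = "\<lambda>g. inv g0 \<circ> g"])
      show "\<forall>\<sigma>\<in>stab X C. inv g0 \<circ> (g0 \<circ> \<sigma>) = \<sigma>"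
        using permutes_inv_o[OF g0(1)] by (simp add: o_assoc)
      show "\<forall>g\<in>{g\<in>?P. h g = C}. g0 \<circ> (inv g0 \<circ> g) = g"
        using permutes_inv_o[OF g0(1)] by (simp add: o_assoc)
      show "(\<lambda>\<sigma>. g0 \<circ> \<sigma>) ` stab X C \<subseteq> {g\<in>?P. h g = C}"
        unfolding hC using g0 by (auto simp: stab_def permutes_compose permutes_in_image simp flip: g0(2))
      show "(\<lambda>g. inv g0 \<circ> g) ` {g\<in>?P. h g = C} \<subseteq> stab X C"
        unfolding hC using g0 permutes_inverses[OF g0(1)] permutes_in_image[OF permutes_inv[OF g0(1)]]
        by (auto simp: stab_def permutes_compose permutes_inv permutes_in_image)
    qed
    then show ?thesis by (rule bij_betw_same_card)
  qed
  then have "(\<Sum>C\<in>type_colorings X K t. card (stab X C)) =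
    (\<Sum>C\<in>type_colorings X K t. \<Sum>g\<in>{g\<in>?P. h g = C}. 1)" by simp
  also have "\<dots> = (\<Sum>g\<in>?P. 1)"
    by (rule sum.group) (use X K hT finite_type_colorings finite_permutations in auto)
  finally show ?thesis using card_permutations[OF refl X] by simp
qed

text \<open>Multiplication by the transposition of two equally coloured points is a sign-reversing
  involution of the stabiliser. The two forms serve the left factor (column permutations) and the
  right factor (row permutations) of a product q p.\<close>

lemma sum_sign_cancel:
  assumes X: "finite X" and xy: "x \<in> X" "y \<in> X" "x \<noteq> y" "C x = C y"
  shows sum_sign_cancel_left: "(\<And>q. f (transpose x y \<circ> q) = f q) \<Longrightarrow> (\<Sum>q\<in>stab X C. sign q * f q) = (0::int)"
    and sum_sign_cancel_right: "(\<And>q. q permutes X \<Longrightarrow> f (q \<circ> transpose x y) = f q) \<Longrightarrow> (\<Sum>q\<in>stab X C. sign q * f q) = (0::int)"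
proof -
  let ?t = "transpose x y"
  have t: "?t permutes X" using xy by (simp add: permutes_swap_id)
  have Ct: "C (?t z) = C z" for z using xy by (simp add: transpose_def)
  have tX: "?t z \<in> X \<longleftrightarrow> z \<in> X" for z using permutes_in_image[OF t] .
  have perm: "permutation q" if "q \<in> stab X C" for q
    using that permutes_imp_permutation[OF X] by (auto simp: stab_def)
  have l: "?t \<circ> q \<in> stab X C" if "q \<in> stab X C" for q
    using that t Ct unfolding stab_def by (simp add: permutes_compose)
  have r: "q \<circ> ?t \<in> stab X C" if "q \<in> stab X C" for q
    using that t Ct tX unfolding stab_def by (simp add: permutes_compose)
  have sg: "sign (?t \<circ> q) = - sign q" "sign (q \<circ> ?t) = - sign q" if "q \<in> stab X C" for q
    using perm[OF that] xy by (simp_all add: sign_compose permutation_swap_id sign_swap_id)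
  {
    assume f: "\<And>q. f (?t \<circ> q) = f q"
    have "(\<Sum>q\<in>stab X C. sign q * f q) = (\<Sum>q\<in>stab X C. sign (?t \<circ> q) * f (?t \<circ> q))"
      by (rule sum.reindex_bij_witness[of _ "\<lambda>q. ?t \<circ> q" "\<lambda>q. ?t \<circ> q"]) (simp_all add: l o_assoc)
    also have "\<dots> = (\<Sum>q\<in>stab X C. - (sign q * f q))"
      by (rule sum.cong) (simp_all only: f sg mult_minus_left)
    finally show "(\<Sum>q\<in>stab X C. sign q * f q) = 0" by (simp add: sum_negf)
  }
  {
    assume f: "\<And>q. q permutes X \<Longrightarrow> f (q \<circ> ?t) = f q"
    have "(\<Sum>q\<in>stab X C. sign q * f q) = (\<Sum>q\<in>stab X C. sign (q \<circ> ?t) * f (q \<circ> ?t))"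
      by (rule sum.reindex_bij_witness[of _ "\<lambda>q. q \<circ> ?t" "\<lambda>q. q \<circ> ?t"]) (simp_all add: r comp_assoc)
    also have "\<dots> = (\<Sum>q\<in>stab X C. - (sign q * f q))"
    proof (rule sum.cong[OF refl])
      fix q assume q: "q \<in> stab X C"
      then have "f (q \<circ> ?t) = f q" by (intro f) (simp add: stab_def)
      then show "sign (q \<circ> ?t) * f (q \<circ> ?t) = - (sign q * f q)" using sg(2)[OF q] by (simp only: mult_minus_left)
    qed
    finally show "(\<Sum>q\<in>stab X C. sign q * f q) = 0" by (simp add: sum_negf)
  }
qed

lemma stab_inj:
  assumes "inj_on C X"
  shows "stab X C = {id}"
proof -
  have "\<sigma> = id" if "\<sigma> \<in> stab X C" for \<sigma>
  proof
    fix x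
    show "\<sigma> x = id x"
    proof (cases "x \<in> X")
      case True then show ?thesis using that assms
        by (auto simp: stab_def permutes_in_image dest: inj_onD)
    next
      case False then show ?thesis using that by (auto simp: stab_def permutes_not_in)
    qed
  qed
  then show ?thesis by (auto simp: stab_def permutes_id)
qed

section \<open>Contingency tables\<close>

section \<open>Matrices with prescribed margins\<close>

text \<open>In a matrix \<open>t\<close>, the entry in row i and column j is \<open>t j i\<close>.
  With \<open>U = UNIV\<close> all nonnegative matrices are counted, with \<open>U = {0, 1}\<close>
  the 0-1 matrices; both share the recursion over columns. The bound by \<open>c\<close> makes
  finiteness immediate.\<close>

definition columns :: "int set \<Rightarrow> nat \<Rightarrow> int \<Rightarrow> (nat \<Rightarrow> int) set" where
  "columns U l c = {v \<in> {..<l} \<rightarrow>\<^sub>E {u\<in>U. 0 \<le> u \<and> u \<le> c}. (\<Sum>i<l. v i) = c}"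

definition matrices :: "int set \<Rightarrow> nat \<Rightarrow> (nat \<Rightarrow> int) \<Rightarrow> nat \<Rightarrow> (nat \<Rightarrow> int) \<Rightarrow> (nat \<Rightarrow> nat \<Rightarrow> int) set" where
  "matrices U l a m b = {t \<in> (\<Pi>\<^sub>E j\<in>{..<m}. columns U l (b j)). \<forall>i<l. (\<Sum>j<m. t j i) = a i}"

lemma finite_columns: "finite (columns U l c)"
proof -
  have "finite {u\<in>U. 0 \<le> u \<and> u \<le> c}" by (rule finite_subset[of _ "{0..c}"]) auto
  then show ?thesis unfolding columns_def
    by (intro finite_subset[OF _ finite_PiE[of "{..<l}" "\<lambda>_. {u\<in>U. 0 \<le> u \<and> u \<le> c}"]]) auto
qed

lemma finite_matrices: "finite (matrices U l a m b)"
  unfolding matrices_def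
  by (rule finite_subset[OF _ finite_PiE[of "{..<m}" "\<lambda>j. columns U l (b j)"]])
    (auto simp: finite_columns)

lemma card_matrices_0: "card (matrices U l a 0 b) = (if \<forall>i<l. a i = 0 then 1 else 0)"
  by (auto simp: matrices_def)

lemma card_matrices_Suc:
  "card (matrices U l a (Suc m) b) =
    (\<Sum>v\<in>columns U l (b m). card (matrices U l (\<lambda>i. a i - v i) m b))"
proof -
  have "bij_betw (\<lambda>t. (t m, restrict t {..<m})) (matrices U l a (Suc m) b)
      (Sigma (columns U l (b m)) (\<lambda>v. matrices U l (\<lambda>i. a i - v i) m b))"
  proof (rule bij_betw_byWitness[where f' = "\<lambda>(v, t). t(m := v)"], goal_cases)
    case 1
    then show ?case
      by (auto simp: matrices_def fun_eq_iff PiE_def extensional_def restrict_def)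
  next
    case 2
    then show ?case
      by (auto simp: matrices_def fun_eq_iff PiE_def extensional_def restrict_def)
  next
    case 3
    then show ?case
      by (auto simp: matrices_def PiE_def Pi_def algebra_simps)
  next
    case 4
    then show ?case
      by (auto simp: matrices_def PiE_def Pi_def extensional_def less_Suc_eq algebra_simps)
  qed
  then have "card (matrices U l a (Suc m) b) =
    card (Sigma (columns U l (b m)) (\<lambda>v. matrices U l (\<lambda>i. a i - v i) m b))"
    by (rule bij_betw_same_card)
  then show ?thesis by (simp add: card_SigmaI finite_columns finite_matrices)
qed

lemma matrices_01_iff:
  assumes "t \<in> matrices UNIV l a m b"
  shows "t \<in> matrices {0, 1} l a m b \<longleftrightarrow> (\<forall>j<m. \<forall>i<l. t j i \<le> 1)"
proof
  assume "t \<in> matrices {0, 1} l a m b"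
  then show "\<forall>j<m. \<forall>i<l. t j i \<le> 1"
    by (fastforce simp: matrices_def columns_def PiE_def Pi_def)
next
  assume le: "\<forall>j<m. \<forall>i<l. t j i \<le> 1"
  have "t j \<in> columns {0, 1} l (b j)" if "j < m" for j
  proof -
    have "t j \<in> columns UNIV l (b j)" using assms that by (auto simp: matrices_def)
    moreover have "t j i = 0 \<or> t j i = 1" if "i < l" for i
      using calculation le that \<open>j < m\<close> by (fastforce simp: columns_def PiE_def Pi_def)
    ultimately show ?thesis by (auto simp: columns_def PiE_def Pi_def)
  qed
  then show "t \<in> matrices {0, 1} l a m b" using assms by (auto simp: matrices_def PiE_def Pi_def)
qed

lemma matrices_01_subset: "matrices {0, 1} l a m b \<subseteq> matrices UNIV l a m b"
  by (auto simp: matrices_def columns_def PiE_def Pi_def)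

section \<open>Inner products of permutation characters\<close>

definition joint_colorings :: "'a set \<Rightarrow> nat \<Rightarrow> (nat \<Rightarrow> int) \<Rightarrow> nat \<Rightarrow> (nat \<Rightarrow> int) \<Rightarrow> ('a \<Rightarrow> nat \<times> nat) set" where
  "joint_colorings X l a m b = {C \<in> X \<rightarrow>\<^sub>E {..<l} \<times> {..<m}.
     restrict (fst \<circ> C) X \<in> type_colorings X {..<l} a \<and>
     restrict (snd \<circ> C) X \<in> type_colorings X {..<m} b}"

lemma finite_joint_colorings: "finite X \<Longrightarrow> finite (joint_colorings X l a m b)"
  unfolding joint_colorings_def
  by (rule finite_subset[OF _ finite_PiE[of X "\<lambda>_. {..<l} \<times> {..<m}"]]) auto

text \<open>A pair of invariant colourings is one invariant colouring by pairs.\<close>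

lemma psi_mult:
  assumes \<sigma>: "\<sigma> permutes X"
  shows "psi X l a \<sigma> * psi X m b \<sigma> = int (card {C \<in> joint_colorings X l a m b. \<sigma> \<in> stab X C})"
proof -
  have sX: "\<sigma> x \<in> X \<longleftrightarrow> x \<in> X" for x using permutes_in_image[OF \<sigma>] .
  let ?A = "{B \<in> type_colorings X {..<l} a. \<forall>x\<in>X. B (\<sigma> x) = B x}"
  let ?B = "{B \<in> type_colorings X {..<m} b. \<forall>x\<in>X. B (\<sigma> x) = B x}"
  have ext: "A \<in> extensional X" if "A \<in> type_colorings X K c" for A :: "'a \<Rightarrow> nat" and K c
    using that by (simp add: type_colorings_def PiE_def)
  have r1: "restrict (fst \<circ> restrict (\<lambda>x. (A x, B x)) X) X = A" if "A \<in> extensional X" for A B :: "'a \<Rightarrow> nat"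
    using that by (auto simp: fun_eq_iff restrict_def extensional_def)
  have r2: "restrict (snd \<circ> restrict (\<lambda>x. (A x, B x)) X) X = B" if "B \<in> extensional X" for A B :: "'a \<Rightarrow> nat"
    using that by (auto simp: fun_eq_iff restrict_def extensional_def)
  have "bij_betw (\<lambda>(A, B). restrict (\<lambda>x. (A x, B x)) X) (?A \<times> ?B)
    {C \<in> joint_colorings X l a m b. \<sigma> \<in> stab X C}"
  proof (rule bij_betw_byWitness[where f' = "\<lambda>C. (restrict (fst \<circ> C) X, restrict (snd \<circ> C) X)"], goal_cases)
    case 1
    show ?case using ext r1 r2 by auto
  next
    case 2
    show ?case by (auto simp: joint_colorings_def fun_eq_iff restrict_def PiE_def extensional_def)
  next
    case 3
    show ?case
    proof (intro subsetI, elim imageE, clarify)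
      fix A B assume A: "A \<in> type_colorings X {..<l} a" "\<forall>x\<in>X. A (\<sigma> x) = A x"
        and B: "B \<in> type_colorings X {..<m} b" "\<forall>x\<in>X. B (\<sigma> x) = B x"
      have "restrict (\<lambda>x. (A x, B x)) X \<in> X \<rightarrow>\<^sub>E {..<l} \<times> {..<m}"
        using A B by (auto simp: type_colorings_def)
      moreover have "\<sigma> \<in> stab X (restrict (\<lambda>x. (A x, B x)) X)"
        using A B \<sigma> sX by (simp add: stab_def)
      ultimately show "restrict (\<lambda>x. (A x, B x)) X \<in> joint_colorings X l a m b \<and>
          \<sigma> \<in> stab X (restrict (\<lambda>x. (A x, B x)) X)"
        using A B ext r1 r2 by (simp add: joint_colorings_def)
    qed
  next
    case 4
    show ?case using sX by (auto simp: joint_colorings_def stab_def)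
  qed
  then have "card (?A \<times> ?B) = card {C \<in> joint_colorings X l a m b. \<sigma> \<in> stab X C}"
    by (rule bij_betw_same_card)
  then show ?thesis by (simp add: psi_def card_cartesian_product flip: of_nat_mult)
qed

lemma sum_psi_mult:
  assumes X: "finite X"
  shows "(\<Sum>\<sigma> | \<sigma> permutes X. g \<sigma> * (psi X l a \<sigma> * psi X m b \<sigma>)) =
    (\<Sum>C\<in>joint_colorings X l a m b. \<Sum>\<sigma>\<in>stab X C. g \<sigma>)"
proof -
  let ?P = "{\<sigma>. \<sigma> permutes X}" and ?J = "joint_colorings X l a m b"
  have fP: "finite ?P" using X by (rule finite_permutations)
  have fJ: "finite ?J" using X by (rule finite_joint_colorings)
  have "(\<Sum>\<sigma>\<in>?P. g \<sigma> * (psi X l a \<sigma> * psi X m b \<sigma>)) =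
      (\<Sum>\<sigma>\<in>?P. \<Sum>C\<in>?J. if \<sigma> \<in> stab X C then g \<sigma> else 0)"
  proof (rule sum.cong[OF refl])
    fix \<sigma> assume "\<sigma> \<in> ?P"
    then have "g \<sigma> * (psi X l a \<sigma> * psi X m b \<sigma>) = (\<Sum>C\<in>{C\<in>?J. \<sigma> \<in> stab X C}. g \<sigma>)"
      by (simp add: psi_mult)
    also have "\<dots> = (\<Sum>C\<in>?J. if \<sigma> \<in> stab X C then g \<sigma> else 0)"
      using fJ by (simp add: sum.If_cases Int_def)
    finally show "g \<sigma> * (psi X l a \<sigma> * psi X m b \<sigma>) = (\<Sum>C\<in>?J. if \<sigma> \<in> stab X C then g \<sigma> else 0)" .
  qed
  also have "\<dots> = (\<Sum>C\<in>?J. \<Sum>\<sigma>\<in>?P. if \<sigma> \<in> stab X C then g \<sigma> else 0)" by (rule sum.swap)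
  also have "\<dots> = (\<Sum>C\<in>?J. \<Sum>\<sigma>\<in>stab X C. g \<sigma>)"
  proof (rule sum.cong[OF refl])
    fix C
    have "{x. x permutes X \<and> x \<in> stab X C} = stab X C" by (auto simp: stab_def)
    then show "(\<Sum>\<sigma>\<in>?P. if \<sigma> \<in> stab X C then g \<sigma> else 0) = (\<Sum>\<sigma>\<in>stab X C. g \<sigma>)"
      using fP by (simp add: sum.If_cases Int_def)
  qed
  finally show ?thesis .
qed

text \<open>The contingency table of a pair of colourings, with the column index first so that it
  lies in \<open>matrices\<close>.\<close>

definition joint_type :: "'a set \<Rightarrow> nat \<Rightarrow> nat \<Rightarrow> ('a \<Rightarrow> nat \<times> nat) \<Rightarrow> nat \<Rightarrow> nat \<Rightarrow> int" where
  "joint_type X l m C = (\<lambda>j\<in>{..<m}. \<lambda>i\<in>{..<l}. int (card {x\<in>X. C x = (i, j)}))"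

lemma card_fiber_sum:
  fixes C :: "'a \<Rightarrow> nat \<times> nat"
  assumes X: "finite X" and C: "C \<in> X \<rightarrow> {..<l} \<times> {..<m}"
  shows "j < m \<Longrightarrow> (\<Sum>i<l. card {x\<in>X. C x = (i, j)}) = card {x\<in>X. snd (C x) = j}"
    and "i < l \<Longrightarrow> (\<Sum>j<m. card {x\<in>X. C x = (i, j)}) = card {x\<in>X. fst (C x) = i}"
proof -
  assume j: "j < m"
  have "{x\<in>X. snd (C x) = j} = (\<Union>i\<in>{..<l}. {x\<in>X. C x = (i, j)})"
    using C j by (auto simp: Pi_def prod_eq_iff)
  then show "(\<Sum>i<l. card {x\<in>X. C x = (i, j)}) = card {x\<in>X. snd (C x) = j}"
    using X by (simp, subst card_UN_disjoint) auto
next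
  assume i: "i < l"
  have "{x\<in>X. fst (C x) = i} = (\<Union>j\<in>{..<m}. {x\<in>X. C x = (i, j)})"
    using C i by (auto simp: Pi_def prod_eq_iff)
  then show "(\<Sum>j<m. card {x\<in>X. C x = (i, j)}) = card {x\<in>X. fst (C x) = i}"
    using X by (simp, subst card_UN_disjoint) auto
qed

lemma restrict_type_iff:
  fixes C :: "'a \<Rightarrow> nat \<times> nat"
  assumes C: "C \<in> X \<rightarrow>\<^sub>E {..<l} \<times> {..<m}"
  shows "restrict (fst \<circ> C) X \<in> type_colorings X {..<l} a \<longleftrightarrow>
      (\<forall>i<l. int (card {x\<in>X. fst (C x) = i}) = a i)"
    and "restrict (snd \<circ> C) X \<in> type_colorings X {..<m} b \<longleftrightarrow>
      (\<forall>j<m. int (card {x\<in>X. snd (C x) = j}) = b j)"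
proof -
  have e: "{x\<in>X. restrict (g \<circ> C) X x = k} = {x\<in>X. g (C x) = k}"
    for g :: "nat \<times> nat \<Rightarrow> nat" and k by auto
  have "restrict (fst \<circ> C) X \<in> X \<rightarrow>\<^sub>E {..<l}" "restrict (snd \<circ> C) X \<in> X \<rightarrow>\<^sub>E {..<m}"
    using C by (auto simp: PiE_def Pi_def mem_Times_iff)
  then show "restrict (fst \<circ> C) X \<in> type_colorings X {..<l} a \<longleftrightarrow>
      (\<forall>i<l. int (card {x\<in>X. fst (C x) = i}) = a i)"
    and "restrict (snd \<circ> C) X \<in> type_colorings X {..<m} b \<longleftrightarrow>
      (\<forall>j<m. int (card {x\<in>X. snd (C x) = j}) = b j)"
    by (auto simp: type_colorings_def cong: conj_cong)
qed

lemma joint_type_in_matrices: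
  assumes X: "finite X" and C: "C \<in> joint_colorings X l a m b"
  shows "joint_type X l m C \<in> matrices UNIV l a m b"
proof -
  have CE: "C \<in> X \<rightarrow>\<^sub>E {..<l} \<times> {..<m}" and
    ca: "\<And>i. i < l \<Longrightarrow> int (card {x\<in>X. fst (C x) = i}) = a i" and
    cb: "\<And>j. j < m \<Longrightarrow> int (card {x\<in>X. snd (C x) = j}) = b j"
    using C restrict_type_iff[of C X l m] by (auto simp: joint_colorings_def)
  have CP: "C \<in> X \<rightarrow> {..<l} \<times> {..<m}" using CE by auto
  have "joint_type X l m C j \<in> columns UNIV l (b j)" if j: "j < m" for j
  proof -
    have s: "(\<Sum>i<l. int (card {x\<in>X. C x = (i, j)})) = b j"
      using card_fiber_sum(1)[OF X CP j] cb[OF j] by (metis of_nat_sum)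
    moreover have "int (card {x\<in>X. C x = (i, j)}) \<le> b j" if "i < l" for i
      unfolding s[symmetric] using that by (intro member_le_sum) auto
    ultimately show ?thesis using j by (auto simp: joint_type_def columns_def)
  qed
  moreover have "(\<Sum>j<m. joint_type X l m C j i) = a i" if i: "i < l" for i
    using card_fiber_sum(2)[OF X CP i] ca[OF i] i by (simp add: joint_type_def flip: of_nat_sum)
  ultimately show ?thesis by (auto simp: matrices_def joint_type_def)
qed

lemma joint_type_fiber:
  assumes X: "finite X" and t: "t \<in> matrices UNIV l a m b"
  shows "{C \<in> joint_colorings X l a m b. joint_type X l m C = t} =
    type_colorings X ({..<l} \<times> {..<m}) (\<lambda>(i, j). t j i)"
proof (intro set_eqI iffI)
  fix C assume "C \<in> {C \<in> joint_colorings X l a m b. joint_type X l m C = t}"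
  then show "C \<in> type_colorings X ({..<l} \<times> {..<m}) (\<lambda>(i, j). t j i)"
    by (auto simp: type_colorings_def joint_colorings_def joint_type_def)
next
  fix C assume C: "C \<in> type_colorings X ({..<l} \<times> {..<m}) (\<lambda>(i, j). t j i)"
  then have CE: "C \<in> X \<rightarrow>\<^sub>E {..<l} \<times> {..<m}" by (simp add: type_colorings_def)
  have cnt: "int (card {x\<in>X. C x = (i, j)}) = t j i" if "i < l" "j < m" for i j
    using C that by (auto simp: type_colorings_def)
  have CP: "C \<in> X \<rightarrow> {..<l} \<times> {..<m}" using CE by auto
  have "int (card {x\<in>X. fst (C x) = i}) = a i" if i: "i < l" for i
    using card_fiber_sum(2)[OF X CP i, symmetric] t cnt i by (simp add: matrices_def)
  moreover have "int (card {x\<in>X. snd (C x) = j}) = b j" if j: "j < m" for j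
    using card_fiber_sum(1)[OF X CP j, symmetric] t cnt j by (auto simp: matrices_def columns_def)
  ultimately have "C \<in> joint_colorings X l a m b"
    using CE restrict_type_iff[OF CE] by (simp add: joint_colorings_def)
  moreover have "joint_type X l m C = t"
  proof
    fix j show "joint_type X l m C j = t j"
    proof (cases "j < m")
      case True
      then have "t j \<in> {..<l} \<rightarrow>\<^sub>E UNIV" using t by (auto simp: matrices_def columns_def PiE_def)
      then show ?thesis using True cnt
        by (auto simp: joint_type_def fun_eq_iff PiE_def extensional_def)
    next
      case False
      then show ?thesis using t by (auto simp: joint_type_def matrices_def PiE_def extensional_def)
    qed
  qed
  ultimately show "C \<in> {C \<in> joint_colorings X l a m b. joint_type X l m C = t}" by simp
qed

lemma sum_joint_colorings:
  assumes X: "finite X"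
  shows "(\<Sum>C\<in>joint_colorings X l a m b. h C) =
    (\<Sum>t\<in>matrices UNIV l a m b. \<Sum>C\<in>type_colorings X ({..<l} \<times> {..<m}) (\<lambda>(i, j). t j i). h C)"
proof -
  have "(\<Sum>C\<in>joint_colorings X l a m b. h C) =
    (\<Sum>t\<in>matrices UNIV l a m b. \<Sum>C\<in>{C \<in> joint_colorings X l a m b. joint_type X l m C = t}. h C)"
    by (rule sum.group[symmetric])
      (use X joint_type_in_matrices finite_joint_colorings finite_matrices in auto)
  then show ?thesis by (simp add: joint_type_fiber[OF X])
qed

lemma matrix_coloring_exists:
  assumes X: "finite X" and a: "(\<Sum>i<l. a i) = int (card X)" and t: "t \<in> matrices UNIV l a m b"
  shows "type_colorings X ({..<l} \<times> {..<m}) (\<lambda>(i, j). t j i) \<noteq> {}"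
proof -
  have "(\<Sum>k\<in>{..<l} \<times> {..<m}. case k of (i, j) \<Rightarrow> t j i) = (\<Sum>i<l. \<Sum>j<m. t j i)"
    by (simp add: sum.cartesian_product)
  also have "\<dots> = int (card X)" using t a by (simp add: matrices_def)
  finally have "\<exists>C. C \<in> type_colorings X ({..<l} \<times> {..<m}) (\<lambda>(i, j). t j i)"
    using t X by (intro exists_type_coloring) (auto simp: matrices_def columns_def PiE_def Pi_def)
  then show ?thesis by auto
qed

text \<open>The colourings with one given contingency table form a single orbit, and orbit counting
  gives each table the weight \<open>fact (card X)\<close>.\<close>

theorem psi_inner_product:
  assumes X: "finite X" and a: "(\<Sum>i<l. a i) = int (card X)"
  shows "(\<Sum>\<sigma> | \<sigma> permutes X. psi X l a \<sigma> * psi X m b \<sigma>) =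
    fact (card X) * int (card (matrices UNIV l a m b))"
proof -
  have "(\<Sum>\<sigma> | \<sigma> permutes X. psi X l a \<sigma> * psi X m b \<sigma>) =
      (\<Sum>C\<in>joint_colorings X l a m b. int (card (stab X C)))"
    using sum_psi_mult[OF X, of "\<lambda>_. 1" l a m b] by simp
  also have "\<dots> = (\<Sum>t\<in>matrices UNIV l a m b. fact (card X))"
    unfolding sum_joint_colorings[OF X]
  proof (rule sum.cong[OF refl])
    fix t assume t: "t \<in> matrices UNIV l a m b"
    from sum_card_stab[OF X _ matrix_coloring_exists[OF X a t]]
    show "(\<Sum>C\<in>type_colorings X ({..<l} \<times> {..<m}) (\<lambda>(i, j). t j i). int (card (stab X C))) = fact (card X)"
      by (simp flip: of_nat_sum)
  qed
  finally show ?thesis by simp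
qed

text \<open>A table entry above 1 puts two points into one class, and the signs over the stabiliser
  cancel; for a 0-1 table the colouring is injective, its stabiliser trivial, and the weight the
  same as without sign.\<close>

theorem psi_sign_inner_product:
  assumes X: "finite X" and a: "(\<Sum>i<l. a i) = int (card X)"
  shows "(\<Sum>\<sigma> | \<sigma> permutes X. sign \<sigma> * (psi X l a \<sigma> * psi X m b \<sigma>)) =
    fact (card X) * int (card (matrices {0, 1} l a m b))"
proof -
  let ?h = "\<lambda>C. \<Sum>\<sigma>\<in>stab X C. sign \<sigma>"
  let ?T = "\<lambda>t. type_colorings X ({..<l} \<times> {..<m}) (\<lambda>(i, j). t j i)"
  have "(\<Sum>\<sigma> | \<sigma> permutes X. sign \<sigma> * (psi X l a \<sigma> * psi X m b \<sigma>)) =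
      (\<Sum>t\<in>matrices UNIV l a m b. \<Sum>C\<in>?T t. ?h C)"
    unfolding sum_psi_mult[OF X] sum_joint_colorings[OF X] ..
  also have "\<dots> = (\<Sum>t\<in>matrices UNIV l a m b. if t \<in> matrices {0, 1} l a m b then fact (card X) else 0)"
  proof (rule sum.cong[OF refl])
    fix t assume t: "t \<in> matrices UNIV l a m b"
    show "(\<Sum>C\<in>?T t. ?h C) = (if t \<in> matrices {0, 1} l a m b then fact (card X) else 0)"
    proof (cases "t \<in> matrices {0, 1} l a m b")
      case True
      then have le: "t j i \<le> 1" if "j < m" "i < l" for i j
        using matrices_01_iff[OF t] that by auto
      have "?h C = int (card (stab X C))" if C: "C \<in> ?T t" for C
      proof -
        have "inj_on C X"
        proof (rule inj_onI, rule ccontr)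
          fix x y assume xy: "x \<in> X" "y \<in> X" "C x = C y" "x \<noteq> y"
          obtain i j where ij: "C x = (i, j)" by force
          then have "i < l" "j < m" using C xy by (auto simp: type_colorings_def PiE_def Pi_def)
          then have "int (card {z\<in>X. C z = (i, j)}) \<le> 1"
            using C le by (auto simp: type_colorings_def)
          moreover have "card {x, y} \<le> card {z\<in>X. C z = (i, j)}"
            using X xy ij by (intro card_mono) auto
          ultimately show False using xy by simp
        qed
        then show ?thesis by (simp add: stab_inj)
      qed
      then have "(\<Sum>C\<in>?T t. ?h C) = (\<Sum>C\<in>?T t. int (card (stab X C)))" by (intro sum.cong) auto
      also have "\<dots> = fact (card X)"
        using sum_card_stab[OF X _ matrix_coloring_exists[OF X a t]] by (simp flip: of_nat_sum)
      finally show ?thesis using True by simp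
    next
      case False
      then obtain i j where ij: "j < m" "i < l" "t j i > 1"
        using matrices_01_iff[OF t] by (auto simp: not_le)
      have "?h C = 0" if C: "C \<in> ?T t" for C
      proof -
        have "int (card {z\<in>X. C z = (i, j)}) > 1" using C ij by (auto simp: type_colorings_def)
        then obtain x y where "x \<in> {z\<in>X. C z = (i, j)}" "y \<in> {z\<in>X. C z = (i, j)}" "x \<noteq> y"
          using card_le_Suc0_iff_eq[of "{z\<in>X. C z = (i, j)}"] X by force
        then show ?thesis using sum_sign_cancel_left[OF X, of x y C "\<lambda>_. 1"] by auto
      qed
      then show ?thesis using False by simp
    qed
  qed
  also have "\<dots> = fact (card X) * int (card (matrices {0, 1} l a m b))"
    using matrices_01_subset[of l a m b] finite_matrices[of UNIV l a m b]
    by (simp add: sum.If_cases Int_absorb1 Int_def[symmetric] inf.absorb2)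
  finally show ?thesis .
qed

section \<open>Jacobi-Trudi determinants and Kostka numbers\<close>

section \<open>Alternating sums over shifted index vectors\<close>

text \<open>Leibniz expansion of a Jacobi-Trudi determinant, where the product of the entries is
  replaced by an arbitrary function \<open>F\<close> of the whole index vector. Characters
  (\<open>F\<close> a permutation character) and Kostka numbers (\<open>F\<close> a matrix count)
  are both instances.\<close>

definition alternant :: "nat \<Rightarrow> ((nat \<Rightarrow> int) \<Rightarrow> int) \<Rightarrow> (nat \<Rightarrow> int) \<Rightarrow> int" where
  "alternant l F a = (\<Sum>w | w permutes {..<l}. sign w * F (\<lambda>i. a i - int i + int (w i)))"

definition symmetric_on :: "nat \<Rightarrow> ((nat \<Rightarrow> int) \<Rightarrow> int) \<Rightarrow> bool" where
  "symmetric_on l F \<longleftrightarrow> (\<forall>c d. (\<forall>i<l. c i = d i) \<longrightarrow> F c = F d) \<and>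
     (\<forall>c w. w permutes {..<l} \<longrightarrow> F (c \<circ> w) = F c)"

lemma symmetric_on_cong: "symmetric_on l F \<Longrightarrow> (\<And>i. i < l \<Longrightarrow> c i = d i) \<Longrightarrow> F c = F d"
  by (simp add: symmetric_on_def)

lemma symmetric_on_permute: "symmetric_on l F \<Longrightarrow> w permutes {..<l} \<Longrightarrow> F (c \<circ> w) = F c"
  by (simp add: symmetric_on_def)

definition decreasing :: "nat \<Rightarrow> (nat \<Rightarrow> int) \<Rightarrow> bool" where
  "decreasing l a \<longleftrightarrow> (\<forall>i. Suc i < l \<longrightarrow> a (Suc i) \<le> a i)"

lemma decreasing_le: "decreasing l a \<Longrightarrow> i \<le> j \<Longrightarrow> j < l \<Longrightarrow> a j \<le> a i"
proof (induction "j - i" arbitrary: j)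
  case (Suc d)
  then obtain j' where j': "j = Suc j'" by (cases j) auto
  have "a j' \<le> a i" using Suc.hyps(1)[of j'] Suc.hyps(2) Suc.prems j' by simp
  then show ?case using Suc.prems j' by (force simp: decreasing_def)
qed simp

lemma alternant_cong:
  assumes "symmetric_on l F" "\<And>i. i < l \<Longrightarrow> a i = b i"
  shows "alternant l F a = alternant l F b"
proof -
  have "F (\<lambda>i. a i - int i + int (w i)) = F (\<lambda>i. b i - int i + int (w i))" for w
    by (rule symmetric_on_cong[OF assms(1)]) (simp add: assms(2))
  then show ?thesis by (simp add: alternant_def)
qed

text \<open>In the shifted coordinates a_i - i the vector \<open>a'\<close> is \<open>a\<close> with
  entries i and i + 1 exchanged: two adjacent rows of the determinant are swapped.\<close>

lemma alternant_swap:
  assumes F: "symmetric_on l F" and i: "Suc i < l"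
    and a': "a' i = a (Suc i) - 1" "a' (Suc i) = a i + 1"
      "\<And>j. j < l \<Longrightarrow> j \<noteq> i \<Longrightarrow> j \<noteq> Suc i \<Longrightarrow> a' j = a j"
  shows "alternant l F a' = - alternant l F a"
proof -
  let ?t = "transpose i (Suc i)"
  have t: "?t permutes {..<l}" using i by (simp add: permutes_swap_id)
  have eq: "F (\<lambda>j. a' j - int j + int (w j)) = F (\<lambda>j. a j - int j + int ((w \<circ> ?t) j))" for w
  proof -
    have "F (\<lambda>j. a' j - int j + int (w j)) = F ((\<lambda>j. a j - int j + int ((w \<circ> ?t) j)) \<circ> ?t)"
    proof -
      have "a' j - int j + int (w j) = ((\<lambda>j. a j - int j + int ((w \<circ> ?t) j)) \<circ> ?t) j" if "j < l" for j
        using a' that by (cases "j = i"; cases "j = Suc i") auto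
      then show ?thesis by (rule symmetric_on_cong[OF F])
    qed
    also have "\<dots> = F (\<lambda>j. a j - int j + int ((w \<circ> ?t) j))"
      by (rule symmetric_on_permute[OF F t])
    finally show ?thesis .
  qed
  have sg: "sign (w \<circ> ?t) = - sign w" if "w permutes {..<l}" for w
    using that by (simp add: sign_compose permutation_swap_id sign_swap_id
      permutes_imp_permutation[of "{..<l}"])
  have "alternant l F a = (\<Sum>w | w permutes {..<l}. sign (w \<circ> ?t) * F (\<lambda>j. a j - int j + int ((w \<circ> ?t) j)))"
    unfolding alternant_def by (rule sum_permutations_compose_right[OF t])
  also have "\<dots> = (\<Sum>w | w permutes {..<l}. - (sign w * F (\<lambda>j. a' j - int j + int (w j))))"
    by (rule sum.cong) (auto simp: sg eq simp del: o_apply)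
  finally show ?thesis by (simp add: alternant_def sum_negf)
qed

text \<open>Here a_i - i = a_(i+1) - (i+1), so two rows of the determinant agree and the vector is
  its own swap.\<close>

lemma alternant_zero:
  assumes "symmetric_on l F" "Suc i < l" "a (Suc i) = a i + 1"
  shows "alternant l F a = 0"
  using alternant_swap[OF assms(1,2), of a a] assms(3) by simp

text \<open>In the last row w (l - 1) \<le> l - 1, so every index there is at most
  \<open>a (l - 1)\<close> and hence negative.\<close>

lemma alternant_neg_last:
  assumes F: "\<And>c i. i < l \<Longrightarrow> c i < 0 \<Longrightarrow> F c = 0" and l: "l > 0" and a: "a (l - 1) < 0"
  shows "alternant l F a = 0"
  unfolding alternant_def
proof (rule sum.neutral, intro ballI)
  fix w assume "w \<in> {w. w permutes {..<l}}"
  then have "w (l - 1) < l" using permutes_in_image[of w "{..<l}" "l - 1"] l by simp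
  then have "F (\<lambda>i. a i - int i + int (w i)) = 0" using a l by (intro F[of "l - 1"]) auto
  then show "sign w * F (\<lambda>i. a i - int i + int (w i)) = 0" by simp
qed

lemma symmetric_psi:
  assumes "\<sigma> permutes X"
  shows "symmetric_on l (\<lambda>c. psi X l c \<sigma>)"
  unfolding symmetric_on_def
proof (intro conjI allI impI)
  fix c d :: "nat \<Rightarrow> int" assume "\<forall>i<l. c i = d i"
  then show "psi X l c \<sigma> = psi X l d \<sigma>" by (intro psi_cong) simp
qed (rule psi_permute[OF _ assms])

definition mat_count :: "int set \<Rightarrow> nat \<Rightarrow> nat \<Rightarrow> (nat \<Rightarrow> int) \<Rightarrow> (nat \<Rightarrow> int) \<Rightarrow> int" where
  "mat_count U l m b c = int (card (matrices U l c m b))"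

lemma mat_count_cong:
  "(\<And>i. i < l \<Longrightarrow> c i = d i) \<Longrightarrow> mat_count U l m b c = mat_count U l m b d"
  by (simp add: mat_count_def matrices_def)

lemma mat_count_cong_right:
  assumes "\<And>j. j < m \<Longrightarrow> b j = b' j"
  shows "mat_count U l m b = mat_count U l m b'"
proof -
  have "(\<Pi>\<^sub>E j\<in>{..<m}. columns U l (b j)) = (\<Pi>\<^sub>E j\<in>{..<m}. columns U l (b' j))"
    by (rule PiE_cong) (simp add: assms)
  then show ?thesis by (simp add: mat_count_def matrices_def fun_eq_iff)
qed

lemma mat_count_0: "mat_count U l 0 b c = (if \<forall>i<l. c i = 0 then 1 else 0)"
  by (simp add: mat_count_def card_matrices_0)

lemma mat_count_Suc:
  "mat_count U l (Suc m) b c = (\<Sum>v\<in>columns U l (b m). mat_count U l m b (\<lambda>i. c i - v i))"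
  by (simp add: mat_count_def card_matrices_Suc)

lemma columns_permute:
  assumes w: "w permutes {..<l}" and v: "v \<in> columns U l c"
  shows "restrict (v \<circ> w) {..<l} \<in> columns U l c"
proof -
  have "(\<Sum>i<l. (v \<circ> w) i) = (\<Sum>i<l. v i)" using sum.permute[OF w, of v] by simp
  moreover have "restrict (v \<circ> w) {..<l} \<in> {..<l} \<rightarrow>\<^sub>E {u\<in>U. 0 \<le> u \<and> u \<le> c}"
    using v permutes_in_image[OF w] by (auto simp: columns_def PiE_def Pi_def)
  ultimately show ?thesis using v by (simp add: columns_def)
qed

lemma symmetric_mat_count: "symmetric_on l (mat_count U l m b)"
proof -
  have "mat_count U l m b (c \<circ> w) = mat_count U l m b c" if w: "w permutes {..<l}" for c w
  proof (induction m arbitrary: c)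
    case 0
    have "(\<forall>i<l. c (w i) = 0) \<longleftrightarrow> (\<forall>i<l. c i = 0)"
      using permutes_in_image[OF w] permutes_inverses(1)[OF w] permutes_in_image[OF permutes_inv[OF w]]
      by (metis lessThan_iff)
    then show ?case by (simp add: mat_count_0)
  next
    case (Suc m)
    have w': "inv w permutes {..<l}" using w by (rule permutes_inv)
    have "mat_count U l (Suc m) b (c \<circ> w) =
        (\<Sum>v\<in>columns U l (b m). mat_count U l m b (\<lambda>i. (c \<circ> w) i - restrict (v \<circ> w) {..<l} i))"
      unfolding mat_count_Suc
    proof (rule sum.reindex_bij_witness[of _ "\<lambda>v. restrict (v \<circ> w) {..<l}" "\<lambda>v. restrict (v \<circ> inv w) {..<l}"])
      fix v assume v: "v \<in> columns U l (b m)"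
      then have ext: "v \<in> extensional {..<l}" by (simp add: columns_def PiE_def)
      show "restrict (restrict (v \<circ> inv w) {..<l} \<circ> w) {..<l} = v"
        using ext permutes_inverses[OF w] permutes_in_image[OF w]
        by (auto simp: fun_eq_iff restrict_def extensional_def)
      show "restrict (restrict (v \<circ> w) {..<l} \<circ> inv w) {..<l} = v"
        using ext permutes_inverses[OF w] permutes_in_image[OF w']
        by (auto simp: fun_eq_iff restrict_def extensional_def)
      show "restrict (v \<circ> inv w) {..<l} \<in> columns U l (b m)" by (rule columns_permute[OF w' v])
      show "restrict (v \<circ> w) {..<l} \<in> columns U l (b m)" by (rule columns_permute[OF w v])
      show "mat_count U l m b (\<lambda>i. (c \<circ> w) i - restrict (restrict (v \<circ> inv w) {..<l} \<circ> w) {..<l} i) =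
         mat_count U l m b (\<lambda>i. (c \<circ> w) i - v i)"
        using permutes_inverses[OF w] permutes_in_image[OF w]
        by (intro mat_count_cong) auto
    qed
    also have "\<dots> = (\<Sum>v\<in>columns U l (b m). mat_count U l m b ((\<lambda>i. c i - v i) \<circ> w))"
      by (intro sum.cong refl mat_count_cong) auto
    also have "\<dots> = mat_count U l (Suc m) b c" unfolding Suc.IH mat_count_Suc ..
    finally show ?case .
  qed
  moreover have "mat_count U l m b c = mat_count U l m b d" if "\<forall>i<l. c i = d i" for c d
    using that by (intro mat_count_cong) simp
  ultimately show ?thesis unfolding symmetric_on_def by (intro conjI allI impI)
qed

lemma mat_count_neg: "i < l \<Longrightarrow> c i < 0 \<Longrightarrow> mat_count U l m b c = 0"
proof (induction m arbitrary: c)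
  case 0 then show ?case by (auto simp: mat_count_0)
next
  case (Suc m)
  have "mat_count U l m b (\<lambda>i. c i - v i) = 0" if "v \<in> columns U l (b m)" for v
    using Suc.prems that by (intro Suc.IH) (force simp: columns_def PiE_def Pi_def)+
  then show ?case by (simp add: mat_count_Suc)
qed

text \<open>For a partition \<open>a\<close> this is the coefficient of the Schur function s_a in
  the product of the h_(b j) if \<open>U = UNIV\<close>, and in the product of the e_(b j) if
  \<open>U = {0, 1}\<close>.\<close>

definition kostka :: "int set \<Rightarrow> nat \<Rightarrow> nat \<Rightarrow> (nat \<Rightarrow> int) \<Rightarrow> (nat \<Rightarrow> int) \<Rightarrow> int" where
  "kostka U l m b = alternant l (mat_count U l m b)"

lemma kostka_Suc:
  "kostka U l (Suc m) b a = (\<Sum>v\<in>columns U l (b m). kostka U l m b (\<lambda>i. a i - v i))"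
proof -
  have "kostka U l (Suc m) b a = (\<Sum>w | w permutes {..<l}. \<Sum>v\<in>columns U l (b m).
     sign w * mat_count U l m b (\<lambda>i. a i - v i - int i + int (w i)))"
    unfolding kostka_def alternant_def mat_count_Suc sum_distrib_left
    by (intro sum.cong refl arg_cong2[where f = "(*)"] arg_cong[where f = "mat_count U l m b"])
      (simp add: algebra_simps)
  also have "\<dots> = (\<Sum>v\<in>columns U l (b m). kostka U l m b (\<lambda>i. a i - v i))"
    unfolding kostka_def alternant_def by (rule sum.swap)
  finally show ?thesis .
qed

lemma kostka_cong_right: "(\<And>j. j < m \<Longrightarrow> b j = b' j) \<Longrightarrow> kostka U l m b a = kostka U l m b' a"
  unfolding kostka_def using mat_count_cong_right[of m b b' U l] by simp

lemma kostka_nonzero_nonneg: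
  assumes dec: "decreasing l a" and nz: "kostka U l m b a \<noteq> 0" and i: "i < l"
  shows "0 \<le> a i"
proof -
  have "0 \<le> a (l - 1)"
    using alternant_neg_last[of l "mat_count U l m b" a] mat_count_neg nz i
    unfolding kostka_def by (metis gr_zeroI less_zeroE not_le)
  moreover have "a (l - 1) \<le> a i" using i by (intro decreasing_le[OF dec]) auto
  ultimately show ?thesis by simp
qed

lemma kostka_0:
  assumes dec: "decreasing l a"
  shows "kostka U l 0 b a = (if \<forall>i<l. a i = 0 then 1 else 0)"
proof -
  have w_id: "w = id \<and> (\<forall>i<l. a i = 0)"
    if w: "w permutes {..<l}" and z: "\<forall>i<l. a i - int i + int (w i) = 0" for w
  proof -
    \<comment> \<open>A zero index vector has w i = i - a i, and \<open>a\<close> is nonnegative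
      because already its last entry is; a permutation that increases no point is the
      identity.\<close>
    have "w i \<le> i" if "i \<in> {..<l}" for i
    proof -
      have "w (l - 1) < l" using permutes_in_image[OF w, of "l - 1"] that by auto
      then have "0 \<le> a (l - 1)" using z[rule_format, of "l - 1"] that by auto
      moreover have "a (l - 1) \<le> a i" using that by (intro decreasing_le[OF dec]) auto
      ultimately have "0 \<le> a i" by simp
      then show ?thesis using z[rule_format, of i] that by auto
    qed
    then have "w = id" using permutes_natset_le[OF w] by blast
    then show ?thesis using z by simp
  qed
  have "kostka U l 0 b a = (\<Sum>w | w permutes {..<l}. if w = id then (if \<forall>i<l. a i = 0 then 1 else 0) else 0)"
    unfolding kostka_def alternant_def mat_count_0
    by (rule sum.cong[OF refl]) (use w_id in auto)
  then show ?thesis by (simp add: finite_permutations permutes_id)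
qed

subsection \<open>Pieri rules\<close>

text \<open>Columns violating the interlacing condition cancel in pairs: the involution changes two
  adjacent entries so that the remaining shifted vector gets those two entries exchanged.\<close>

lemma kostka_Suc_horizontal:
  assumes dec: "decreasing l a"
  shows "kostka UNIV l (Suc m) b a =
    (\<Sum>v\<in>{v\<in>columns UNIV l (b m). \<forall>i. Suc i < l \<longrightarrow> a (Suc i) \<le> a i - v i}.
       kostka UNIV l m b (\<lambda>i. a i - v i))"
proof -
  define bad where "bad v i \<longleftrightarrow> Suc i < l \<and> a i - v i < a (Suc i)" for v i
  let ?V = "columns UNIV l (b m)"
  let ?B = "{v\<in>?V. \<exists>i. bad v i}"
  let ?g = "\<lambda>v. kostka UNIV l m b (\<lambda>i. a i - v i)"
  \<comment> \<open>Adding \<open>d\<close> to entry i and subtracting it from entry i + 1 exchanges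
    the shifted remainders a_k - v_k - k at k = i and k = i + 1. Acting at the first violation
    leaves the earlier inequalities and the violation at i intact, so the map finds the same i
    again; the violation is also exactly what keeps entry i + 1 nonnegative.\<close>
  define d where "d v i = a i - a (Suc i) + v (Suc i) + 1 - v i" for v i
  define upd where "upd v i = (\<lambda>k. v k + (if k = i then d v i else if k = Suc i then - d v i else 0))" for v i
  define inv' where "inv' v = upd v (LEAST i. bad v i)" for v
  have key: "inv' v \<in> ?B \<and> inv' (inv' v) = v \<and> ?g (inv' v) = - ?g v" if v: "v \<in> ?B" for v
  proof -
    define i where "i = (LEAST i. bad v i)"
    have bi: "bad v i" unfolding i_def using v by (auto intro: LeastI)
    have least: "\<not> bad v k" if "k < i" for k using that unfolding i_def by (rule not_less_Least)
    have il: "Suc i < l" using bi by (simp add: bad_def)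
    let ?u = "upd v i"
    have iu: "inv' v = ?u" by (simp add: inv'_def i_def)
    have vV: "v \<in> ?V" using v by simp
    have nn: "0 \<le> v k" if "k < l" for k using vV that by (auto simp: columns_def PiE_def Pi_def)
    have unn: "0 \<le> ?u k" if "k < l" for k
    proof -
      have "v i + d v i = a i - a (Suc i) + v (Suc i) + 1" by (simp add: d_def)
      moreover have "a (Suc i) \<le> a i" using dec il by (simp add: decreasing_def)
      moreover have "v (Suc i) - d v i \<ge> 0" using bi by (simp add: d_def bad_def)
      moreover have "v (Suc i) \<ge> 0" using nn il by simp
      ultimately show ?thesis using nn that by (simp add: upd_def)
    qed
    have "(\<Sum>k<l. ?u k) = (\<Sum>k<l. v k) + (\<Sum>k<l. (if k = i then d v i else 0) + (if k = Suc i then - d v i else 0))"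
      unfolding upd_def sum.distrib[symmetric] by (rule sum.cong) auto
    also have "(\<Sum>k<l. (if k = i then d v i else 0) + (if k = Suc i then - d v i else 0)) = 0"
      using il by (simp add: sum.distrib)
    finally have usum: "(\<Sum>k<l. ?u k) = b m" using vV by (simp add: columns_def)
    have "?u k \<le> b m" if "k < l" for k
      unfolding usum[symmetric] using unn that by (intro member_le_sum) auto
    moreover have "?u \<in> extensional {..<l}"
      using vV il by (auto simp: columns_def PiE_def extensional_def upd_def)
    ultimately have uV: "?u \<in> ?V" using unn usum by (auto simp: columns_def PiE_def)
    have bu: "bad ?u k \<longleftrightarrow> bad v k" if "k < i" for k using that by (simp add: bad_def upd_def)
    have bui: "bad ?u i" using il nn[of "Suc i"] by (simp add: bad_def upd_def d_def)
    have "(LEAST i. bad ?u i) = i"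
    proof (rule Least_equality, rule bui, rule ccontr)
      fix y assume "bad ?u y" "\<not> i \<le> y"
      then show False using bu[of y] least[of y] by simp
    qed
    then have iiu: "inv' ?u = upd ?u i" by (simp add: inv'_def)
    have "d ?u i = - d v i" by (simp add: d_def upd_def)
    then have "upd ?u i = v" by (auto simp: upd_def fun_eq_iff)
    moreover have "?g ?u = - ?g v"
      unfolding kostka_def
      by (rule alternant_swap[OF symmetric_mat_count il]) (auto simp: upd_def d_def)
    ultimately show ?thesis using uV bui iu iiu by auto
  qed
  have "(\<Sum>v\<in>?B. ?g v) = (\<Sum>v\<in>?B. ?g (inv' v))"
    by (rule sum.reindex_bij_witness[of _ inv' inv']) (use key in auto)
  also have "\<dots> = - (\<Sum>v\<in>?B. ?g v)" using key by (simp add: sum_negf[symmetric])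
  finally have zero: "(\<Sum>v\<in>?B. ?g v) = 0" by simp
  have "(\<Sum>v\<in>?V. ?g v) = (\<Sum>v\<in>?B. ?g v) + (\<Sum>v\<in>?V - ?B. ?g v)"
    by (subst sum.subset_diff[of ?B ?V]) (auto simp: finite_columns)
  moreover have "?V - ?B = {v\<in>?V. \<forall>i. Suc i < l \<longrightarrow> a (Suc i) \<le> a i - v i}"
    by (auto simp: bad_def not_less)
  ultimately show ?thesis using zero by (simp add: kostka_Suc)
qed

text \<open>A 0-1 column can break the order of a decreasing vector only by creating a_i - v_i + 1 =
  a_(i+1) - v_(i+1), and then two rows of the determinant coincide.\<close>

lemma kostka_Suc_vertical:
  assumes dec: "decreasing l a"
  shows "kostka {0, 1} l (Suc m) b a =
    (\<Sum>v\<in>{v\<in>columns {0, 1} l (b m). decreasing l (\<lambda>i. a i - v i)}. kostka {0, 1} l m b (\<lambda>i. a i - v i))"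
  unfolding kostka_Suc
proof (rule sum.mono_neutral_right)
  show "\<forall>v\<in>columns {0, 1} l (b m) - {v \<in> columns {0, 1} l (b m). decreasing l (\<lambda>i. a i - v i)}.
       kostka {0, 1} l m b (\<lambda>i. a i - v i) = 0"
  proof
    fix v assume v: "v \<in> columns {0, 1} l (b m) - {v \<in> columns {0, 1} l (b m). decreasing l (\<lambda>i. a i - v i)}"
    then obtain i where i: "Suc i < l" "a i - v i < a (Suc i) - v (Suc i)"
      by (auto simp: decreasing_def not_le)
    have 01: "v k = 0 \<or> v k = 1" if "k < l" for k
      using v that by (auto simp: columns_def PiE_def Pi_def)
    have "a (Suc i) - v (Suc i) = (a i - v i) + 1"
      using i dec 01[of i] 01[of "Suc i"] by (fastforce simp: decreasing_def)
    then show "kostka {0, 1} l m b (\<lambda>i. a i - v i) = 0"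
      unfolding kostka_def by (intro alternant_zero[OF symmetric_mat_count i(1)])
  qed
qed (auto simp: finite_columns)

subsection \<open>Triangularity\<close>

lemma sum_lessThan_split_zero:
  fixes f :: "nat \<Rightarrow> int"
  assumes "\<And>i. k \<le> i \<Longrightarrow> i < l \<Longrightarrow> f i = 0"
  shows "(\<Sum>i<min k l. f i) = (\<Sum>i<l. f i)"
  by (rule sum.mono_neutral_left) (use assms in auto)

text \<open>By the Pieri rule the shape is built from horizontal strips of sizes \<open>b j\<close>,
  and each strip creates at most one new row; the first j strips therefore lie in the first j rows.
  The weight \<open>b\<close> is arbitrary because it will be a shifted index vector, not a
  partition.\<close>

lemma kostka_horizontal_dominance:
  assumes "decreasing l a" "kostka UNIV l m b a \<noteq> 0"
  shows "(\<forall>i. m \<le> i \<longrightarrow> i < l \<longrightarrow> a i = 0) \<and> (\<forall>j\<le>m. (\<Sum>i<j. b i) \<le> (\<Sum>i<min j l. a i))"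
  using assms
proof (induction m arbitrary: a)
  case 0
  then show ?case by (auto simp: kostka_0 split: if_splits)
next
  case (Suc m)
  from Suc.prems obtain v where v: "v \<in> columns UNIV l (b m)" "\<And>i. Suc i < l \<Longrightarrow> a (Suc i) \<le> a i - v i"
    and nz: "kostka UNIV l m b (\<lambda>i. a i - v i) \<noteq> 0"
    unfolding kostka_Suc_horizontal[OF Suc.prems(1)]
    by (elim sum.not_neutral_contains_not_neutral) blast
  have nn: "0 \<le> v k" if "k < l" for k using v(1) that by (auto simp: columns_def PiE_def Pi_def)
  have vs: "(\<Sum>i<l. v i) = b m" using v(1) by (simp add: columns_def)
  have dec': "decreasing l (\<lambda>i. a i - v i)"
    unfolding decreasing_def using v(2) nn by (smt (verit))
  note IH = Suc.IH[OF dec' nz]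
  have ge0: "0 \<le> a i" if "i < l" for i using kostka_nonzero_nonneg[OF Suc.prems that] .
  have z: "a i = 0" if i: "Suc m \<le> i" "i < l" for i
  proof -
    obtain i' where "i = Suc i'" using i by (cases i) auto
    then have "a i \<le> 0" using v(2)[of i'] IH i by auto
    then show ?thesis using ge0[of i] i by simp
  qed
  have "(\<Sum>i<j. b i) \<le> (\<Sum>i<min j l. a i)" if j: "j \<le> Suc m" for j
  proof (cases "j = Suc m")
    case True
    have "(\<Sum>i<Suc m. b i) \<le> (\<Sum>i<min m l. a i - v i) + (\<Sum>i<l. v i)"
      using IH vs by simp
    also have "(\<Sum>i<min m l. a i - v i) = (\<Sum>i<l. a i - v i)"
      by (rule sum_lessThan_split_zero) (use IH in auto)
    also have "(\<Sum>i<l. a i - v i) + (\<Sum>i<l. v i) = (\<Sum>i<l. a i)" by (simp add: sum_subtractf)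
    also have "\<dots> = (\<Sum>i<min (Suc m) l. a i)" using sum_lessThan_split_zero[of "Suc m" l a] z by simp
    finally show ?thesis using True by simp
  next
    case False
    then have "(\<Sum>i<j. b i) \<le> (\<Sum>i<min j l. a i - v i)" using IH j by simp
    also have "\<dots> \<le> (\<Sum>i<min j l. a i)" using nn by (intro sum_mono) auto
    finally show ?thesis .
  qed
  then show ?case using z by blast
qed

lemma kostka_horizontal_diag:
  assumes "decreasing l a" "\<And>i. i < l \<Longrightarrow> 0 \<le> a i" "m \<le> l" "\<And>i. m \<le> i \<Longrightarrow> i < l \<Longrightarrow> a i = 0"
  shows "kostka UNIV l m a a = 1"
  using assms
proof (induction m arbitrary: a)
  case 0
  then show ?case by (simp add: kostka_0)
next
  case (Suc m)
  let ?G = "{v\<in>columns UNIV l (a m). \<forall>i. Suc i < l \<longrightarrow> a (Suc i) \<le> a i - v i}"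
  let ?g = "\<lambda>v. kostka UNIV l m a (\<lambda>i. a i - v i)"
  define v0 where "v0 = (\<lambda>i\<in>{..<l}. if i = m then a m else 0)"
  have ml: "m < l" using Suc.prems by simp
  have v0V: "v0 \<in> columns UNIV l (a m)"
    using ml Suc.prems(2) by (auto simp: columns_def v0_def)
  have dec_v0: "a (Suc i) \<le> a i - v0 i" if "Suc i < l" for i
    using that Suc.prems by (auto simp: v0_def decreasing_def)
  have v0G: "v0 \<in> ?G" using v0V dec_v0 by simp
  have "?g v = 0" if v: "v \<in> ?G - {v0}" for v
  proof (rule ccontr)
    assume nz: "?g v \<noteq> 0"
    have nn: "0 \<le> v k" if "k < l" for k using v that by (auto simp: columns_def PiE_def Pi_def)
    have vs: "(\<Sum>i<l. v i) = a m" and ve: "v \<in> extensional {..<l}" using v by (auto simp: columns_def PiE_def)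
    have dec': "decreasing l (\<lambda>i. a i - v i)"
      unfolding decreasing_def using v nn by (smt (verit) DiffD1 mem_Collect_eq)
    \<comment> \<open>Dominance confines the remainder to the first m rows, so the strip swallows
      row m entirely; this exhausts its size, and it must be \<open>v0\<close>.\<close>
    have "a m - v m = 0" using kostka_horizontal_dominance[OF dec' nz] ml by auto
    then have "(\<Sum>i\<in>{..<l} - {m}. v i) = 0" using vs ml by (simp add: sum.remove[of "{..<l}" m])
    then have "\<forall>i\<in>{..<l} - {m}. v i = 0" using nn by (subst (asm) sum_nonneg_eq_0_iff) auto
    then have "v = v0" using ve \<open>a m - v m = 0\<close> by (auto simp: v0_def fun_eq_iff extensional_def)
    then show False using v by simp
  qed
  then have "kostka UNIV l (Suc m) a a = ?g v0"
    unfolding kostka_Suc_horizontal[OF Suc.prems(1)]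
    using v0G finite_columns[of UNIV l "a m"] by (subst sum.remove[of _ v0]) auto
  also have "\<dots> = kostka UNIV l m (\<lambda>i. a i - v0 i) (\<lambda>i. a i - v0 i)"
    using ml by (intro kostka_cong_right) (auto simp: v0_def)
  also have "\<dots> = 1"
  proof (rule Suc.IH)
    show "decreasing l (\<lambda>i. a i - v0 i)"
      unfolding decreasing_def
    proof (intro allI impI)
      fix i assume i: "Suc i < l"
      have "0 \<le> v0 (Suc i)" using i Suc.prems(2) by (simp add: v0_def)
      then show "a (Suc i) - v0 (Suc i) \<le> a i - v0 i" using dec_v0[OF i] by simp
    qed
  qed (use Suc.prems in \<open>auto simp: v0_def\<close>)
  finally show ?case .
qed

text \<open>The sum of \<open>min (a i) (int j)\<close> counts the boxes in the first j columns of
  \<open>a\<close>, so this is dominance for the conjugate shape: each vertical strip adds at most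
  one box to a row.\<close>

lemma kostka_vertical_dominance:
  assumes "decreasing l a" "kostka {0, 1} l m b a \<noteq> 0"
  shows "(\<forall>i<l. a i \<le> int m) \<and> (\<forall>j\<le>m. (\<Sum>i<j. b i) \<le> (\<Sum>i<l. min (a i) (int j)))"
  using assms
proof (induction m arbitrary: a)
  case 0
  then show ?case by (auto simp: kostka_0 split: if_splits)
next
  case (Suc m)
  from Suc.prems obtain v where v: "v \<in> columns {0, 1} l (b m)" and dec': "decreasing l (\<lambda>i. a i - v i)"
    and nz: "kostka {0, 1} l m b (\<lambda>i. a i - v i) \<noteq> 0"
    unfolding kostka_Suc_vertical[OF Suc.prems(1)]
    by (elim sum.not_neutral_contains_not_neutral) blast
  have 01: "v k = 0 \<or> v k = 1" if "k < l" for k using v(1) that by (auto simp: columns_def PiE_def Pi_def)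
  have vs: "(\<Sum>i<l. v i) = b m" using v(1) by (simp add: columns_def)
  note IH = Suc.IH[OF dec' nz]
  have le: "a i \<le> int (Suc m)" if "i < l" for i using IH 01[OF that] that by fastforce
  have "(\<Sum>i<j. b i) \<le> (\<Sum>i<l. min (a i) (int j))" if j: "j \<le> Suc m" for j
  proof (cases "j = Suc m")
    case True
    have "(\<Sum>i<m. b i) \<le> (\<Sum>i<l. min (a i - v i) (int m))" using IH by blast
    then have "(\<Sum>i<Suc m. b i) \<le> (\<Sum>i<l. min (a i - v i) (int m)) + (\<Sum>i<l. v i)" using vs by simp
    also have "\<dots> = (\<Sum>i<l. min (a i - v i) (int m) + v i)" by (simp add: sum.distrib)
    also have "\<dots> = (\<Sum>i<l. min (a i) (int (Suc m)))"
    proof (rule sum.cong[OF refl])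
      fix i assume "i \<in> {..<l}"
      then have "a i - v i \<le> int m" "a i \<le> int (Suc m)" using IH le by auto
      then show "min (a i - v i) (int m) + v i = min (a i) (int (Suc m))" by simp
    qed
    finally show ?thesis using True by simp
  next
    case False
    then have "(\<Sum>i<j. b i) \<le> (\<Sum>i<l. min (a i - v i) (int j))" using IH j by simp
    also have "\<dots> \<le> (\<Sum>i<l. min (a i) (int j))"
    proof (rule sum_mono)
      fix i assume "i \<in> {..<l}"
      then show "min (a i - v i) (int j) \<le> min (a i) (int j)" using 01[of i] by auto
    qed
    finally show ?thesis .
  qed
  then show ?case using le by blast
qed

lemma kostka_vertical_diag:
  assumes "decreasing l a" "\<And>i. i < l \<Longrightarrow> 0 \<le> a i" "\<And>i. i < l \<Longrightarrow> a i \<le> int m"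
  shows "kostka {0, 1} l m (\<lambda>j. int (card {i. i < l \<and> int j < a i})) a = 1"
  using assms
proof (induction m arbitrary: a)
  case 0
  then have "a i = 0" if "i < l" for i using that by (metis antisym of_nat_0)
  then show ?case using 0 by (simp add: kostka_0)
next
  case (Suc m)
  define b where "b j = int (card {i. i < l \<and> int j < a i})" for j
  let ?G = "{v\<in>columns {0, 1} l (b m). decreasing l (\<lambda>i. a i - v i)}"
  let ?g = "\<lambda>v. kostka {0, 1} l m b (\<lambda>i. a i - v i)"
  \<comment> \<open>The last column of the shape: rows reaching beyond m must lose a box, and the
    size \<open>b m\<close> allows no other.\<close>
  define v0 where "v0 = (\<lambda>i\<in>{..<l}. if int m < a i then 1 else 0 :: int)"
  have v0s: "(\<Sum>i<l. v0 i) = b m"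
    by (simp add: v0_def b_def sum.If_cases Int_def lessThan_def)
  have v0V: "v0 \<in> columns {0, 1} l (b m)"
  proof -
    have "v0 i \<le> b m" if "i < l" for i
      unfolding v0s[symmetric] using that by (intro member_le_sum) (auto simp: v0_def)
    then show ?thesis using v0s by (auto simp: columns_def v0_def)
  qed
  have dec0: "decreasing l (\<lambda>i. a i - v0 i)"
    unfolding decreasing_def
  proof (intro allI impI)
    fix i assume i: "Suc i < l"
    then have "a (Suc i) \<le> a i" "a i \<le> int (Suc m)" using Suc.prems by (auto simp: decreasing_def)
    then show "a (Suc i) - v0 (Suc i) \<le> a i - v0 i" using i by (auto simp: v0_def)
  qed
  have v0G: "v0 \<in> ?G" using v0V dec0 by simp
  have "?g v = 0" if v: "v \<in> ?G - {v0}" for v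
  proof (rule ccontr)
    assume nz: "?g v \<noteq> 0"
    have 01: "v k = 0 \<or> v k = 1" if "k < l" for k using v that by (auto simp: columns_def PiE_def Pi_def)
    have vs: "(\<Sum>i<l. v i) = b m" and ve: "v \<in> extensional {..<l}" using v by (auto simp: columns_def PiE_def)
    have dec': "decreasing l (\<lambda>i. a i - v i)" using v by simp
    have "a i - v i \<le> int m" if "i < l" for i using kostka_vertical_dominance[OF dec' nz] that by blast
    then have ge: "v0 i \<le> v i" if "i < l" for i using 01[OF that] that by (fastforce simp: v0_def)
    have "(\<Sum>i<l. v i - v0 i) = 0" using vs v0s by (simp add: sum_subtractf)
    then have "\<forall>i\<in>{..<l}. v i - v0 i = 0" using ge by (subst (asm) sum_nonneg_eq_0_iff) auto
    then have "v = v0" using ve by (auto simp: v0_def fun_eq_iff extensional_def)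
    then show False using v by simp
  qed
  then have "kostka {0, 1} l (Suc m) b a = ?g v0"
    unfolding kostka_Suc_vertical[OF Suc.prems(1)]
    using v0G finite_columns[of "{0, 1}" l "b m"] by (subst sum.remove[of _ v0]) auto
  also have "\<dots> = kostka {0, 1} l m (\<lambda>j. int (card {i. i < l \<and> int j < a i - v0 i})) (\<lambda>i. a i - v0 i)"
  proof (rule kostka_cong_right)
    fix j assume "j < m"
    then have "{i. i < l \<and> int j < a i - v0 i} = {i. i < l \<and> int j < a i}" by (auto simp: v0_def)
    then show "b j = int (card {i. i < l \<and> int j < a i - v0 i})" by (simp add: b_def)
  qed
  also have "\<dots> = 1"
  proof (rule Suc.IH[OF dec0])
    fix i assume i: "i < l"
    show "0 \<le> a i - v0 i" using i Suc.prems(2)[OF i] by (simp add: v0_def)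
    show "a i - v0 i \<le> int m" using i Suc.prems(3)[OF i] by (simp add: v0_def)
  qed
  finally show ?case unfolding b_def .
qed

section \<open>Orthonormality of the irreducible characters\<close>

definition chi :: "'a set \<Rightarrow> nat \<Rightarrow> (nat \<Rightarrow> int) \<Rightarrow> ('a \<Rightarrow> 'a) \<Rightarrow> int" where
  "chi X l a \<sigma> = alternant l (\<lambda>c. psi X l c \<sigma>) a"

lemma sum_shift_permutes:
  assumes w: "w permutes {..<l}"
  shows "(\<Sum>i<l. a i - int i + int (w i)) = (\<Sum>i<l. a i)"
proof -
  have "(\<Sum>i<l. int (w i)) = (\<Sum>i<l. int i)" using sum.permute[OF w, of int] by (simp add: o_def)
  then show ?thesis by (simp add: sum.distrib sum_subtractf)
qed

lemma sum_chi_mult: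
  "(\<Sum>\<sigma>\<in>A. chi X l a \<sigma> * h \<sigma>) =
    alternant l (\<lambda>c. \<Sum>\<sigma>\<in>A. psi X l c \<sigma> * h \<sigma>) a"
proof -
  have "(\<Sum>\<sigma>\<in>A. chi X l a \<sigma> * h \<sigma>) = (\<Sum>\<sigma>\<in>A. \<Sum>w | w permutes {..<l}.
      sign w * (psi X l (\<lambda>i. a i - int i + int (w i)) \<sigma> * h \<sigma>))"
    by (simp add: chi_def alternant_def sum_distrib_right mult.assoc)
  also have "\<dots> = (\<Sum>w | w permutes {..<l}. \<Sum>\<sigma>\<in>A.
      sign w * (psi X l (\<lambda>i. a i - int i + int (w i)) \<sigma> * h \<sigma>))" by (rule sum.swap)
  finally show ?thesis by (simp add: alternant_def sum_distrib_left)
qed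

text \<open>All index vectors in the expansion have the same total as \<open>a\<close>, and the
  inner product formula is available for exactly such vectors.\<close>

lemma alternant_scale_on_total:
  assumes "\<And>c. (\<Sum>i<l. c i) = (\<Sum>i<l. a i) \<Longrightarrow> F c = k * G c"
  shows "alternant l F a = k * alternant l G a"
proof -
  have "sign w * F (\<lambda>i. a i - int i + int (w i)) = k * (sign w * G (\<lambda>i. a i - int i + int (w i)))"
    if "w permutes {..<l}" for w
    using assms[OF sum_shift_permutes[OF that]] by simp
  then show ?thesis unfolding alternant_def sum_distrib_left by (intro sum.cong) auto
qed

lemma chi_psi_inner_product:
  assumes X: "finite X" and a: "(\<Sum>i<l. a i) = int (card X)"
  shows "(\<Sum>\<sigma> | \<sigma> permutes X. chi X l a \<sigma> * psi X m b \<sigma>) = fact (card X) * kostka UNIV l m b a"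
  unfolding sum_chi_mult kostka_def
  by (rule alternant_scale_on_total) (simp add: psi_inner_product[OF X] a mat_count_def)

lemma chi_sign_psi_inner_product:
  assumes X: "finite X" and a: "(\<Sum>i<l. a i) = int (card X)"
  shows "(\<Sum>\<sigma> | \<sigma> permutes X. chi X l a \<sigma> * (sign \<sigma> * psi X m b \<sigma>)) =
    fact (card X) * kostka {0, 1} l m b a"
  unfolding sum_chi_mult kostka_def
  by (rule alternant_scale_on_total)
    (simp add: psi_sign_inner_product[OF X] a mat_count_def mult.left_commute)

lemma sum_lessThan_card_le: "finite A \<Longrightarrow> (\<Sum>i<card A. i) \<le> \<Sum>A" for A :: "nat set"
proof (induction "card A" arbitrary: A)
  case 0 then show ?case by simp
next
  case (Suc n)
  then have ne: "A \<noteq> {}" by auto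
  have "A \<subseteq> {..Max A}" using Suc by auto
  then have "card A \<le> Suc (Max A)" using card_mono[of "{..Max A}" A] by simp
  then have n: "n \<le> Max A" using Suc by simp
  have c: "card (A - {Max A}) = n" using Suc ne by simp
  have "(\<Sum>i<n. i) \<le> \<Sum>(A - {Max A})" using Suc.hyps(1)[of "A - {Max A}"] c Suc.prems by simp
  moreover have "\<Sum>A = Max A + \<Sum>(A - {Max A})"
    using Suc.prems ne by (intro sum.remove) auto
  ultimately show ?case using n Suc.hyps(2)[symmetric] by simp
qed

text \<open>The first j values of \<open>w\<close> are distinct and hence sum to at least 0 + ... +
  (j - 1): every index vector in the determinant of \<open>b\<close> dominates \<open>b\<close>.
  This makes the determinantal formula triangular.\<close>

lemma prefix_shift_ge:
  assumes w: "w permutes {..<l}"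
  shows "(\<Sum>i<j. b i) \<le> (\<Sum>i<j. b i - int i + int (w i))"
proof -
  have "inj_on w {..<j}" using permutes_inj_on[OF w] .
  then have "(\<Sum>i<j. i) \<le> (\<Sum>i<j. w i)"
    using sum_lessThan_card_le[of "w ` {..<j}"] by (simp add: card_image sum.reindex)
  then have "(\<Sum>i<j. int i) \<le> (\<Sum>i<j. int (w i))" by (simp flip: of_nat_sum)
  then show ?thesis by (simp add: sum.distrib sum_subtractf)
qed

text \<open>Positive entries make the number \<open>l\<close> of parts an invariant, so that
  orthogonality can conclude \<open>l = m\<close>.\<close>

definition parts :: "nat \<Rightarrow> (nat \<Rightarrow> int) \<Rightarrow> bool" where
  "parts l a \<longleftrightarrow> decreasing l a \<and> (\<forall>i<l. 0 < a i)"

lemma chi_inner_product: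
  assumes X: "finite X" and a: "(\<Sum>i<l. a i) = int (card X)"
  shows "(\<Sum>\<sigma> | \<sigma> permutes X. chi X l a \<sigma> * chi X m b \<sigma>) =
    fact (card X) * (\<Sum>w | w permutes {..<m}. sign w * kostka UNIV l m (\<lambda>i. b i - int i + int (w i)) a)"
proof -
  have "(\<Sum>\<sigma> | \<sigma> permutes X. chi X l a \<sigma> * chi X m b \<sigma>) =
     alternant m (\<lambda>c. \<Sum>\<sigma> | \<sigma> permutes X. psi X m c \<sigma> * chi X l a \<sigma>) b"
    by (simp add: mult.commute[of "chi X l a _"] sum_chi_mult)
  also have "\<dots> = (\<Sum>w | w permutes {..<m}. sign w * (fact (card X) * kostka UNIV l m (\<lambda>i. b i - int i + int (w i)) a))"
    unfolding alternant_def mult.commute[of "psi X m _ _"] chi_psi_inner_product[OF X a] ..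
  finally show ?thesis by (simp add: sum_distrib_left mult.left_commute)
qed

text \<open>Some index vector of \<open>b\<close> has a nonzero Kostka number with \<open>a\<close>;
  it is dominated by \<open>a\<close> and dominates \<open>b\<close>. As m strips fill at most m
  rows, positivity of the parts gives \<open>l \<le> m\<close>.\<close>

lemma chi_inner_nonzero_dominance:
  assumes X: "finite X" and pa: "parts l a" and a: "(\<Sum>i<l. a i) = int (card X)"
    and nz: "(\<Sum>\<sigma> | \<sigma> permutes X. chi X l a \<sigma> * chi X m b \<sigma>) \<noteq> 0"
  shows "l \<le> m \<and> (\<forall>j\<le>m. (\<Sum>i<j. b i) \<le> (\<Sum>i<min j l. a i))"
proof -
  from nz obtain w where w: "w permutes {..<m}"
    and k: "kostka UNIV l m (\<lambda>i. b i - int i + int (w i)) a \<noteq> 0"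
    unfolding chi_inner_product[OF X a] by (auto elim!: sum.not_neutral_contains_not_neutral)
  have dec: "decreasing l a" using pa by (simp add: parts_def)
  note dom = kostka_horizontal_dominance[OF dec k]
  have "l \<le> m"
  proof (rule ccontr)
    assume "\<not> l \<le> m"
    then have "m < l" by simp
    then have "a m = 0" using dom[THEN conjunct1, rule_format, of m] by simp
    then show False using pa \<open>m < l\<close> by (auto simp: parts_def)
  qed
  moreover have "(\<Sum>i<j. b i) \<le> (\<Sum>i<min j l. a i)" if "j \<le> m" for j
    using prefix_shift_ge[OF w, of b j] dom that by (meson order_trans)
  ultimately show ?thesis by blast
qed

theorem chi_orthogonal:
  assumes X: "finite X" and pa: "parts l a" "parts m b"
    and a: "(\<Sum>i<l. a i) = int (card X)" and b: "(\<Sum>i<m. b i) = int (card X)"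
    and nz: "(\<Sum>\<sigma> | \<sigma> permutes X. chi X l a \<sigma> * chi X m b \<sigma>) \<noteq> 0"
  shows "l = m \<and> (\<forall>i<l. a i = b i)"
proof -
  have nz': "(\<Sum>\<sigma> | \<sigma> permutes X. chi X m b \<sigma> * chi X l a \<sigma>) \<noteq> 0"
    using nz by (simp add: mult.commute)
  note d1 = chi_inner_nonzero_dominance[OF X pa(1) a nz]
  note d2 = chi_inner_nonzero_dominance[OF X pa(2) b nz']
  have lm: "l = m" using d1 d2 by simp
  have eq: "(\<Sum>i<j. a i) = (\<Sum>i<j. b i)" if "j \<le> l" for j
  proof (rule antisym)
    show "(\<Sum>i<j. a i) \<le> (\<Sum>i<j. b i)" using d2 that lm by (simp add: min_absorb1)
    show "(\<Sum>i<j. b i) \<le> (\<Sum>i<j. a i)" using d1 that lm by (simp add: min_absorb1)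
  qed
  have "a i = b i" if "i < l" for i using eq[of i] eq[of "Suc i"] that by simp
  then show ?thesis using lm by blast
qed

theorem chi_norm:
  assumes X: "finite X" and pa: "parts l a" and a: "(\<Sum>i<l. a i) = int (card X)"
  shows "(\<Sum>\<sigma> | \<sigma> permutes X. chi X l a \<sigma> * chi X l a \<sigma>) = fact (card X)"
proof -
  have dec: "decreasing l a" using pa by (simp add: parts_def)
  have "sign w * kostka UNIV l l (\<lambda>i. a i - int i + int (w i)) a = (if w = id then 1 else 0)"
    if w: "w permutes {..<l}" for w
  proof (cases "w = id")
    case True
    then show ?thesis using kostka_horizontal_diag[OF dec] pa by (simp add: parts_def less_imp_le)
  next
    case False
    \<comment> \<open>For \<open>w \<noteq> id\<close> the index vector lies strictly above
      \<open>a\<close> in dominance order, whereas a nonzero Kostka number would put it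
      below.\<close>
    have "kostka UNIV l l (\<lambda>i. a i - int i + int (w i)) a = 0"
    proof (rule ccontr)
      assume k: "kostka UNIV l l (\<lambda>i. a i - int i + int (w i)) a \<noteq> 0"
      have eq: "(\<Sum>i<j. a i - int i + int (w i)) = (\<Sum>i<j. a i)" if "j \<le> l" for j
      proof (rule antisym)
        show "(\<Sum>i<j. a i - int i + int (w i)) \<le> (\<Sum>i<j. a i)"
          using kostka_horizontal_dominance[OF dec k] that by (auto simp: min_absorb1)
        show "(\<Sum>i<j. a i) \<le> (\<Sum>i<j. a i - int i + int (w i))" by (rule prefix_shift_ge[OF w])
      qed
      have "w i = i" for i
      proof (cases "i < l")
        case True then show ?thesis using eq[of i] eq[of "Suc i"] by simp
      next
        case False then show ?thesis using w by (simp add: permutes_not_in)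
      qed
      then show False using False by auto
    qed
    then show ?thesis using False by simp
  qed
  then have "(\<Sum>w | w permutes {..<l}. sign w * kostka UNIV l l (\<lambda>i. a i - int i + int (w i)) a) = 1"
    by (simp add: finite_permutations permutes_id)
  then show ?thesis unfolding chi_inner_product[OF X a] by simp
qed

section \<open>Branching and skew tableaux\<close>

lemma psi_insert:
  assumes X: "finite X" and z: "z \<notin> X" and \<sigma>: "\<sigma> permutes X"
  shows "psi (insert z X) l c \<sigma> = (\<Sum>i<l. psi X l (c(i := c i - 1)) \<sigma>)"
proof -
  let ?Y = "insert z X"
  let ?A = "{B \<in> type_colorings ?Y {..<l} c. \<forall>x\<in>?Y. B (\<sigma> x) = B x}"
  let ?S = "\<lambda>i. {B \<in> type_colorings X {..<l} (c(i := c i - 1)). \<forall>x\<in>X. B (\<sigma> x) = B x}"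
  have sz: "\<sigma> z = z" using \<sigma> z by (simp add: permutes_not_in)
  have sX: "\<sigma> x \<in> X \<longleftrightarrow> x \<in> X" for x using permutes_in_image[OF \<sigma>] .
  have cnt: "card {x \<in> ?Y. B x = k} = card {x \<in> X. B x = k} + (if B z = k then 1 else 0)"
    for B :: "'a \<Rightarrow> nat" and k
  proof -
    have "{x \<in> ?Y. B x = k} = (if B z = k then insert z {x \<in> X. B x = k} else {x \<in> X. B x = k})" by auto
    then show ?thesis using X z by simp
  qed
  have "bij_betw (\<lambda>B. (B z, restrict B X)) ?A (Sigma {..<l} ?S)"
  proof (rule bij_betw_byWitness[where f' = "\<lambda>(i, B). B(z := i)"], goal_cases)
    case 1
    show ?case using z
      by (auto simp: type_colorings_def fun_eq_iff restrict_def PiE_def extensional_def)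
  next
    case 2
    show ?case using z
      by (auto simp: type_colorings_def fun_eq_iff restrict_def PiE_def extensional_def)
  next
    case 3
    show ?case
    proof
      fix p assume "p \<in> (\<lambda>B. (B z, restrict B X)) ` ?A"
      then obtain B where p: "p = (B z, restrict B X)" and B: "B \<in> ?Y \<rightarrow>\<^sub>E {..<l}"
        "\<And>k. k < l \<Longrightarrow> int (card {x \<in> ?Y. B x = k}) = c k" "\<And>x. x \<in> X \<Longrightarrow> B (\<sigma> x) = B x"
        by (auto simp: type_colorings_def)
      have Bz: "B z < l" using B(1) by auto
      have e: "{x \<in> X. restrict B X x = k} = {x \<in> X. B x = k}" for k by auto
      have "int (card {x \<in> X. restrict B X x = k}) = (c(B z := c (B z) - 1)) k" if "k < l" for k
        using B(2)[OF that] unfolding cnt e by auto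
      moreover have "restrict B X \<in> X \<rightarrow>\<^sub>E {..<l}" using B(1) by auto
      ultimately show "p \<in> Sigma {..<l} ?S"
        using Bz B(3) sX unfolding p type_colorings_def by simp
    qed
  next
    case 4
    show ?case
    proof
      fix B' assume "B' \<in> (\<lambda>(i, B). B(z := i)) ` Sigma {..<l} ?S"
      then obtain i B where B': "B' = B(z := i)" and i: "i < l" and B: "B \<in> X \<rightarrow>\<^sub>E {..<l}"
        "\<And>k. k < l \<Longrightarrow> int (card {x \<in> X. B x = k}) = (c(i := c i - 1)) k"
        "\<And>x. x \<in> X \<Longrightarrow> B (\<sigma> x) = B x"
        by (auto simp: type_colorings_def)
      have e: "{x \<in> X. B' x = k} = {x \<in> X. B x = k}" for k using z by (auto simp: B')
      have "int (card {x \<in> ?Y. B' x = k}) = c k" if "k < l" for k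
        using B(2)[OF that] unfolding cnt e by (simp add: B' split: if_splits)
      moreover have "B' \<in> ?Y \<rightarrow>\<^sub>E {..<l}"
        using B(1) i unfolding B' by (auto simp: PiE_def Pi_def extensional_def)
      moreover have "B' (\<sigma> x) = B' x" if "x \<in> ?Y" for x
      proof (cases "x = z")
        case True then show ?thesis using sz by simp
      next
        case False
        then have "\<sigma> x \<noteq> z" "x \<in> X" using that sX[of x] z by auto
        then show ?thesis using B(3) False by (simp add: B')
      qed
      ultimately show "B' \<in> ?A" by (auto simp: type_colorings_def)
    qed
  qed
  then have "card ?A = card (Sigma {..<l} ?S)" by (rule bij_betw_same_card)
  also have "\<dots> = (\<Sum>i<l. card (?S i))"
    using X finite_type_colorings[of X "{..<l}"] by (subst card_SigmaI) auto
  finally show ?thesis by (simp add: psi_def)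
qed

lemma chi_insert:
  assumes X: "finite X" and z: "z \<notin> X" and \<sigma>: "\<sigma> permutes X"
  shows "chi (insert z X) l a \<sigma> = (\<Sum>i<l. chi X l (a(i := a i - 1)) \<sigma>)"
proof -
  have e: "(\<lambda>j. a j - int j + int (w j))(i := a i - int i + int (w i) - 1) =
     (\<lambda>j. (a(i := a i - 1)) j - int j + int (w j))" for i and w :: "nat \<Rightarrow> nat" by auto
  have "chi (insert z X) l a \<sigma> = (\<Sum>w | w permutes {..<l}. \<Sum>i<l. sign w *
      psi X l (\<lambda>j. (a(i := a i - 1)) j - int j + int (w j)) \<sigma>)"
    unfolding chi_def alternant_def psi_insert[OF assms] e sum_distrib_left ..
  also have "\<dots> = (\<Sum>i<l. chi X l (a(i := a i - 1)) \<sigma>)"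
    unfolding chi_def alternant_def by (rule sum.swap)
  finally show ?thesis .
qed

lemma psi_trailing_zero:
  assumes X: "finite X" and \<sigma>: "\<sigma> permutes X" and z: "a l = 0"
  shows "psi X (Suc l) a \<sigma> = psi X l a \<sigma>"
proof -
  have "B x < l" if B: "B \<in> X \<rightarrow>\<^sub>E {..<Suc l}" "card {x\<in>X. B x = l} = 0" and x: "x \<in> X" for B x
  proof -
    have "{x\<in>X. B x = l} = {}" using B(2) X by simp
    then have "B x \<noteq> l" using x by auto
    moreover have "B x < Suc l" using B(1) x by auto
    ultimately show ?thesis by simp
  qed
  moreover have "{x\<in>X. B x = l} = {}" if "B \<in> X \<rightarrow>\<^sub>E {..<l}" for B
    using that by (auto simp: PiE_def Pi_def)
  note old = calculation this
  have "type_colorings X {..<Suc l} a = type_colorings X {..<l} a"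
  proof (intro set_eqI iffI)
    fix B assume B: "B \<in> type_colorings X {..<Suc l} a"
    then have "B \<in> X \<rightarrow>\<^sub>E {..<Suc l}" "int (card {x\<in>X. B x = l}) = a l"
      unfolding type_colorings_def by blast+
    then have "B \<in> X \<rightarrow>\<^sub>E {..<Suc l}" "card {x\<in>X. B x = l} = 0"
      using z by simp_all
    then have "\<And>x. x \<in> X \<Longrightarrow> B x < l" "B \<in> extensional X" using old(1) by (auto simp: PiE_def)
    then have "B \<in> X \<rightarrow>\<^sub>E {..<l}" by (simp add: PiE_def Pi_def)
    then show "B \<in> type_colorings X {..<l} a" using B by (simp add: type_colorings_def)
  next
    fix B assume B: "B \<in> type_colorings X {..<l} a"
    then have "B \<in> X \<rightarrow>\<^sub>E {..<l}" by (simp add: type_colorings_def)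
    moreover from this have "B \<in> X \<rightarrow>\<^sub>E {..<Suc l}" by (auto simp: PiE_def Pi_def less_Suc_eq)
    ultimately show "B \<in> type_colorings X {..<Suc l} a"
      using B z old(2)[of B] by (auto simp: type_colorings_def less_Suc_eq simp del: Collect_empty_eq)
  qed
  then show ?thesis by (simp add: psi_def)
qed

lemma chi_trailing_zero:
  assumes X: "finite X" and \<sigma>: "\<sigma> permutes X" and z: "a l = 0"
  shows "chi X (Suc l) a \<sigma> = chi X l a \<sigma>"
  unfolding chi_def alternant_def
proof (rule sum.mono_neutral_cong_right)
  show "{w. w permutes {..<l}} \<subseteq> {w. w permutes {..<Suc l}}"
  proof (intro subsetI, unfold mem_Collect_eq)
    fix w assume "w permutes {..<l}"
    then show "w permutes {..<Suc l}" by (rule permutes_subset) auto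
  qed
  show "\<forall>w\<in>{w. w permutes {..<Suc l}} - {w. w permutes {..<l}}.
       sign w * psi X (Suc l) (\<lambda>i. a i - int i + int (w i)) \<sigma> = 0"
  proof
    fix w assume w: "w \<in> {w. w permutes {..<Suc l}} - {w. w permutes {..<l}}"
    \<comment> \<open>If w moves l, then w l < l, and the index in row l is negative because
      \<open>a l = 0\<close>.\<close>
    have "w l \<noteq> l"
    proof
      assume wl: "w l = l"
      have "w permutes {..<l}"
      proof (rule permutes_superset[of w "{..<Suc l}"])
        show "w permutes {..<Suc l}" using w by blast
        fix x assume "x \<in> {..<Suc l} - {..<l}"
        then have "x = l" by simp
        then show "w x = x" using wl by simp
      qed
      then show False using w by blast
    qed
    moreover have "w l < Suc l" using w permutes_in_image[of w "{..<Suc l}" l] by simp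
    ultimately have "psi X (Suc l) (\<lambda>i. a i - int i + int (w i)) \<sigma> = 0"
      using z by (intro psi_neg[of l]) auto
    then show "sign w * psi X (Suc l) (\<lambda>i. a i - int i + int (w i)) \<sigma> = 0" by simp
  qed
next
  fix w assume "w \<in> {w. w permutes {..<l}}"
  then have "w l = l" by (simp add: permutes_not_in)
  then show "sign w * psi X (Suc l) (\<lambda>i. a i - int i + int (w i)) \<sigma> =
     sign w * psi X l (\<lambda>i. a i - int i + int (w i)) \<sigma>"
    using z psi_trailing_zero[OF X \<sigma>] by simp
qed (simp add: finite_permutations)

lemma chi_cong:
  assumes "\<sigma> permutes X" "\<And>i. i < l \<Longrightarrow> a i = b i"
  shows "chi X l a \<sigma> = chi X l b \<sigma>"
  unfolding chi_def by (rule alternant_cong[OF symmetric_psi[OF assms(1)] assms(2)])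

subsection \<open>Partitions and their diagrams\<close>

lemma is_partition_nth_le:
  "is_partition lam \<Longrightarrow> i \<le> j \<Longrightarrow> j < length lam \<Longrightarrow> lam ! j \<le> lam ! i"
  by (auto simp: is_partition_def intro: sorted_rev_nth_mono)

lemma is_partition_nth_pos: "is_partition lam \<Longrightarrow> i < length lam \<Longrightarrow> 0 < lam ! i"
  by (metis is_partition_def neq0_conv nth_mem)

lemma is_partitionI:
  assumes "\<And>i. Suc i < length lam \<Longrightarrow> lam ! Suc i \<le> lam ! i" "\<And>i. i < length lam \<Longrightarrow> 0 < lam ! i"
  shows "is_partition lam"
proof -
  have "sorted_wrt (\<ge>) lam"
    using assms(1) by (subst sorted_wrt_iff_nth_Suc_transp) (auto intro: transpI)
  then have "sorted (rev lam)" by (simp add: sorted_wrt_rev)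
  then show ?thesis using assms(2) unfolding is_partition_def by (metis in_set_conv_nth less_irrefl)
qed

lemma parts_of_partition:
  "is_partition lam \<Longrightarrow> parts (length lam) (\<lambda>i. int (lam ! i))"
  by (auto simp: parts_def decreasing_def is_partition_nth_le is_partition_nth_pos)

lemma sum_parts: "(\<Sum>i<length lam. int (lam ! i)) = int (sum_list lam)"
  by (simp add: sum_list_sum_nth atLeast0LessThan)

lemma irr_char_eq_chi: "irr_char lam \<sigma> = chi {1..sum_list lam} (length lam) (\<lambda>i. int (lam ! i)) \<sigma>"
  unfolding irr_char_def chi_def alternant_def Let_def young_perm_char_eq_psi atLeast0LessThan ..

definition corners :: "nat list \<Rightarrow> nat set" where
  "corners lam = {i. i < length lam \<and> (Suc i < length lam \<longrightarrow> lam ! Suc i < lam ! i)}"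

text \<open>A corner row with a single box is the last row, so dropping the last entry removes it
  and leaves no zero part in the list.\<close>

definition rem_box :: "nat list \<Rightarrow> nat \<Rightarrow> nat list" where
  "rem_box lam i = (if lam ! i = 1 then butlast lam else lam[i := lam ! i - 1])"

lemma corner_one_last:
  assumes "is_partition lam" "i \<in> corners lam" "lam ! i = 1"
  shows "Suc i = length lam"
  using assms is_partition_nth_pos[of lam "Suc i"] by (force simp: corners_def)

lemma rem_box_partition:
  assumes lam: "is_partition lam" and i: "i \<in> corners lam"
  shows "is_partition (rem_box lam i)"
proof (cases "lam ! i = 1")
  case True
  then show ?thesis using lam
    by (intro is_partitionI) (auto simp: rem_box_def nth_butlast is_partition_nth_le is_partition_nth_pos)
next
  case False
  have il: "i < length lam" using i by (simp add: corners_def)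
  have "2 \<le> lam ! i" using False is_partition_nth_pos[OF lam il] by simp
  then show ?thesis using lam i False
    by (intro is_partitionI)
      (auto simp: rem_box_def nth_list_update corners_def is_partition_nth_pos
        intro!: order_trans[OF diff_le_self is_partition_nth_le] intro: is_partition_nth_le)
qed

lemma young_rem_box:
  assumes lam: "is_partition lam" and i: "i \<in> corners lam"
  shows "young (rem_box lam i) = young lam - {(i, lam ! i - 1)}"
proof (cases "lam ! i = 1")
  case True
  have l: "Suc i = length lam" by (rule corner_one_last[OF lam i True])
  show ?thesis
  proof (intro set_eqI, clarify)
    fix a b
    have "a < length lam - 1 \<longleftrightarrow> a < length lam \<and> a \<noteq> i" using l by auto
    then show "(a, b) \<in> young (rem_box lam i) \<longleftrightarrow> (a, b) \<in> young lam - {(i, lam ! i - 1)}"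
      using True by (auto simp: young_def rem_box_def nth_butlast)
  qed
next
  case False
  have il: "i < length lam" using i by (simp add: corners_def)
  show ?thesis using False il
    by (auto simp: young_def rem_box_def nth_list_update split: if_splits)
qed

lemma young_altdef: "young lam = Sigma {..<length lam} (\<lambda>i. {..<lam ! i})"
  by (auto simp: young_def)

lemma finite_young [simp]: "finite (young lam)"
  by (simp add: young_altdef)

lemma card_young: "card (young lam) = sum_list lam"
  by (simp add: young_altdef sum_list_sum_nth atLeast0LessThan)

lemma sum_list_rem_box:
  assumes "is_partition lam" "i \<in> corners lam"
  shows "sum_list (rem_box lam i) = sum_list lam - 1"
proof -
  have "(i, lam ! i - 1) \<in> young lam"
    using assms is_partition_nth_pos[OF assms(1), of i] by (auto simp: young_def corners_def)
  then show ?thesis using young_rem_box[OF assms] by (simp flip: card_young)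
qed

lemma young_inj:
  assumes "is_partition lam" "is_partition mu" "young lam = young mu"
  shows "lam = mu"
proof (rule nth_equalityI)
  have len: "length nu = card {i. (i, 0) \<in> young nu}" if "is_partition nu" for nu
  proof -
    have "{i. (i, 0) \<in> young nu} = {..<length nu}" using is_partition_nth_pos[OF that] by (auto simp: young_def)
    then show ?thesis by simp
  qed
  show l: "length lam = length mu" using len assms by metis
  fix i assume i: "i < length lam"
  have "nu ! i = card {j. (i, j) \<in> young nu}" if "i < length nu" for nu
    using that by (simp add: young_def)
  then show "lam ! i = mu ! i" using i l assms(3) by metis
qed

theorem irr_char_branching:
  assumes lam: "is_partition lam" and n: "sum_list lam = Suc n" and \<sigma>: "\<sigma> permutes {1..n}"
  shows "irr_char lam \<sigma> = (\<Sum>i\<in>corners lam. irr_char (rem_box lam i) \<sigma>)"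
proof -
  let ?l = "length lam" and ?a = "\<lambda>i. int (lam ! i)"
  have ins: "{1..Suc n} = insert (Suc n) {1..n}" by auto
  have "irr_char lam \<sigma> = (\<Sum>i<?l. chi {1..n} ?l (?a(i := ?a i - 1)) \<sigma>)"
    unfolding irr_char_eq_chi n ins by (rule chi_insert) (use \<sigma> in auto)
  also have "\<dots> = (\<Sum>i\<in>corners lam. chi {1..n} ?l (?a(i := ?a i - 1)) \<sigma>)"
  proof (rule sum.mono_neutral_right)
    \<comment> \<open>If row i + 1 is as long as row i, taking a box from row i makes two rows of
      the determinant equal.\<close>
    show "\<forall>i\<in>{..<?l} - corners lam. chi {1..n} ?l (?a(i := ?a i - 1)) \<sigma> = 0"
    proof
      fix i assume "i \<in> {..<?l} - corners lam"
      then have i: "Suc i < ?l" "lam ! i \<le> lam ! Suc i" by (auto simp: corners_def)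
      then have "lam ! Suc i = lam ! i" using is_partition_nth_le[OF lam, of i "Suc i"] by simp
      then show "chi {1..n} ?l (?a(i := ?a i - 1)) \<sigma> = 0"
        unfolding chi_def using i by (intro alternant_zero[OF symmetric_psi[OF \<sigma>] i(1)]) simp
    qed
  qed (auto simp: corners_def)
  also have "\<dots> = (\<Sum>i\<in>corners lam. irr_char (rem_box lam i) \<sigma>)"
  proof (rule sum.cong[OF refl])
    fix i assume i: "i \<in> corners lam"
    then have il: "i < ?l" by (simp add: corners_def)
    have s: "sum_list (rem_box lam i) = n" using sum_list_rem_box[OF lam i] n by simp
    show "chi {1..n} ?l (?a(i := ?a i - 1)) \<sigma> = irr_char (rem_box lam i) \<sigma>"
    proof (cases "lam ! i = 1")
      case True
      then have l: "?l = Suc i" using corner_one_last[OF lam i] by simp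
      have "chi {1..n} (Suc i) (?a(i := ?a i - 1)) \<sigma> = chi {1..n} i (?a(i := ?a i - 1)) \<sigma>"
        by (rule chi_trailing_zero[OF _ \<sigma>]) (use True in auto)
      also have "\<dots> = chi {1..n} i (\<lambda>j. int (rem_box lam i ! j)) \<sigma>"
        by (rule chi_cong[OF \<sigma>]) (use True l in \<open>auto simp: rem_box_def nth_butlast\<close>)
      finally show ?thesis using True l by (simp add: irr_char_eq_chi s) (simp add: rem_box_def)
    next
      case False
      then have len: "length (rem_box lam i) = ?l" by (simp add: rem_box_def)
      have pos: "0 < lam ! i" using is_partition_nth_pos[OF lam il] .
      show ?thesis unfolding irr_char_eq_chi s len
        by (rule chi_cong[OF \<sigma>]) (use False il pos in \<open>auto simp: rem_box_def nth_list_update\<close>)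
    qed
  qed
  finally show ?thesis .
qed

subsection \<open>Standard fillings\<close>

text \<open>The shape is an arbitrary set of boxes, so that single boxes can be removed without
  describing the result as a skew shape.\<close>

definition syt :: "(nat \<times> nat) set \<Rightarrow> (nat \<times> nat \<Rightarrow> nat) set" where
  "syt D = {T. bij_betw T D {1..card D} \<and> (\<forall>c. c \<notin> D \<longrightarrow> T c = 0) \<and>
          (\<forall>i j. (i, j) \<in> D \<and> (i, Suc j) \<in> D \<longrightarrow> T (i, j) < T (i, Suc j)) \<and>
          (\<forall>i j. (i, j) \<in> D \<and> (Suc i, j) \<in> D \<longrightarrow> T (i, j) < T (Suc i, j))}"

lemma f_skew_eq_syt: "f_skew lam mu = card (syt (young lam - young mu))"
  by (simp add: f_skew_def skew_syt_def syt_def Let_def)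

lemma syt_empty: "syt {} = {\<lambda>_. 0}"
  by (auto simp: syt_def bij_betw_def)

lemma syt_bij: "T \<in> syt D \<Longrightarrow> bij_betw T D {1..card D}"
  by (simp add: syt_def)

lemma syt_outside: "T \<in> syt D \<Longrightarrow> c \<notin> D \<Longrightarrow> T c = 0"
  unfolding syt_def by blast

lemma finite_syt:
  assumes "finite D"
  shows "finite (syt D)"
proof -
  have "inj_on (\<lambda>T. restrict T D) (syt D)"
  proof (rule inj_onI, rule ext)
    fix S T c assume ST: "S \<in> syt D" "T \<in> syt D" and e: "restrict S D = restrict T D"
    show "S c = T c"
      using fun_cong[OF e, of c] syt_outside[OF ST(1), of c] syt_outside[OF ST(2), of c]
      by (cases "c \<in> D") auto
  qed
  moreover have "(\<lambda>T. restrict T D) ` syt D \<subseteq> D \<rightarrow>\<^sub>E {1..card D}"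
    by (auto simp: syt_def bij_betw_def)
  moreover have "finite (D \<rightarrow>\<^sub>E {1..card D})" using assms by (intro finite_PiE) auto
  ultimately show ?thesis by (meson finite_imageD finite_subset)
qed

definition maximal_boxes :: "(nat \<times> nat) set \<Rightarrow> (nat \<times> nat) set" where
  "maximal_boxes D = {(i, j) \<in> D. (i, Suc j) \<notin> D \<and> (Suc i, j) \<notin> D}"

text \<open>The largest entry \<open>card D\<close> sits in a box without right or lower neighbour
  in \<open>D\<close>; conversely it can be put back into any such box.\<close>

lemma card_syt_recursion:
  assumes D: "finite D" "D \<noteq> {}"
  shows "card (syt D) = (\<Sum>c\<in>maximal_boxes D. card (syt (D - {c})))"
proof -
  let ?N = "card D"
  have N: "0 < ?N" using D by (simp add: card_gt_0_iff)
  have cD: "card (D - {c}) = ?N - 1" if "c \<in> D" for c using D that by simp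
  have fm: "finite (maximal_boxes D)" using D(1) by (rule rev_finite_subset) (auto simp: maximal_boxes_def)
  have "bij_betw (\<lambda>(c, T). T(c := ?N)) (Sigma (maximal_boxes D) (\<lambda>c. syt (D - {c}))) (syt D)"
    unfolding bij_betw_def
  proof
    show "inj_on (\<lambda>(c, T). T(c := ?N)) (Sigma (maximal_boxes D) (\<lambda>c. syt (D - {c})))"
    proof (rule inj_onI)
      fix p p'
      assume pp: "p \<in> Sigma (maximal_boxes D) (\<lambda>c. syt (D - {c}))"
        "p' \<in> Sigma (maximal_boxes D) (\<lambda>c. syt (D - {c}))"
        "(\<lambda>(c, T). T(c := ?N)) p = (\<lambda>(c, T). T(c := ?N)) p'"
      obtain i j T where p: "p = ((i, j), T)" by (metis surj_pair)
      obtain i' j' T' where p': "p' = ((i', j'), T')" by (metis surj_pair)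
      have c: "(i, j) \<in> maximal_boxes D" "T \<in> syt (D - {(i, j)})"
        and c': "(i', j') \<in> maximal_boxes D" "T' \<in> syt (D - {(i', j')})"
        and e: "T((i, j) := ?N) = T'((i', j') := ?N)"
        using pp unfolding p p' by auto
      have inD: "(i, j) \<in> D" "(i', j') \<in> D" using c(1) c'(1) by (auto simp: maximal_boxes_def)
      have lt: "T x < ?N" for x
      proof (cases "x \<in> D - {(i, j)}")
        case True
        then have "T x \<in> {1..?N - 1}"
          using bij_betwE[OF syt_bij[OF c(2)]] cD[OF inD(1)] by metis
        then show ?thesis using N by auto
      next
        case False then show ?thesis using syt_outside[OF c(2)] N by simp
      qed
      have cc: "(i, j) = (i', j')"
      proof (rule ccontr)
        assume ne: "(i, j) \<noteq> (i', j')"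
        then have "T (i', j') = ?N" using fun_cong[OF e, of "(i', j')"] by auto
        then show False using lt[of "(i', j')"] by simp
      qed
      moreover have "T = T'"
      proof
        fix x show "T x = T' x"
        proof (cases "x = (i, j)")
          case True
          then show ?thesis using syt_outside[OF c(2), of x] syt_outside[OF c'(2), of x] cc by simp
        next
          case False then show ?thesis using fun_cong[OF e, of x] cc by simp
        qed
      qed
      ultimately show "p = p'" by (simp add: p p')
    qed
    show "(\<lambda>(c, T). T(c := ?N)) ` Sigma (maximal_boxes D) (\<lambda>c. syt (D - {c})) = syt D"
    proof (intro equalityI subsetI)
      fix S assume "S \<in> (\<lambda>(c, T). T(c := ?N)) ` Sigma (maximal_boxes D) (\<lambda>c. syt (D - {c}))"
      then obtain p where p: "p \<in> Sigma (maximal_boxes D) (\<lambda>c. syt (D - {c}))"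
        "S = (\<lambda>(c, T). T(c := ?N)) p" by (elim imageE)
      obtain i j T where p': "p = ((i, j), T)" by (metis surj_pair)
      have S: "S = T((i, j) := ?N)" and m: "(i, j) \<in> maximal_boxes D"
        and T: "T \<in> syt (D - {(i, j)})" using p unfolding p' by simp_all
      have inD: "(i, j) \<in> D" using m by (auto simp: maximal_boxes_def)
      have bT: "bij_betw T (D - {(i, j)}) {1..?N - 1}" using T cD[OF inD] by (simp add: syt_def)
      have lt: "T x < ?N" if "x \<in> D - {(i, j)}" for x
        using bij_betwE[OF bT] that N by (metis One_nat_def Suc_pred atLeastAtMost_iff le_imp_less_Suc)
      have "bij_betw S (D - {(i, j)}) {1..?N - 1}"
        using bij_betw_cong[of "D - {(i, j)}" S T] bT by (simp add: S)
      then have "bij_betw S ((D - {(i, j)}) \<union> {(i, j)}) ({1..?N - 1} \<union> {S (i, j)})"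
        using N by (intro notIn_Un_bij_betw) (auto simp: S)
      moreover have "(D - {(i, j)}) \<union> {(i, j)} = D" using inD by auto
      moreover have "{1..?N - 1} \<union> {S (i, j)} = {1..?N}" using N by (auto simp: S)
      ultimately have "bij_betw S D {1..?N}" by simp
      moreover have "S (a, b) < S (a, Suc b)" if "(a, b) \<in> D" "(a, Suc b) \<in> D" for a b
      proof -
        have "(a, b) \<noteq> (i, j)" using m that by (auto simp: maximal_boxes_def)
        then have ne: "(a, b) \<in> D - {(i, j)}" using that by simp
        show ?thesis
        proof (cases "(a, Suc b) = (i, j)")
          case True then show ?thesis using lt[OF ne] ne by (auto simp: S)
        next
          case False
          then have "T (a, b) < T (a, Suc b)" using T ne that unfolding syt_def by blast
          then show ?thesis using False ne by (auto simp: S)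
        qed
      qed
      moreover have "S (a, b) < S (Suc a, b)" if "(a, b) \<in> D" "(Suc a, b) \<in> D" for a b
      proof -
        have "(a, b) \<noteq> (i, j)" using m that by (auto simp: maximal_boxes_def)
        then have ne: "(a, b) \<in> D - {(i, j)}" using that by simp
        show ?thesis
        proof (cases "(Suc a, b) = (i, j)")
          case True then show ?thesis using lt[OF ne] ne by (auto simp: S)
        next
          case False
          then have "T (a, b) < T (Suc a, b)" using T ne that unfolding syt_def by blast
          then show ?thesis using False ne by (auto simp: S)
        qed
      qed
      moreover have "S c = 0" if "c \<notin> D" for c
        using syt_outside[OF T, of c] that inD by (auto simp: S)
      ultimately show "S \<in> syt D" unfolding syt_def by blast
    next
      fix S assume S: "S \<in> syt D"
      then have b: "bij_betw S D {1..?N}" by (simp add: syt_def)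
      then have "?N \<in> S ` D" using N bij_betw_imp_surj_on[OF b] by simp
      then obtain i j where c: "(i, j) \<in> D" "S (i, j) = ?N" by (metis imageE surj_pair)
      have le: "S x \<le> ?N" if "x \<in> D" for x using bij_betwE[OF b] that by simp
      have "(i, Suc j) \<notin> D"
      proof
        assume d: "(i, Suc j) \<in> D"
        then have "S (i, j) < S (i, Suc j)" using S c(1) unfolding syt_def by blast
        then show False using le[OF d] c(2) by simp
      qed
      moreover have "(Suc i, j) \<notin> D"
      proof
        assume d: "(Suc i, j) \<in> D"
        then have "S (i, j) < S (Suc i, j)" using S c(1) unfolding syt_def by blast
        then show False using le[OF d] c(2) by simp
      qed
      ultimately have m: "(i, j) \<in> maximal_boxes D" using c(1) by (simp add: maximal_boxes_def)
      define T where "T = S((i, j) := 0)"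
      have "bij_betw S (D - {(i, j)}) ({1..?N} - {S (i, j)})"
      proof (rule bij_betw_DiffI[OF b])
        show "bij_betw S {(i, j)} {S (i, j)}" by (simp add: bij_betw_def)
      qed (use c N in auto)
      moreover have "{1..?N} - {S (i, j)} = {1..?N - 1}" using c N by auto
      ultimately have "bij_betw S (D - {(i, j)}) {1..card (D - {(i, j)})}" using cD[OF c(1)] by simp
      then have "bij_betw T (D - {(i, j)}) {1..card (D - {(i, j)})}"
        using bij_betw_cong[of "D - {(i, j)}" T S] by (simp add: T_def)
      moreover have "T c = 0" if "c \<notin> D - {(i, j)}" for c
        using syt_outside[OF S, of c] that by (auto simp: T_def)
      moreover have "T (a, b) < T (a, Suc b)" if "(a, b) \<in> D - {(i, j)}" "(a, Suc b) \<in> D - {(i, j)}" for a b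
      proof -
        have "S (a, b) < S (a, Suc b)" using S that unfolding syt_def by blast
        then show ?thesis using that by (auto simp: T_def)
      qed
      moreover have "T (a, b) < T (Suc a, b)" if "(a, b) \<in> D - {(i, j)}" "(Suc a, b) \<in> D - {(i, j)}" for a b
      proof -
        have "S (a, b) < S (Suc a, b)" using S that unfolding syt_def by blast
        then show ?thesis using that by (auto simp: T_def)
      qed
      ultimately have "T \<in> syt (D - {(i, j)})" unfolding syt_def by blast
      then have "((i, j), T) \<in> Sigma (maximal_boxes D) (\<lambda>c. syt (D - {c}))" using m by simp
      moreover have "S = (\<lambda>(c, T). T(c := ?N)) ((i, j), T)" using c by (auto simp: T_def)
      ultimately show "S \<in> (\<lambda>(c, T). T(c := ?N)) ` Sigma (maximal_boxes D) (\<lambda>c. syt (D - {c}))"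
        by (rule rev_image_eqI)
    qed
  qed
  then have "card (syt D) = card (Sigma (maximal_boxes D) (\<lambda>c. syt (D - {c})))"
    by (rule bij_betw_same_card[symmetric])
  then show ?thesis using fm D finite_syt by (simp add: card_SigmaI)
qed

lemma young_down_closed:
  assumes "is_partition mu" "(i, j) \<in> young mu" "i' \<le> i" "j' \<le> j"
  shows "(i', j') \<in> young mu"
proof -
  have ij: "i < length mu" "j < mu ! i" using assms(2) by (simp_all add: young_def)
  have "mu ! i \<le> mu ! i'" by (rule is_partition_nth_le[OF assms(1,3) ij(1)])
  then show ?thesis using ij assms(3,4) by (simp add: young_def)
qed

text \<open>A right or lower neighbour of a box outside \<open>mu\<close> is again outside
  \<open>mu\<close>, so maximality within the skew shape is maximality within
  \<open>lam\<close>.\<close>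

lemma maximal_boxes_skew:
  assumes lam: "is_partition lam" and mu: "is_partition mu" and sub: "contained mu lam"
  shows "maximal_boxes (young lam - young mu) =
    (\<lambda>i. (i, lam ! i - 1)) ` {i\<in>corners lam. contained mu (rem_box lam i)}"
proof -
  have 1: "contained mu (rem_box lam i) \<longleftrightarrow> (i, lam ! i - 1) \<notin> young mu" if "i \<in> corners lam" for i
    using sub young_rem_box[OF lam that] by (auto simp: contained_def)
  have 2: "(i, j) \<in> maximal_boxes (young lam - young mu) \<longleftrightarrow>
     i \<in> corners lam \<and> j = lam ! i - 1 \<and> (i, j) \<notin> young mu" for i j
  proof
    assume a: "(i, j) \<in> maximal_boxes (young lam - young mu)"
    then have inl: "(i, j) \<in> young lam" and nm: "(i, j) \<notin> young mu" by (auto simp: maximal_boxes_def)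
    have "(i, Suc j) \<notin> young mu" "(Suc i, j) \<notin> young mu"
      using nm young_down_closed[OF mu, of i "Suc j" i j] young_down_closed[OF mu, of "Suc i" j i j] by auto
    then have "(i, Suc j) \<notin> young lam" "(Suc i, j) \<notin> young lam"
      using a by (auto simp: maximal_boxes_def)
    then show "i \<in> corners lam \<and> j = lam ! i - 1 \<and> (i, j) \<notin> young mu"
      using inl nm by (auto simp: young_def corners_def)
  next
    assume a: "i \<in> corners lam \<and> j = lam ! i - 1 \<and> (i, j) \<notin> young mu"
    then have "0 < lam ! i" using is_partition_nth_pos[OF lam] by (simp add: corners_def)
    then show "(i, j) \<in> maximal_boxes (young lam - young mu)"
      using a by (auto simp: maximal_boxes_def young_def corners_def)
  qed
  show ?thesis using 1 2 by (auto simp: image_iff)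
qed

lemma f_skew_recursion:
  assumes lam: "is_partition lam" and mu: "is_partition mu" and sub: "contained mu lam"
    and lt: "sum_list mu < sum_list lam"
  shows "f_skew lam mu = (\<Sum>i\<in>{i\<in>corners lam. contained mu (rem_box lam i)}. f_skew (rem_box lam i) mu)"
proof -
  let ?D = "young lam - young mu"
  have "young mu \<noteq> young lam" using lt card_young by (metis less_irrefl)
  then have ne: "?D \<noteq> {}" using sub by (auto simp: contained_def)
  have "f_skew lam mu = (\<Sum>c\<in>maximal_boxes ?D. card (syt (?D - {c})))"
    unfolding f_skew_eq_syt by (rule card_syt_recursion) (use ne in auto)
  also have "\<dots> = (\<Sum>i\<in>{i\<in>corners lam. contained mu (rem_box lam i)}. card (syt (?D - {(i, lam ! i - 1)})))"
    unfolding maximal_boxes_skew[OF lam mu sub] by (subst sum.reindex) (auto simp: inj_on_def)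
  also have "\<dots> = (\<Sum>i\<in>{i\<in>corners lam. contained mu (rem_box lam i)}. f_skew (rem_box lam i) mu)"
  proof (rule sum.cong[OF refl])
    fix i assume "i \<in> {i\<in>corners lam. contained mu (rem_box lam i)}"
    then have "?D - {(i, lam ! i - 1)} = young (rem_box lam i) - young mu"
      using young_rem_box[OF lam] by auto
    then show "card (syt (?D - {(i, lam ! i - 1)})) = f_skew (rem_box lam i) mu"
      by (simp add: f_skew_eq_syt)
  qed
  finally show ?thesis .
qed

section \<open>Restriction of characters to a smaller symmetric group\<close>

lemma irr_char_orthonormal:
  assumes lam: "is_partition lam" "sum_list lam = n" and mu: "is_partition mu" "sum_list mu = n"
  shows "(\<Sum>\<sigma> | \<sigma> permutes {1..n}. irr_char lam \<sigma> * irr_char mu \<sigma>) = (if lam = mu then fact n else 0)"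
proof -
  have t: "(\<Sum>i<length nu. int (nu ! i)) = int (card {1..n})" if "sum_list nu = n" for nu :: "nat list"
    using that by (simp add: sum_parts)
  show ?thesis
  proof (cases "lam = mu")
    case True
    then show ?thesis using chi_norm[OF _ parts_of_partition[OF mu(1)] t[OF mu(2)]] lam mu
      by (simp add: irr_char_eq_chi)
  next
    case False
    have "(\<Sum>\<sigma> | \<sigma> permutes {1..n}. irr_char lam \<sigma> * irr_char mu \<sigma>) = 0"
    proof (rule ccontr)
      assume "\<not> ?thesis"
      then have "length lam = length mu \<and> (\<forall>i<length lam. int (lam ! i) = int (mu ! i))"
        unfolding irr_char_eq_chi lam mu
        by (intro chi_orthogonal[OF _ parts_of_partition[OF lam(1)] parts_of_partition[OF mu(1)] t t])
           (use lam mu in auto)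
      then show False using False by (simp add: list_eq_iff_nth_eq)
    qed
    then show ?thesis using False by simp
  qed
qed

text \<open>Both sides obey the same recursion in \<open>lam\<close>, removal of a corner: the
  characters by branching, the skew tableaux by the position of the largest entry. The recursion
  ends at equal sizes, where orthonormality decides. Corners lying in \<open>mu\<close> contribute
  zero on both sides.\<close>

theorem restriction_multiplicity:
  assumes lam: "is_partition lam" and mu: "is_partition mu" and le: "sum_list mu \<le> sum_list lam"
  shows "(\<Sum>\<sigma> | \<sigma> permutes {1..sum_list mu}. irr_char lam \<sigma> * irr_char mu \<sigma>) =
    (if contained mu lam then fact (sum_list mu) * int (f_skew lam mu) else 0)"
  using lam le
proof (induction "sum_list lam - sum_list mu" arbitrary: lam)
  case 0
  then have s: "sum_list lam = sum_list mu" by simp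
  note orth = irr_char_orthonormal[OF "0.prems"(1) s mu refl]
  show ?case
  proof (cases "lam = mu")
    case True
    have "f_skew mu mu = 1" by (simp add: f_skew_eq_syt syt_empty)
    then show ?thesis unfolding orth by (simp add: True contained_def)
  next
    case False
    have "\<not> contained mu lam"
    proof
      assume "contained mu lam"
      then have "young mu = young lam"
        unfolding contained_def using s by (intro card_subset_eq) (auto simp: card_young)
      then show False using False young_inj 0 mu by metis
    qed
    then show ?thesis unfolding orth using False by simp
  qed
next
  case (Suc d)
  let ?X = "{1..sum_list mu}"
  let ?C = "corners lam"
  obtain n where n: "sum_list lam = Suc n" using Suc by (cases "sum_list lam") auto
  have fC: "finite ?C" by (simp add: corners_def)
  have lt: "sum_list mu < sum_list lam" using Suc by simp
  have br: "irr_char lam \<sigma> = (\<Sum>i\<in>?C. irr_char (rem_box lam i) \<sigma>)" if "\<sigma> permutes ?X" for \<sigma>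
    by (rule irr_char_branching[OF Suc.prems(1) n permutes_subset[OF that]]) (use lt n in auto)
  have "(\<Sum>\<sigma> | \<sigma> permutes ?X. irr_char lam \<sigma> * irr_char mu \<sigma>) =
      (\<Sum>\<sigma> | \<sigma> permutes ?X. \<Sum>i\<in>?C. irr_char (rem_box lam i) \<sigma> * irr_char mu \<sigma>)"
    by (rule sum.cong) (simp_all add: br sum_distrib_right)
  also have "\<dots> = (\<Sum>i\<in>?C. \<Sum>\<sigma> | \<sigma> permutes ?X. irr_char (rem_box lam i) \<sigma> * irr_char mu \<sigma>)"
    by (rule sum.swap)
  also have "\<dots> = (\<Sum>i\<in>?C. if contained mu (rem_box lam i)
      then fact (sum_list mu) * int (f_skew (rem_box lam i) mu) else 0)"
  proof (rule sum.cong[OF refl])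
    fix i assume i: "i \<in> ?C"
    show "(\<Sum>\<sigma> | \<sigma> permutes ?X. irr_char (rem_box lam i) \<sigma> * irr_char mu \<sigma>) =
      (if contained mu (rem_box lam i) then fact (sum_list mu) * int (f_skew (rem_box lam i) mu) else 0)"
      by (rule Suc.hyps(1))
        (use Suc.hyps(2) Suc.prems sum_list_rem_box[OF Suc.prems(1) i] rem_box_partition[OF Suc.prems(1) i] n lt
         in auto)
  qed
  also have "\<dots> = (\<Sum>i\<in>{i\<in>?C. contained mu (rem_box lam i)}. fact (sum_list mu) * int (f_skew (rem_box lam i) mu))"
    using fC by (simp add: sum.If_cases Int_def)
  also have "\<dots> = (if contained mu lam then fact (sum_list mu) * int (f_skew lam mu) else 0)"
  proof (cases "contained mu lam")
    case True
    then show ?thesis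
      by (simp add: f_skew_recursion[OF Suc.prems(1) mu True lt] sum_distrib_left)
  next
    case False
    have "\<not> contained mu (rem_box lam i)" if "i \<in> ?C" for i
      using False young_rem_box[OF Suc.prems(1) that] by (auto simp: contained_def)
    then have "{i\<in>?C. contained mu (rem_box lam i)} = {}" by blast
    then show ?thesis using False by (simp only: sum.empty if_False)
  qed
  finally show ?case .
qed

text \<open>This is the restriction theorem for empty \<open>mu\<close>, where the group is trivial
  and the skew shape is all of \<open>lam\<close>.\<close>

corollary irr_char_id:
  assumes "is_partition lam"
  shows "irr_char lam id = int (f_shape lam)"
proof -
  have e: "{w. w permutes ({}::nat set)} = {id}" by (simp only: permutes_empty singleton_conv)
  have x: "{1..sum_list ([]::nat list)} = {}" by simp
  have "{B \<in> type_colorings ({}::nat set) {..<0::nat} c. \<forall>x\<in>{}. B (id x) = B x} = {\<lambda>_. undefined}" for c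
    unfolding type_colorings_def by simp
  then have psi: "psi ({}::nat set) 0 c id = 1" for c unfolding psi_def by simp
  have "irr_char [] id = 1"
    unfolding irr_char_eq_chi chi_def alternant_def x list.size lessThan_0 e psi by simp
  moreover have "{\<sigma>. \<sigma> permutes {1..sum_list ([]::nat list)}} = {id}"
    unfolding x by (rule e)
  moreover have "is_partition []" by (simp add: is_partition_def)
  moreover have "contained [] lam" by (simp add: contained_def young_def)
  ultimately show ?thesis
    using restriction_multiplicity[OF assms, of "[]"] unfolding f_shape_def by simp
qed

section \<open>Completeness of the permutation characters\<close>

lemma funpow_eq_iff_mod:
  assumes p: "permutation p" and le: "a \<le> b"
  shows "(p ^^ a) r = (p ^^ b) r \<longleftrightarrow> least_power p r dvd (b - a)"
proof -
  have "bij (p ^^ a)" using permutation_bijective[OF p] by (rule bij_betw_funpow)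
  moreover have "(p ^^ b) r = (p ^^ a) ((p ^^ (b - a)) r)"
    using le funpow_add[of a "b - a" p] by simp
  ultimately have "(p ^^ a) r = (p ^^ b) r \<longleftrightarrow> r = (p ^^ (b - a)) r"
    by (metis bij_is_inj injD)
  also have "\<dots> \<longleftrightarrow> least_power p r dvd (b - a)"
    using least_power_dvd[OF p, of r "b - a"] by auto
  finally show ?thesis .
qed

lemma least_power_eq_card_orbit:
  assumes p: "permutation p"
  shows "least_power p r = card (orbit p r)"
proof -
  let ?n = "least_power p r"
  have n: "(p ^^ ?n) r = r" "0 < ?n"
    using least_power_of_permutation[OF p, of r] by simp_all
  have "orbit p r = (\<lambda>m. (p ^^ m) r) ` {..<?n}"
    unfolding orbit_altdef_bounded[OF n] by auto
  moreover have "inj_on (\<lambda>m. (p ^^ m) r) {..<?n}"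
  proof (rule linorder_inj_onI)
    fix a b assume ab: "a < b" "a \<in> {..<?n}" "b \<in> {..<?n}"
    then have "\<not> ?n dvd (b - a)" by (auto dest: dvd_imp_le)
    then show "(p ^^ a) r \<noteq> (p ^^ b) r" using funpow_eq_iff_mod[OF p, of a b r] ab by simp
  qed auto
  ultimately show ?thesis by (simp add: card_image)
qed

text \<open>With a representative r of each common orbit, \<open>g\<close> sends (s ^^ j) r to (t ^^
  j) r; this is well defined since the period of r under \<open>s\<close> and under \<open>t\<close>
  is the size of the orbit.\<close>

lemma same_orbits_conjugate:
  assumes X: "finite X" and s: "s permutes X" and t: "t permutes X"
    and orb: "\<And>x. x \<in> X \<Longrightarrow> orbit s x = orbit t x"
  shows "\<exists>g. g permutes X \<and> t = g \<circ> s \<circ> inv g"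
proof -
  have ps: "permutation s" and pt: "permutation t"
    using permutes_imp_permutation[OF X] s t by simp_all
  have iff_le: "(s ^^ a) r = (s ^^ b) r \<longleftrightarrow> (t ^^ a) r = (t ^^ b) r" if "r \<in> X" "a \<le> b" for r a b
    unfolding funpow_eq_iff_mod[OF ps that(2)] funpow_eq_iff_mod[OF pt that(2)]
      least_power_eq_card_orbit[OF ps] least_power_eq_card_orbit[OF pt] orb[OF that(1)] ..
  have iff: "(s ^^ a) r = (s ^^ b) r \<longleftrightarrow> (t ^^ a) r = (t ^^ b) r" if "r \<in> X" for r a b
    using iff_le[OF that, of a b] iff_le[OF that, of b a] by (cases "a \<le> b") auto
  \<comment> \<open>The choice depends on the orbit as a set only, so all points of an orbit share
    one representative.\<close>
  define r where "r x = (SOME y. y \<in> orbit s x)" for x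
  have r_in: "r x \<in> orbit s x" for x
    unfolding r_def by (rule someI[of "\<lambda>y. y \<in> orbit s x"]) (rule orbit.base)
  have r_eq: "r x = r y" if "orbit s x = orbit s y" for x y using that by (simp add: r_def)
  have r_orb: "orbit s (r x) = orbit s x" for x using orbit_eq_iff[OF ps] r_in by blast
  have rX: "r x \<in> X" if "x \<in> X" for x using permutes_orbit_subset[OF s that] r_in by blast
  have ex: "\<exists>j. (s ^^ j) (r x) = x" for x
  proof -
    have "x \<in> orbit s (r x)" using permutation_self_in_orbit[OF ps] r_orb by simp
    then obtain n where "x = (s ^^ n) (r x)" unfolding orbit_altdef_permutation[OF ps] by blast
    then show ?thesis by (intro exI[of _ n]) simp
  qed
  define j where "j x = (SOME j. (s ^^ j) (r x) = x)" for x
  have j: "(s ^^ j x) (r x) = x" for x unfolding j_def using ex by (rule someI_ex)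
  define g where "g x = (if x \<in> X then (t ^^ j x) (r x) else x)" for x
  have g_val: "g x = (t ^^ a) (r x)" if "x \<in> X" "(s ^^ a) (r x) = x" for x a
    using iff[OF rX[OF that(1)], of "j x" a] j[of x] that by (simp add: g_def)
  have g_orb: "g x \<in> orbit s x" if "x \<in> X" for x
  proof -
    have "g x \<in> orbit t (r x)"
      using that unfolding orbit_altdef_permutation[OF pt] by (auto simp: g_def)
    then show ?thesis using orb[OF rX[OF that]] r_orb by simp
  qed
  have gX: "g x \<in> X" if "x \<in> X" for x using g_orb[OF that] permutes_orbit_subset[OF s that] by blast
  have "inj_on g X"
  proof (rule inj_onI)
    fix x y assume xy: "x \<in> X" "y \<in> X" "g x = g y"
    have "orbit s (g x) = orbit s x" "orbit s (g y) = orbit s y"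
      using g_orb[OF xy(1)] g_orb[OF xy(2)] orbit_eq_iff[OF ps] by blast+
    then have "orbit s x = orbit s y" using xy(3) by simp
    then have ry: "r x = r y" by (rule r_eq)
    then have "(t ^^ j x) (r x) = (t ^^ j y) (r x)" using xy by (simp add: g_def)
    then have "(s ^^ j x) (r x) = (s ^^ j y) (r x)" by (rule iff[OF rX[OF xy(1)], THEN iffD2])
    then show "x = y" using j[of x] j[of y] ry by metis
  qed
  then have "bij_betw g X X"
    unfolding bij_betw_def using endo_inj_surj[OF X] gX by (metis image_subsetI)
  then have gp: "g permutes X" by (intro bij_imp_permutes) (auto simp: g_def)
  have comm: "g (s x) = t (g x)" for x
  proof (cases "x \<in> X")
    case True
    have sx: "s x \<in> X" using permutes_in_image[OF s] True by simp
    have "r (s x) = r x" by (rule r_eq) (rule permutation_orbit_step[OF ps])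
    then have "g (s x) = (t ^^ Suc (j x)) (r x)"
      using g_val[OF sx, of "Suc (j x)"] j[of x] by simp
    then show ?thesis using True by (simp add: g_def)
  next
    case False
    then show ?thesis using s t by (simp add: g_def permutes_not_in)
  qed
  have "t = g \<circ> s \<circ> inv g"
    using comm permutes_inverses(1)[OF gp] by (simp add: fun_eq_iff)
  then show ?thesis using gp by blast
qed

definition class_function :: "'a set \<Rightarrow> (('a \<Rightarrow> 'a) \<Rightarrow> int) \<Rightarrow> bool" where
  "class_function X \<phi> \<longleftrightarrow> (\<forall>s g. s permutes X \<longrightarrow> g permutes X \<longrightarrow> \<phi> (g \<circ> s \<circ> inv g) = \<phi> s)"

lemma stab_conjugate_bij:
  assumes g: "g permutes X" and B: "\<And>x. x \<in> X \<Longrightarrow> B x = C (g x)"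
  shows "bij_betw (\<lambda>\<sigma>. g \<circ> \<sigma> \<circ> inv g) (stab X B) (stab X C)"
proof (rule bij_betw_byWitness[where f' = "\<lambda>\<sigma>. inv g \<circ> \<sigma> \<circ> g"])
  have g': "inv g permutes X" using g by (rule permutes_inv)
  have gg: "g (inv g x) = x" "inv g (g x) = x" for x using permutes_inverses[OF g] by auto
  have gX: "g x \<in> X \<longleftrightarrow> x \<in> X" "inv g x \<in> X \<longleftrightarrow> x \<in> X" for x
    using permutes_in_image[OF g] permutes_in_image[OF g'] by auto
  show "\<forall>\<sigma>\<in>stab X B. inv g \<circ> (g \<circ> \<sigma> \<circ> inv g) \<circ> g = \<sigma>" by (simp add: fun_eq_iff gg)
  show "\<forall>\<sigma>\<in>stab X C. g \<circ> (inv g \<circ> \<sigma> \<circ> g) \<circ> inv g = \<sigma>" by (simp add: fun_eq_iff gg)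
  show "(\<lambda>\<sigma>. g \<circ> \<sigma> \<circ> inv g) ` stab X B \<subseteq> stab X C"
  proof (intro image_subsetI)
    fix \<sigma> assume s: "\<sigma> \<in> stab X B"
    then have sp: "\<sigma> permutes X" by (simp add: stab_def)
    have "C (g (\<sigma> (inv g x))) = C x" if "x \<in> X" for x
    proof -
      have "C (g (\<sigma> (inv g x))) = B (\<sigma> (inv g x))" using B that gX permutes_in_image[OF sp] by simp
      also have "\<dots> = B (inv g x)" using s that gX by (simp add: stab_def)
      also have "\<dots> = C x" using B that gX gg by simp
      finally show ?thesis .
    qed
    then show "g \<circ> \<sigma> \<circ> inv g \<in> stab X C" using sp g g' by (simp add: stab_def permutes_compose)
  qed
  show "(\<lambda>\<sigma>. inv g \<circ> \<sigma> \<circ> g) ` stab X C \<subseteq> stab X B"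
  proof (intro image_subsetI)
    fix \<sigma> assume s: "\<sigma> \<in> stab X C"
    then have sp: "\<sigma> permutes X" by (simp add: stab_def)
    have "B (inv g (\<sigma> (g x))) = B x" if "x \<in> X" for x
      using s that gX permutes_in_image[OF sp] gg by (simp add: stab_def B)
    then show "inv g \<circ> \<sigma> \<circ> g \<in> stab X B" using sp g g' by (simp add: stab_def permutes_compose)
  qed
qed

lemma sum_class_function_stab:
  assumes \<phi>: "class_function X \<phi>" and g: "g permutes X"
    and B: "\<And>x. x \<in> X \<Longrightarrow> B x = C (g x)"
  shows "(\<Sum>\<sigma>\<in>stab X B. \<phi> \<sigma>) = (\<Sum>\<sigma>\<in>stab X C. \<phi> \<sigma>)"
proof -
  have "(\<Sum>\<sigma>\<in>stab X C. \<phi> \<sigma>) = (\<Sum>\<sigma>\<in>stab X B. \<phi> (g \<circ> \<sigma> \<circ> inv g))"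
    by (rule sum.reindex_bij_betw[symmetric], rule stab_conjugate_bij[OF g], rule B)
  also have "\<dots> = (\<Sum>\<sigma>\<in>stab X B. \<phi> \<sigma>)"
    using \<phi> g by (intro sum.cong refl) (simp add: class_function_def stab_def)
  finally show ?thesis ..
qed

lemma sum_mult_psi:
  assumes X: "finite X"
  shows "(\<Sum>\<sigma> | \<sigma> permutes X. \<phi> \<sigma> * psi X l b \<sigma>) =
    (\<Sum>B\<in>type_colorings X {..<l} b. \<Sum>\<sigma>\<in>stab X B. \<phi> \<sigma>)"
proof -
  let ?P = "{\<sigma>. \<sigma> permutes X}" and ?T = "type_colorings X {..<l} b"
  have fP: "finite ?P" using X by (rule finite_permutations)
  have fT: "finite ?T" using X by (intro finite_type_colorings) auto
  have "(\<Sum>\<sigma>\<in>?P. \<phi> \<sigma> * psi X l b \<sigma>) = (\<Sum>\<sigma>\<in>?P. \<Sum>B\<in>?T. if \<sigma> \<in> stab X B then \<phi> \<sigma> else 0)"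
  proof (rule sum.cong[OF refl])
    fix \<sigma> assume s: "\<sigma> \<in> ?P"
    have "(\<Sum>B\<in>?T. if \<sigma> \<in> stab X B then \<phi> \<sigma> else 0) = (\<Sum>B\<in>{B\<in>?T. \<sigma> \<in> stab X B}. \<phi> \<sigma>)"
      by (rule sum.inter_filter[symmetric, OF fT])
    also have "{B\<in>?T. \<sigma> \<in> stab X B} = {B \<in> ?T. \<forall>x\<in>X. B (\<sigma> x) = B x}"
      using s by (auto simp: stab_def)
    finally show "\<phi> \<sigma> * psi X l b \<sigma> = (\<Sum>B\<in>?T. if \<sigma> \<in> stab X B then \<phi> \<sigma> else 0)"
      by (simp add: psi_def)
  qed
  also have "\<dots> = (\<Sum>B\<in>?T. \<Sum>\<sigma>\<in>?P. if \<sigma> \<in> stab X B then \<phi> \<sigma> else 0)" by (rule sum.swap)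
  also have "\<dots> = (\<Sum>B\<in>?T. \<Sum>\<sigma>\<in>stab X B. \<phi> \<sigma>)"
  proof (rule sum.cong[OF refl])
    fix B
    have "{\<sigma>\<in>?P. \<sigma> \<in> stab X B} = stab X B" by (auto simp: stab_def)
    then show "(\<Sum>\<sigma>\<in>?P. if \<sigma> \<in> stab X B then \<phi> \<sigma> else 0) = (\<Sum>\<sigma>\<in>stab X B. \<phi> \<sigma>)"
      using sum.inter_filter[OF fP, of \<phi> "\<lambda>\<sigma>. \<sigma> \<in> stab X B"] by simp
  qed
  finally show ?thesis .
qed

text \<open>By hypothesis each cycle of \<open>s\<close> lies in a cycle of \<open>t\<close>.
  Sending the one to the other is onto, so equal counts force a bijection and hence equal
  cycles.\<close>

lemma orbit_refinement:
  assumes X: "finite X" and s: "s permutes X" and t: "t permutes X"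
    and ref: "\<And>x. x \<in> X \<Longrightarrow> orbit t (s x) = orbit t x"
  shows "cyc X t < cyc X s \<or> (\<forall>x\<in>X. orbit s x = orbit t x)"
proof -
  have ps: "permutation s" and pt: "permutation t"
    using permutes_imp_permutation[OF X] s t by simp_all
  have const: "orbit t y = orbit t x" if xy: "x \<in> X" "y \<in> orbit s x" for x y
    by (rule orbit_invariant[OF s xy(1) _ xy(2)]) (rule ref)
  define h where "h O' = orbit t (SOME x. x \<in> O')" for O'
  have h: "h (orbit s x) = orbit t x" if "x \<in> X" for x
  proof -
    have "(SOME y. y \<in> orbit s x) \<in> orbit s x"
      by (rule someI[of "\<lambda>y. y \<in> orbit s x"]) (rule orbit.base)
    then show ?thesis unfolding h_def using const[OF that] by blast
  qed
  have img: "h ` (orbit s ` X) = orbit t ` X" using h by (auto simp: image_iff)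
  have fin: "finite (orbit s ` X)" using X by simp
  show ?thesis
  proof (cases "inj_on h (orbit s ` X)")
    case True
    have "orbit s x = orbit t x" if x: "x \<in> X" for x
    proof (intro equalityI subsetI)
      fix y assume "y \<in> orbit s x"
      then show "y \<in> orbit t x" using const[OF x] permutation_self_in_orbit[OF pt, of y] by blast
    next
      fix y assume y: "y \<in> orbit t x"
      then have yX: "y \<in> X" using permutes_orbit_subset[OF t x] by blast
      have "h (orbit s y) = h (orbit s x)" using h x yX y orbit_eq_iff[OF pt] by metis
      then have "orbit s y = orbit s x" using True x yX by (auto dest: inj_onD)
      then show "y \<in> orbit s x" using permutation_self_in_orbit[OF ps, of y] by blast
    qed
    then show ?thesis by blast
  next
    case False
    then have "card (h ` (orbit s ` X)) \<noteq> card (orbit s ` X)" using fin eq_card_imp_inj_on by blast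
    then have "card (h ` (orbit s ` X)) < card (orbit s ` X)"
      using card_image_le[OF fin, of h] by simp
    then show ?thesis by (simp add: cyc_def img)
  qed
qed

text \<open>Induction from many cycles to few. The Young subgroup of the cycle partition of
  \<open>t\<close> consists of permutations with the orbits of \<open>t\<close>, which are conjugate
  to \<open>t\<close>, and of permutations with more cycles, on which \<open>\<phi>\<close> vanishes
  already. Orthogonality makes the total over the subgroup zero, and this total is a positive
  multiple of \<open>\<phi> t\<close>.\<close>

theorem class_function_zero:
  assumes X: "finite X" and \<phi>: "class_function X \<phi>"
    and orth: "\<And>l b. (\<Sum>\<sigma> | \<sigma> permutes X. \<phi> \<sigma> * psi X l b \<sigma>) = 0"
    and t: "t permutes X"
  shows "\<phi> t = 0"
  using t
proof (induction "card X - cyc X t" arbitrary: t rule: less_induct)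
  case less
  note t = less.prems
  have pt: "permutation t" by (rule permutes_imp_permutation[OF X t])
  have fin: "finite (orbit t ` X)" using X by simp
  obtain e where e: "bij_betw e (orbit t ` X) {..<card (orbit t ` X)}"
    using finite_same_card_bij[OF fin, of "{..<card (orbit t ` X)}"] by auto
  define l where "l = card (orbit t ` X)"
  define C where "C = restrict (\<lambda>x. e (orbit t x)) X"
  define b where "b i = int (card {x\<in>X. C x = i})" for i
  have eO: "e (orbit t x) < l" if "x \<in> X" for x
    using bij_betwE[OF e] that by (auto simp: l_def)
  have C_eq: "C x = C y \<longleftrightarrow> orbit t x = orbit t y" if "x \<in> X" "y \<in> X" for x y
    using that bij_betw_imp_inj_on[OF e] by (auto simp: C_def inj_on_eq_iff)
  have CT: "C \<in> type_colorings X {..<l} b"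
    using eO by (auto simp: type_colorings_def b_def C_def)
  have conj: "(\<Sum>\<sigma>\<in>stab X B. \<phi> \<sigma>) = (\<Sum>\<sigma>\<in>stab X C. \<phi> \<sigma>)"
    if B: "B \<in> type_colorings X {..<l} b" for B
  proof -
    obtain g where g: "g permutes X" "\<forall>x\<in>X. B x = C (g x)"
      using same_type_conjugate[OF X _ B CT] by auto
    show ?thesis by (rule sum_class_function_stab[OF \<phi> g(1)]) (use g in auto)
  qed
  have "0 = (\<Sum>B\<in>type_colorings X {..<l} b. \<Sum>\<sigma>\<in>stab X B. \<phi> \<sigma>)"
    using orth[of l b] unfolding sum_mult_psi[OF X] by simp
  also have "\<dots> = int (card (type_colorings X {..<l} b)) * (\<Sum>\<sigma>\<in>stab X C. \<phi> \<sigma>)"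
    using conj by simp
  finally have zero: "(\<Sum>\<sigma>\<in>stab X C. \<phi> \<sigma>) = 0"
    using CT finite_type_colorings[OF X, of "{..<l}" b] by auto
  let ?E = "{\<sigma>\<in>stab X C. \<forall>x\<in>X. orbit \<sigma> x = orbit t x}"
  have "\<phi> \<sigma> = (if \<sigma> \<in> ?E then \<phi> t else 0)" if \<sigma>: "\<sigma> \<in> stab X C" for \<sigma>
  proof (cases "\<sigma> \<in> ?E")
    case True
    have sp: "\<sigma> permutes X" using \<sigma> by (simp add: stab_def)
    obtain g where "g permutes X" "t = g \<circ> \<sigma> \<circ> inv g"
      using same_orbits_conjugate[OF X sp t] True by auto
    then have "\<phi> t = \<phi> \<sigma>" using \<phi> sp by (simp add: class_function_def)
    then show ?thesis using True by simp
  next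
    case False
    have sp: "\<sigma> permutes X" using \<sigma> by (simp add: stab_def)
    have "orbit t (\<sigma> x) = orbit t x" if "x \<in> X" for x
      using \<sigma> that C_eq[of "\<sigma> x" x] permutes_in_image[OF sp] by (simp add: stab_def)
    then have "cyc X t < cyc X \<sigma>" using orbit_refinement[OF X sp t] False \<sigma> by blast
    moreover have "cyc X \<sigma> \<le> card X" by (rule cyc_le_card[OF X])
    ultimately have "\<phi> \<sigma> = 0" using sp by (intro less.hyps) auto
    then show ?thesis by (simp only: False if_False)
  qed
  then have "(\<Sum>\<sigma>\<in>stab X C. \<phi> \<sigma>) = (\<Sum>\<sigma>\<in>stab X C. if \<sigma> \<in> ?E then \<phi> t else 0)"
    by (intro sum.cong) auto
  also have "\<dots> = (\<Sum>\<sigma>\<in>{\<sigma>\<in>stab X C. \<sigma> \<in> ?E}. \<phi> t)"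
    by (rule sum.inter_filter[symmetric, OF finite_stab[OF X]])
  also have "\<dots> = int (card ?E) * \<phi> t" by simp
  finally have "int (card ?E) * \<phi> t = 0" using zero by simp
  moreover have "t \<in> ?E"
    using t C_eq permutes_in_image[OF t] permutation_orbit_step[OF pt] by (simp add: stab_def)
  then have "card ?E \<noteq> 0" using finite_stab[OF X, of C] by auto
  ultimately show ?case by simp
qed

subsection \<open>From permutation characters to irreducible characters\<close>

lemma chi_drop_zeros:
  assumes X: "finite X" and s: "s permutes X" and "decreasing l a" "\<And>i. i < l \<Longrightarrow> 0 \<le> a i"
  shows "\<exists>l'. parts l' a \<and> (\<Sum>i<l'. a i) = (\<Sum>i<l. a i) \<and> chi X l' a s = chi X l a s"
  using assms(3,4)
proof (induction l)
  case 0
  then show ?case by (intro exI[of _ 0]) (simp add: parts_def)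
next
  case (Suc l)
  show ?case
  proof (cases "a l = 0")
    case True
    have "decreasing l a" using Suc.prems(1) by (auto simp: decreasing_def)
    then obtain l' where "parts l' a" "(\<Sum>i<l'. a i) = (\<Sum>i<l. a i)" "chi X l' a s = chi X l a s"
      using Suc.IH Suc.prems(2) by fastforce
    then show ?thesis using True chi_trailing_zero[where a = a, OF X s True] by (intro exI[of _ l']) simp
  next
    case False
    have "0 < a i" if "i < Suc l" for i
      using decreasing_le[OF Suc.prems(1), of i l] Suc.prems(2)[of l] False that by simp
    then show ?thesis using Suc.prems by (intro exI[of _ "Suc l"]) (simp add: parts_def)
  qed
qed

lemma exists_sorting:
  fixes b :: "nat \<Rightarrow> int"
  shows "\<exists>w. w permutes {..<l} \<and> decreasing l (b \<circ> w)"
proof -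
  let ?xs = "map b [0..<l]"
  obtain p where p: "p permutes {..<length ?xs}" "permute_list p ?xs = rev (sort ?xs)"
    by (rule mset_eq_permutation[of "rev (sort ?xs)" ?xs]) auto
  have "(b \<circ> p) i = rev (sort ?xs) ! i" if "i < l" for i
    using permute_list_nth[OF p(1), of i] that p permutes_in_image[OF p(1), of i] by simp
  moreover have "rev (sort ?xs) ! Suc i \<le> rev (sort ?xs) ! i" if "Suc i < l" for i
    using that sorted_rev_nth_mono[of "rev (sort ?xs)" i "Suc i"] by simp
  ultimately have "decreasing l (b \<circ> p)" by (simp add: decreasing_def)
  then show ?thesis using p by auto
qed

text \<open>Summation by parts: the nonnegative prefix sums of \<open>d\<close> get as weights the
  nonnegative decrements of \<open>b\<close> and its last entry.\<close>

lemma abel_nonneg: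
  fixes b d :: "nat \<Rightarrow> int"
  assumes "decreasing l b" "\<And>i. i < l \<Longrightarrow> 0 \<le> b i" "\<And>j. 0 \<le> (\<Sum>i<j. d i)"
  shows "0 \<le> (\<Sum>i<l. b i * d i)"
proof (cases l)
  case 0 then show ?thesis by simp
next
  case (Suc l')
  have "b j * (\<Sum>i<Suc j. d i) \<le> (\<Sum>i<Suc j. b i * d i)" if "j < l" for j
    using that
  proof (induction j)
    case 0 then show ?case by simp
  next
    case (Suc j)
    have "b (Suc j) * (\<Sum>i<Suc j. d i) \<le> b j * (\<Sum>i<Suc j. d i)"
      using assms(1) assms(3)[of "Suc j"] Suc.prems
      by (intro mult_right_mono) (auto simp: decreasing_def simp del: sum.lessThan_Suc)
    then show ?case using Suc by (simp add: distrib_left)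
  qed
  from this[of l'] show ?thesis using assms(2)[of l'] assms(3)[of "Suc l'"] Suc
    by (smt (verit) lessI mult_nonneg_nonneg)
qed

lemma psi_wrong_total:
  assumes X: "finite X" and "(\<Sum>i<l. b i) \<noteq> int (card X)"
  shows "psi X l b s = 0"
proof -
  have "B \<notin> type_colorings X {..<l} b" for B
  proof
    assume B: "B \<in> type_colorings X {..<l} b"
    have "X = (\<Union>i\<in>{..<l}. {x\<in>X. B x = i})" using B by (auto simp: type_colorings_def)
    then have "card X = card (\<Union>i\<in>{..<l}. {x\<in>X. B x = i})" by simp
    also have "\<dots> = (\<Sum>i<l. card {x\<in>X. B x = i})"
      using X by (intro card_UN_disjoint) auto
    finally have "int (card X) = (\<Sum>i<l. int (card {x\<in>X. B x = i}))" by simp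
    also have "\<dots> = (\<Sum>i<l. b i)" using B by (intro sum.cong) (auto simp: type_colorings_def)
    finally show False using assms(2) by simp
  qed
  then have "type_colorings X {..<l} b = {}" by blast
  then show ?thesis by (simp add: psi_def)
qed

lemma sum_squares_le:
  fixes c :: "nat \<Rightarrow> int"
  assumes "\<And>i. i < l \<Longrightarrow> 0 \<le> c i"
  shows "(\<Sum>i<l. (c i)\<^sup>2) \<le> (\<Sum>i<l. c i)\<^sup>2"
proof -
  have "(c i)\<^sup>2 \<le> c i * (\<Sum>i<l. c i)" if "i < l" for i
    unfolding power2_eq_square using assms that by (intro mult_left_mono member_le_sum) auto
  then have "(\<Sum>i<l. (c i)\<^sup>2) \<le> (\<Sum>i<l. c i * (\<Sum>i<l. c i))" by (intro sum_mono) auto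
  then show ?thesis by (simp add: power2_eq_square sum_distrib_right)
qed

text \<open>The determinant of the sorted vector a expresses psi^a through chi^a and index vectors a
  + d with d = w - id. Those with nonnegative entries have a strictly larger sum of squares, since
  the cross term is nonnegative by summation by parts. The sum of squares is bounded by the square
  of \<open>card X\<close> and so serves as induction measure.\<close>

theorem orthogonal_psi_of_chi:
  assumes X: "finite X"
    and orth: "\<And>l a. parts l a \<Longrightarrow> (\<Sum>i<l. a i) = int (card X) \<Longrightarrow>
      (\<Sum>\<sigma> | \<sigma> permutes X. chi X l a \<sigma> * \<phi> \<sigma>) = 0"
  shows "(\<Sum>\<sigma> | \<sigma> permutes X. psi X l b \<sigma> * \<phi> \<sigma>) = 0"
proof (induction "nat ((int (card X))\<^sup>2 - (\<Sum>i<l. (b i)\<^sup>2))" arbitrary: b rule: less_induct)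
  case less
  let ?n = "int (card X)"
  let ?ip = "\<lambda>c. \<Sum>\<sigma> | \<sigma> permutes X. psi X l c \<sigma> * \<phi> \<sigma>"
  show ?case
  proof (cases "(\<Sum>i<l. b i) = ?n \<and> (\<forall>i<l. 0 \<le> b i)")
    case False
    then have "psi X l b \<sigma> = 0" for \<sigma>
      using psi_wrong_total[OF X, of b l \<sigma>] psi_neg[of _ l b X \<sigma>] by (meson not_le)
    then show ?thesis by simp
  next
    case True
    obtain w0 where w0: "w0 permutes {..<l}" "decreasing l (b \<circ> w0)" using exists_sorting by blast
    define a where "a = b \<circ> w0"
    have dec: "decreasing l a" using w0 by (simp add: a_def)
    have nn: "0 \<le> a i" if "i < l" for i
      using True permutes_in_image[OF w0(1), of i] that by (simp add: a_def)
    have sa: "(\<Sum>i<l. a i) = ?n" using True sum.permute[OF w0(1), of b] by (simp add: a_def)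
    have sqa: "(\<Sum>i<l. (a i)\<^sup>2) = (\<Sum>i<l. (b i)\<^sup>2)"
      using sum.permute[OF w0(1), of "\<lambda>i. (b i)\<^sup>2"] by (simp add: a_def o_def)
    have ipa: "?ip a = ?ip b"
      by (rule sum.cong) (auto simp: a_def psi_permute[OF w0(1)])
    obtain l' where l': "parts l' a" "(\<Sum>i<l'. a i) = (\<Sum>i<l. a i)"
      using chi_drop_zeros[OF X permutes_id dec nn] by blast
    \<comment> \<open>\<open>chi_drop_zeros\<close> provides a length for each permutation
      separately; it is the same for all, because prefix sums increase strictly along positive
      parts.\<close>
    have chi_eq: "chi X l' a \<sigma> = chi X l a \<sigma>" if s: "\<sigma> permutes X" for \<sigma>
    proof -
      obtain l'' where l'': "parts l'' a" "(\<Sum>i<l''. a i) = (\<Sum>i<l. a i)" "chi X l'' a \<sigma> = chi X l a \<sigma>"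
        using chi_drop_zeros[OF X s dec nn] by blast
      have "l'' = l'"
      proof (rule ccontr)
        assume ne: "l'' \<noteq> l'"
        have "(\<Sum>i<u. a i) < (\<Sum>i<v. a i)" if "u < v" "parts v a" for u v
          using that by (intro sum_strict_mono2) (auto simp: parts_def less_imp_le)
        then show False using ne l' l'' by (metis linorder_neqE_nat less_irrefl)
      qed
      then show ?thesis using l''(3) by simp
    qed
    have "0 = (\<Sum>\<sigma> | \<sigma> permutes X. chi X l a \<sigma> * \<phi> \<sigma>)"
      using orth[OF l'(1)] l'(2) sa chi_eq by simp
    also have "\<dots> = (\<Sum>w | w permutes {..<l}. sign w * ?ip (\<lambda>i. a i - int i + int (w i)))"
      by (simp add: sum_chi_mult alternant_def)
    also have "\<dots> = (\<Sum>w | w permutes {..<l}. if w = id then ?ip a else 0)"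
    proof (rule sum.cong[OF refl])
      fix w assume "w \<in> {w. w permutes {..<l}}"
      then have w: "w permutes {..<l}" by simp
      let ?c = "\<lambda>i. a i - int i + int (w i)"
      show "sign w * ?ip ?c = (if w = id then ?ip a else 0)"
      proof (cases "w = id")
        case True then show ?thesis by simp
      next
        case False
        have "?ip ?c = 0"
        proof (cases "\<forall>i<l. 0 \<le> ?c i")
          case False
          then have "psi X l ?c \<sigma> = 0" for \<sigma> using psi_neg[of _ l ?c X \<sigma>] by (meson not_le)
          then show ?thesis by simp
        next
          case nnc: True
          define d where "d i = int (w i) - int i" for i
          have "0 \<le> (\<Sum>i<j. d i)" for j
            using prefix_shift_ge[OF w, of "\<lambda>_. 0" j] by (simp add: d_def)
          then have ab: "0 \<le> (\<Sum>i<l. a i * d i)" using abel_nonneg[OF dec nn] by blast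
          obtain i0 where i0: "w i0 \<noteq> i0" using \<open>w \<noteq> id\<close> by (auto simp: fun_eq_iff)
          then have "i0 < l" using w permutes_not_in by fastforce
          then have "0 < (\<Sum>i<l. (d i)\<^sup>2)"
            using i0 by (intro sum_pos2[of _ i0]) (auto simp: d_def)
          moreover have "(\<Sum>i<l. (?c i)\<^sup>2) = (\<Sum>i<l. (a i)\<^sup>2) + 2 * (\<Sum>i<l. a i * d i) + (\<Sum>i<l. (d i)\<^sup>2)"
            unfolding sum_distrib_left sum.distrib[symmetric] d_def
            by (rule sum.cong) (auto simp: power2_eq_square algebra_simps)
          ultimately have gt: "(\<Sum>i<l. (b i)\<^sup>2) < (\<Sum>i<l. (?c i)\<^sup>2)" using ab sqa by simp
          have "(\<Sum>i<l. (?c i)\<^sup>2) \<le> ?n\<^sup>2"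
            using sum_squares_le[of l ?c] nnc sum_shift_permutes[OF w, of a] sa by simp
          then show ?thesis using gt by (intro less.hyps) simp
        qed
        then show ?thesis using False by simp
      qed
    qed
    also have "\<dots> = ?ip a" by (simp add: finite_permutations permutes_id)
    finally show ?thesis using ipa by simp
  qed
qed

corollary class_function_zero_chi:
  assumes X: "finite X" and \<phi>: "class_function X \<phi>"
    and orth: "\<And>l a. parts l a \<Longrightarrow> (\<Sum>i<l. a i) = int (card X) \<Longrightarrow>
      (\<Sum>\<sigma> | \<sigma> permutes X. chi X l a \<sigma> * \<phi> \<sigma>) = 0"
    and t: "t permutes X"
  shows "\<phi> t = 0"
proof (rule class_function_zero[OF X \<phi> _ t])
  fix l b
  show "(\<Sum>\<sigma> | \<sigma> permutes X. \<phi> \<sigma> * psi X l b \<sigma>) = 0"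
    unfolding mult.commute[of "\<phi> _"] by (rule orthogonal_psi_of_chi[OF X orth])
qed

lemma class_function_psi:
  assumes X: "finite X"
  shows "class_function X (psi X l a)"
  unfolding class_function_def
proof (intro allI impI)
  fix s g :: "'a \<Rightarrow> 'a" assume s: "s permutes X" and g: "g permutes X"
  let ?t = "g \<circ> s \<circ> inv g"
  have gg: "g (inv g x) = x" "inv g (g x) = x" for x using permutes_inverses[OF g] by auto
  have gX: "g x \<in> X \<longleftrightarrow> x \<in> X" "inv g x \<in> X \<longleftrightarrow> x \<in> X" "s x \<in> X \<longleftrightarrow> x \<in> X" for x
    using permutes_in_image[OF g] permutes_in_image[OF permutes_inv[OF g]] permutes_in_image[OF s] by auto
  have "bij_betw (\<lambda>B. restrict (B \<circ> g) X)
     {B \<in> type_colorings X {..<l} a. \<forall>x\<in>X. B (?t x) = B x}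
     {B \<in> type_colorings X {..<l} a. \<forall>x\<in>X. B (s x) = B x}"
  proof (rule bij_betw_byWitness[where f' = "\<lambda>B. restrict (B \<circ> inv g) X"], goal_cases)
    case 1
    show ?case
      by (auto simp: type_colorings_def fun_eq_iff restrict_def PiE_def extensional_def gg gX)
  next
    case 2
    show ?case
      by (auto simp: type_colorings_def fun_eq_iff restrict_def PiE_def extensional_def gg gX)
  next
    case 3
    show ?case
    proof (intro image_subsetI)
      fix B assume B: "B \<in> {B \<in> type_colorings X {..<l} a. \<forall>x\<in>X. B (?t x) = B x}"
      have "B (g (s x)) = B (g x)" if "x \<in> X" for x
      proof -
        have "g x \<in> X" using that gX by simp
        then have "B (?t (g x)) = B (g x)" using B by blast
        then show ?thesis by (simp add: gg)
      qed
      then show "restrict (B \<circ> g) X \<in> {B \<in> type_colorings X {..<l} a. \<forall>x\<in>X. B (s x) = B x}"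
        using type_colorings_comp[OF g, of B] B gX by simp
    qed
  next
    case 4
    show ?case
    proof (intro image_subsetI)
      fix B assume B: "B \<in> {B \<in> type_colorings X {..<l} a. \<forall>x\<in>X. B (s x) = B x}"
      then show "restrict (B \<circ> inv g) X \<in> {B \<in> type_colorings X {..<l} a. \<forall>x\<in>X. B (?t x) = B x}"
        using type_colorings_comp[OF permutes_inv[OF g], of B] gX gg by simp
    qed
  qed
  from bij_betw_same_card[OF this] show "psi X l a ?t = psi X l a s"
    unfolding psi_def by (simp only:)
qed

lemma class_function_chi:
  assumes X: "finite X"
  shows "class_function X (chi X l a)"
  unfolding class_function_def
proof (intro allI impI)
  fix s g assume s: "s permutes X" and g: "g permutes X"
  have "psi X l c (g \<circ> s \<circ> inv g) = psi X l c s" for c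
    using class_function_psi[OF X] s g unfolding class_function_def by blast
  then show "chi X l a (g \<circ> s \<circ> inv g) = chi X l a s"
    unfolding chi_def alternant_def by (simp only:)
qed

section \<open>Young symmetrizers\<close>

text \<open>Fillings map entries to boxes. Type 1 on \<open>Y\<close> makes them bijections onto
  \<open>Y\<close>, and the results on colourings apply.\<close>

definition fillings :: "'a set \<Rightarrow> (nat \<times> nat) set \<Rightarrow> ('a \<Rightarrow> nat \<times> nat) set" where
  "fillings X Y = type_colorings X Y (\<lambda>_. 1)"

definition col_stab :: "'a set \<Rightarrow> ('a \<Rightarrow> nat \<times> nat) \<Rightarrow> ('a \<Rightarrow> 'a) set" where
  "col_stab X T = stab X (\<lambda>x. snd (T x))"

definition row_stab :: "'a set \<Rightarrow> ('a \<Rightarrow> nat \<times> nat) \<Rightarrow> ('a \<Rightarrow> 'a) set" where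
  "row_stab X T = stab X (\<lambda>x. fst (T x))"

text \<open>Coefficient of \<open>\<sigma>\<close> in the Young symmetrizer of \<open>T\<close>, the
  signed column sum times the row sum.\<close>

definition symmetrizer :: "'a set \<Rightarrow> ('a \<Rightarrow> nat \<times> nat) \<Rightarrow> ('a \<Rightarrow> 'a) \<Rightarrow> int" where
  "symmetrizer X T \<sigma> = (\<Sum>q\<in>col_stab X T. \<Sum>p\<in>row_stab X T. if q \<circ> p = \<sigma> then sign q else 0)"

text \<open>Conjugation permutes the fillings, so the total over all of them is a class
  function.\<close>

definition young_function :: "'a set \<Rightarrow> (nat \<times> nat) set \<Rightarrow> ('a \<Rightarrow> 'a) \<Rightarrow> int" where
  "young_function X Y \<sigma> = (\<Sum>T\<in>fillings X Y. symmetrizer X T \<sigma>)"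

lemma finite_fillings: "finite X \<Longrightarrow> finite Y \<Longrightarrow> finite (fillings X Y)"
  unfolding fillings_def by (rule finite_type_colorings)

lemma finite_col_stab: "finite X \<Longrightarrow> finite (col_stab X T)"
  unfolding col_stab_def by (rule finite_stab)

lemma finite_row_stab: "finite X \<Longrightarrow> finite (row_stab X T)"
  unfolding row_stab_def by (rule finite_stab)

lemma filling_inj:
  assumes X: "finite X" and T: "T \<in> fillings X Y"
  shows "inj_on T X"
proof (rule inj_onI)
  fix x y assume xy: "x \<in> X" "y \<in> X" "T x = T y"
  have "T x \<in> Y" using T xy by (auto simp: fillings_def type_colorings_def)
  then have "card {z\<in>X. T z = T x} = 1" using T by (auto simp: fillings_def type_colorings_def)
  then obtain u where "{z\<in>X. T z = T x} = {u}" by (rule card_1_singletonE)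
  then show "x = y" using xy by (metis (mono_tags, lifting) mem_Collect_eq singletonD)
qed

lemma filling_mem: "T \<in> fillings X Y \<Longrightarrow> x \<in> X \<Longrightarrow> T x \<in> Y"
  by (auto simp: fillings_def type_colorings_def)

lemma card_fillings:
  assumes X: "finite X" and Y: "finite Y" and eq: "card X = card Y"
  shows "card (fillings X Y) = fact (card X)"
proof -
  have "\<exists>C. C \<in> type_colorings X Y (\<lambda>_. 1)"
    by (rule exists_type_coloring) (use X Y eq in auto)
  then have ne: "type_colorings X Y (\<lambda>_. 1) \<noteq> {}" by blast
  have "card (stab X T) = 1" if "T \<in> fillings X Y" for T
    by (simp add: stab_inj[OF filling_inj[OF X that]])
  then have "card (fillings X Y) = (\<Sum>T\<in>fillings X Y. card (stab X T))" by simp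
  also have "\<dots> = fact (card X)" using sum_card_stab[OF X Y ne] by (simp add: fillings_def)
  finally show ?thesis .
qed

text \<open>A row step followed by a column step returns to the starting box only if both are trivial.\<close>

lemma row_col_fixed:
  assumes T: "inj_on T X" and q: "q \<in> col_stab X T" and p: "p \<in> row_stab X T"
    and fixed: "q (p x) = x"
  shows "p x = x"
proof (cases "x \<in> X")
  case True
  have pX: "p x \<in> X" using p True permutes_in_image by (fastforce simp: row_stab_def stab_def)
  have "fst (T (p x)) = fst (T x)" using p True by (simp add: row_stab_def stab_def)
  moreover have "snd (T (q (p x))) = snd (T (p x))" using q pX by (simp add: col_stab_def stab_def)
  ultimately have "T (p x) = T x" using fixed by (simp add: prod_eq_iff)
  then show ?thesis using T pX True by (auto dest: inj_onD)
next
  case False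
  have "p permutes X" using p by (simp add: row_stab_def stab_def)
  then show ?thesis using False by (rule permutes_not_in)
qed

text \<open>q p = id forces both factors to be trivial, so each filling contributes 1. This value
  later fixes the scalar between the Young function and the character.\<close>

lemma young_function_id:
  assumes X: "finite X" and Y: "finite Y" and eq: "card X = card Y"
  shows "young_function X Y id = fact (card X)"
proof -
  have "symmetrizer X T id = 1" if T: "T \<in> fillings X Y" for T
  proof -
    have inj: "inj_on T X" by (rule filling_inj[OF X T])
    have id: "id \<in> col_stab X T" "id \<in> row_stab X T"
      by (simp_all add: col_stab_def row_stab_def stab_def permutes_id)
    have iff: "q \<circ> p = id \<longleftrightarrow> q = id \<and> p = id" if "q \<in> col_stab X T" "p \<in> row_stab X T" for q p
    proof
      assume e: "q \<circ> p = id"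
      then have "p x = x" for x using row_col_fixed[OF inj that] by (metis comp_apply id_apply)
      then have "p = id" by (simp add: fun_eq_iff)
      then show "q = id \<and> p = id" using e by simp
    qed simp
    have "symmetrizer X T id = (\<Sum>q\<in>col_stab X T. \<Sum>p\<in>row_stab X T. if p = id then (if q = id then 1 else 0) else 0)"
      unfolding symmetrizer_def by (intro sum.cong refl) (auto simp: iff)
    also have "\<dots> = (\<Sum>q\<in>col_stab X T. if q = id then 1 else 0)"
      using id finite_row_stab[OF X, of T] by (simp add: sum.delta)
    also have "\<dots> = 1" using id finite_col_stab[OF X, of T] by (simp add: sum.delta)
    finally show ?thesis .
  qed
  then show ?thesis by (simp add: young_function_def card_fillings[OF assms])
qed

lemma sum_symmetrizer_mult:
  assumes X: "finite X"
  shows "(\<Sum>\<sigma> | \<sigma> permutes X. symmetrizer X T \<sigma> * \<phi> \<sigma>) =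
    (\<Sum>q\<in>col_stab X T. \<Sum>p\<in>row_stab X T. sign q * \<phi> (q \<circ> p))"
proof -
  let ?P = "{\<sigma>. \<sigma> permutes X}"
  have fP: "finite ?P" using X by (rule finite_permutations)
  have "(\<Sum>\<sigma>\<in>?P. symmetrizer X T \<sigma> * \<phi> \<sigma>) =
    (\<Sum>\<sigma>\<in>?P. \<Sum>q\<in>col_stab X T. \<Sum>p\<in>row_stab X T. if q \<circ> p = \<sigma> then sign q * \<phi> \<sigma> else 0)"
    unfolding symmetrizer_def sum_distrib_right by (intro sum.cong refl) auto
  also have "\<dots> = (\<Sum>q\<in>col_stab X T. \<Sum>\<sigma>\<in>?P. \<Sum>p\<in>row_stab X T. if q \<circ> p = \<sigma> then sign q * \<phi> \<sigma> else 0)"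
    by (rule sum.swap)
  also have "\<dots> = (\<Sum>q\<in>col_stab X T. \<Sum>p\<in>row_stab X T. sign q * \<phi> (q \<circ> p))"
  proof (rule sum.cong[OF refl])
    fix q assume q: "q \<in> col_stab X T"
    have "(\<Sum>\<sigma>\<in>?P. \<Sum>p\<in>row_stab X T. if q \<circ> p = \<sigma> then sign q * \<phi> \<sigma> else 0) =
      (\<Sum>p\<in>row_stab X T. \<Sum>\<sigma>\<in>?P. if q \<circ> p = \<sigma> then sign q * \<phi> \<sigma> else 0)" by (rule sum.swap)
    also have "\<dots> = (\<Sum>p\<in>row_stab X T. sign q * \<phi> (q \<circ> p))"
    proof (rule sum.cong[OF refl])
      fix p assume "p \<in> row_stab X T"
      then have "q \<circ> p \<in> ?P" using q by (simp add: col_stab_def row_stab_def stab_def permutes_compose)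
      then show "(\<Sum>\<sigma>\<in>?P. if q \<circ> p = \<sigma> then sign q * \<phi> \<sigma> else 0) = sign q * \<phi> (q \<circ> p)"
        using sum.delta'[OF fP, of "q \<circ> p" "\<lambda>\<sigma>. sign q * \<phi> \<sigma>"] by simp
    qed
    finally show "(\<Sum>\<sigma>\<in>?P. \<Sum>p\<in>row_stab X T. if q \<circ> p = \<sigma> then sign q * \<phi> \<sigma> else 0) =
      (\<Sum>p\<in>row_stab X T. sign q * \<phi> (q \<circ> p))" .
  qed
  finally show ?thesis .
qed

lemma symmetrizer_conjugate:
  assumes X: "finite X" and g: "g permutes X" and T': "\<And>x. x \<in> X \<Longrightarrow> T' x = T (g x)"
  shows "symmetrizer X T' s = symmetrizer X T (g \<circ> s \<circ> inv g)"
proof -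
  let ?c = "\<lambda>\<sigma>. g \<circ> \<sigma> \<circ> inv g"
  have gg: "g (inv g x) = x" "inv g (g x) = x" for x using permutes_inverses[OF g] by auto
  have c_mult: "?c q \<circ> ?c p = ?c (q \<circ> p)" for q p by (simp add: fun_eq_iff gg)
  have c_inj: "?c u = ?c v \<longleftrightarrow> u = v" for u v
  proof
    assume e: "?c u = ?c v"
    show "u = v"
    proof
      fix x show "u x = v x" using fun_cong[OF e, of "g x"] gg by (metis comp_apply)
    qed
  qed simp
  have c_sign: "sign (?c q) = sign q" if "q \<in> col_stab X T'" for q
  proof -
    have "permutation q" "permutation g" "permutation (inv g)"
      using that g permutes_inv[OF g] permutes_imp_permutation[OF X]
      by (auto simp: col_stab_def stab_def)
    then show ?thesis by (simp add: sign_compose permutation_compose sign_inverse)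
  qed
  have bc: "bij_betw ?c (col_stab X T') (col_stab X T)"
    unfolding col_stab_def by (rule stab_conjugate_bij[OF g]) (simp add: T')
  have br: "bij_betw ?c (row_stab X T') (row_stab X T)"
    unfolding row_stab_def by (rule stab_conjugate_bij[OF g]) (simp add: T')
  have "symmetrizer X T (?c s) =
    (\<Sum>q\<in>col_stab X T'. \<Sum>p\<in>row_stab X T'. if ?c q \<circ> ?c p = ?c s then sign (?c q) else 0)"
    unfolding symmetrizer_def
    by (simp only: sum.reindex_bij_betw[OF bc, symmetric] sum.reindex_bij_betw[OF br, symmetric])
  also have "\<dots> = symmetrizer X T' s"
    unfolding symmetrizer_def c_mult c_inj by (intro sum.cong refl) (simp add: c_sign)
  finally show ?thesis ..
qed

lemma class_function_young:
  assumes X: "finite X"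
  shows "class_function X (young_function X Y)"
  unfolding class_function_def
proof (intro allI impI)
  fix s g :: "'a \<Rightarrow> 'a" assume s: "s permutes X" and g: "g permutes X"
  have g': "inv g permutes X" using g by (rule permutes_inv)
  have gg: "g (inv g x) = x" "inv g (g x) = x" for x using permutes_inverses[OF g] by auto
  have gX: "g x \<in> X \<longleftrightarrow> x \<in> X" "inv g x \<in> X \<longleftrightarrow> x \<in> X" for x
    using permutes_in_image[OF g] permutes_in_image[OF g'] by auto
  have ext: "T \<in> extensional X" if "T \<in> fillings X Y" for T
    using that by (simp add: fillings_def type_colorings_def PiE_def)
  show "young_function X Y (g \<circ> s \<circ> inv g) = young_function X Y s"
    unfolding young_function_def
  proof (rule sum.reindex_bij_witness[of _ "\<lambda>T. restrict (T \<circ> inv g) X" "\<lambda>T. restrict (T \<circ> g) X"])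
    fix T assume T: "T \<in> fillings X Y"
    show "restrict (restrict (T \<circ> g) X \<circ> inv g) X = T"
      using ext[OF T] by (auto simp: fun_eq_iff restrict_def extensional_def gg gX)
    show "restrict (restrict (T \<circ> inv g) X \<circ> g) X = T"
      using ext[OF T] by (auto simp: fun_eq_iff restrict_def extensional_def gg gX)
    show "restrict (T \<circ> g) X \<in> fillings X Y" using T unfolding fillings_def by (rule type_colorings_comp[OF g])
    show "restrict (T \<circ> inv g) X \<in> fillings X Y" using T unfolding fillings_def by (rule type_colorings_comp[OF g'])
    show "symmetrizer X (restrict (T \<circ> g) X) s = symmetrizer X T (g \<circ> s \<circ> inv g)"
      by (rule symmetrizer_conjugate[OF X g]) simp
  qed
qed

subsection \<open>Vanishing of the symmetrizer on permutation characters\<close>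

lemma psi_eq_sum:
  assumes X: "finite X"
  shows "psi X l a \<sigma> = (\<Sum>B\<in>type_colorings X {..<l} a. if \<forall>x\<in>X. B (\<sigma> x) = B x then 1 else 0)"
proof -
  have "finite (type_colorings X {..<l} a)" using X by (intro finite_type_colorings) auto
  from sum.inter_filter[OF this, of "\<lambda>_. 1::int" "\<lambda>B. \<forall>x\<in>X. B (\<sigma> x) = B x", symmetric]
  show ?thesis by (simp add: psi_def)
qed

text \<open>psi^b counts the colourings \<open>B\<close> fixed by q p. If \<open>B\<close> repeats a
  colour within a column of \<open>T\<close>, the corresponding transposition cancels the signed sum
  over q.\<close>

lemma symmetrizer_psi_nonzero:
  assumes X: "finite X" and nz: "(\<Sum>\<sigma> | \<sigma> permutes X. symmetrizer X T \<sigma> * psi X m b \<sigma>) \<noteq> 0"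
  shows "\<exists>B\<in>type_colorings X {..<m} b. \<forall>x\<in>X. \<forall>y\<in>X. x \<noteq> y \<longrightarrow> snd (T x) = snd (T y) \<longrightarrow> B x \<noteq> B y"
proof (rule ccontr)
  assume neg: "\<not> ?thesis"
  let ?TC = "type_colorings X {..<m} b"
  let ?f = "\<lambda>B p q. if \<forall>x\<in>X. B (q (p x)) = B x then 1 else 0 :: int"
  have z: "(\<Sum>q\<in>col_stab X T. sign q * ?f B p q) = 0" if B: "B \<in> ?TC" for B p
  proof -
    obtain x y where xy: "x \<in> X" "y \<in> X" "x \<noteq> y" "snd (T x) = snd (T y)" "B x = B y"
      using neg B by blast
    have Bt: "B (transpose x y z) = B z" for z using xy by (simp add: transpose_def)
    show ?thesis unfolding col_stab_def
      by (rule sum_sign_cancel_left[OF X xy(1-3), of "\<lambda>x. snd (T x)"]) (simp_all add: xy(4) Bt)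
  qed
  have "(\<Sum>\<sigma> | \<sigma> permutes X. symmetrizer X T \<sigma> * psi X m b \<sigma>) =
     (\<Sum>q\<in>col_stab X T. \<Sum>p\<in>row_stab X T. \<Sum>B\<in>?TC. sign q * ?f B p q)"
    unfolding sum_symmetrizer_mult[OF X]
    by (intro sum.cong refl) (simp only: psi_eq_sum[OF X] sum_distrib_left o_apply)
  also have "\<dots> = (\<Sum>p\<in>row_stab X T. \<Sum>q\<in>col_stab X T. \<Sum>B\<in>?TC. sign q * ?f B p q)"
    by (rule sum.swap)
  also have "\<dots> = (\<Sum>p\<in>row_stab X T. \<Sum>B\<in>?TC. \<Sum>q\<in>col_stab X T. sign q * ?f B p q)"
    by (rule sum.cong[OF refl], rule sum.swap)
  also have "\<dots> = 0" by (rule sum.neutral, rule ballI, rule sum.neutral, rule ballI, rule z)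
  finally show False using nz by simp
qed

text \<open>The factor \<open>sign \<sigma>\<close> turns the sign of q into the sign of p, so now a
  colour repeated within a row cancels. The transposition multiplies p from the right, which amounts
  to renaming the point at which invariance of \<open>B\<close> is tested.\<close>

lemma symmetrizer_sign_psi_nonzero:
  assumes X: "finite X"
    and nz: "(\<Sum>\<sigma> | \<sigma> permutes X. symmetrizer X T \<sigma> * (sign \<sigma> * psi X m b \<sigma>)) \<noteq> 0"
  shows "\<exists>B\<in>type_colorings X {..<m} b. \<forall>x\<in>X. \<forall>y\<in>X. x \<noteq> y \<longrightarrow> fst (T x) = fst (T y) \<longrightarrow> B x \<noteq> B y"
proof (rule ccontr)
  assume neg: "\<not> ?thesis"
  let ?TC = "type_colorings X {..<m} b"
  let ?f = "\<lambda>B q p. if \<forall>x\<in>X. B (q (p x)) = B x then 1 else 0 :: int"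
  have z: "(\<Sum>p\<in>row_stab X T. sign p * ?f B q p) = 0" if B: "B \<in> ?TC" for B q
  proof -
    obtain x y where xy: "x \<in> X" "y \<in> X" "x \<noteq> y" "fst (T x) = fst (T y)" "B x = B y"
      using neg B by blast
    let ?t = "transpose x y"
    have Bt: "B (?t z) = B z" for z using xy by (simp add: transpose_def)
    have t: "?t permutes X" using xy by (simp add: permutes_swap_id)
    have tX: "?t z \<in> X \<longleftrightarrow> z \<in> X" for z using permutes_in_image[OF t] .
    have "(\<forall>x\<in>X. B (q ((p \<circ> ?t) x)) = B x) \<longleftrightarrow> (\<forall>x\<in>X. B (q (p x)) = B x)" for p
    proof
      assume a: "\<forall>x\<in>X. B (q ((p \<circ> ?t) x)) = B x"
      show "\<forall>x\<in>X. B (q (p x)) = B x"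
      proof
        fix u assume "u \<in> X"
        then have "B (q ((p \<circ> ?t) (?t u))) = B (?t u)" using a tX by blast
        then show "B (q (p u)) = B u" by (simp add: Bt)
      qed
    next
      assume a: "\<forall>x\<in>X. B (q (p x)) = B x"
      show "\<forall>x\<in>X. B (q ((p \<circ> ?t) x)) = B x" using a tX Bt by simp
    qed
    then have "?f B q (p \<circ> ?t) = ?f B q p" for p by (simp only:)
    then show ?thesis unfolding row_stab_def
      by (intro sum_sign_cancel_right[OF X xy(1-3), of "\<lambda>x. fst (T x)"]) (simp_all add: xy(4))
  qed
  have sg: "sign q * (sign (q \<circ> p) * c) = sign p * c" if "q \<in> col_stab X T" "p \<in> row_stab X T" for q p c
  proof -
    have "permutation q" "permutation p"
      using that permutes_imp_permutation[OF X] by (auto simp: stab_def col_stab_def row_stab_def)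
    then show ?thesis by (simp add: sign_compose flip: mult.assoc)
  qed
  have "(\<Sum>\<sigma> | \<sigma> permutes X. symmetrizer X T \<sigma> * (sign \<sigma> * psi X m b \<sigma>)) =
     (\<Sum>q\<in>col_stab X T. \<Sum>p\<in>row_stab X T. \<Sum>B\<in>?TC. sign p * ?f B q p)"
    unfolding sum_symmetrizer_mult[OF X]
    by (intro sum.cong refl) (simp only: sg psi_eq_sum[OF X] sum_distrib_left o_apply)
  also have "\<dots> = (\<Sum>q\<in>col_stab X T. \<Sum>B\<in>?TC. \<Sum>p\<in>row_stab X T. sign p * ?f B q p)"
    by (rule sum.cong[OF refl], rule sum.swap)
  also have "\<dots> = 0" by (rule sum.neutral, rule ballI, rule sum.neutral, rule ballI, rule z)
  finally show False using nz by simp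
qed

section \<open>Dominance relations forced by injective colourings\<close>

lemma prefix_eq_card:
  fixes B :: "'a \<Rightarrow> nat"
  assumes X: "finite X" and B: "B \<in> type_colorings X {..<m} b" and j: "j \<le> m"
  shows "(\<Sum>i<j. b i) = int (card {x\<in>X. B x < j})"
proof -
  have "{x\<in>X. B x < j} = (\<Union>i\<in>{..<j}. {x\<in>X. B x = i})" by auto
  then have "card {x\<in>X. B x < j} = (\<Sum>i<j. card {x\<in>X. B x = i})"
    using X by (simp, subst card_UN_disjoint) auto
  also have "int \<dots> = (\<Sum>i<j. b i)"
    using B j by (simp add: type_colorings_def)
  finally show ?thesis ..
qed

text \<open>In row i the points of colour below j occupy distinct boxes and have distinct colours,
  so there are at most min (lam ! i) j of them.\<close>

lemma row_injective_dominance: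
  assumes X: "finite X" and T: "T \<in> fillings X (young lam)" and B: "B \<in> type_colorings X {..<m} b"
    and inj: "\<forall>x\<in>X. \<forall>y\<in>X. x \<noteq> y \<longrightarrow> fst (T x) = fst (T y) \<longrightarrow> B x \<noteq> B y" and j: "j \<le> m"
  shows "(\<Sum>i<j. b i) \<le> (\<Sum>i<length lam. min (int (lam ! i)) (int j))"
proof -
  let ?S = "\<lambda>i. {x\<in>X. fst (T x) = i \<and> B x < j}"
  have inr: "fst (T x) < length lam" "snd (T x) < lam ! fst (T x)" if "x \<in> X" for x
    using filling_mem[OF T that] by (auto simp: young_def)
  have "card (?S i) \<le> lam ! i" for i
  proof -
    have "inj_on (\<lambda>x. snd (T x)) (?S i)"
    proof (rule inj_onI)
      fix x y assume "x \<in> ?S i" "y \<in> ?S i" "snd (T x) = snd (T y)"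
      then have "T x = T y" "x \<in> X" "y \<in> X" by (auto simp: prod_eq_iff)
      then show "x = y" by (rule inj_onD[OF filling_inj[OF X T]])
    qed
    moreover have "(\<lambda>x. snd (T x)) ` ?S i \<subseteq> {..<lam ! i}" using inr by auto
    ultimately show ?thesis using card_inj_on_le[of _ "?S i" "{..<lam ! i}"] by simp
  qed
  moreover have "card (?S i) \<le> j" for i
  proof -
    have "inj_on B (?S i)" using inj by (intro inj_onI) auto
    then show ?thesis using card_inj_on_le[of B "?S i" "{..<j}"] by auto
  qed
  ultimately have le: "int (card (?S i)) \<le> min (int (lam ! i)) (int j)" for i by simp
  have "{x\<in>X. B x < j} = (\<Union>i\<in>{..<length lam}. ?S i)" using inr by auto
  then have "card {x\<in>X. B x < j} \<le> (\<Sum>i<length lam. card (?S i))"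
    using card_UN_le[of "{..<length lam}" ?S] by simp
  then have "int (card {x\<in>X. B x < j}) \<le> (\<Sum>i<length lam. int (card (?S i)))"
    by (simp flip: of_nat_sum)
  also have "\<dots> \<le> (\<Sum>i<length lam. min (int (lam ! i)) (int j))" using le by (intro sum_mono)
  finally show ?thesis by (simp add: prefix_eq_card[OF X B j])
qed

text \<open>In each column the points of colour below j are at most as many as the boxes of that
  column in the first j rows; summed over all columns these boxes make up the first j rows.\<close>

lemma column_injective_dominance:
  assumes X: "finite X" and lam: "is_partition lam" and T: "T \<in> fillings X (young lam)"
    and B: "B \<in> type_colorings X {..<m} b"
    and inj: "\<forall>x\<in>X. \<forall>y\<in>X. x \<noteq> y \<longrightarrow> snd (T x) = snd (T y) \<longrightarrow> B x \<noteq> B y" and j: "j \<le> m"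
  shows "(\<Sum>i<j. b i) \<le> (\<Sum>i<min j (length lam). int (lam ! i))"
proof -
  let ?Y = "young lam"
  let ?N = "snd ` ?Y"
  let ?S = "\<lambda>c. {x\<in>X. snd (T x) = c \<and> B x < j}"
  let ?H = "\<lambda>c. {i. (i, c) \<in> ?Y}"
  have finH: "finite (?H c)" for c by (rule finite_subset[of _ "fst ` ?Y"]) (auto simp: rev_image_eqI)
  have le: "card (?S c) \<le> card {i\<in>?H c. i < j}" for c
  \<comment> \<open>Either the column reaches through the first j rows and the number of colours is
    the limit, or it is shorter and its own boxes are.\<close>
  proof (cases "{..<j} \<subseteq> ?H c")
    case True
    then have "{i\<in>?H c. i < j} = {..<j}" by auto
    moreover have "inj_on B (?S c)" using inj by (intro inj_onI) auto
    then have "card (?S c) \<le> j" using card_inj_on_le[of B "?S c" "{..<j}"] by auto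
    ultimately show ?thesis by simp
  next
    case False
    then obtain i0 where i0: "i0 < j" "(i0, c) \<notin> ?Y" by auto
    have "i < j" if "(i, c) \<in> ?Y" for i
      using young_down_closed[OF lam that, of i0 c] i0 by (cases "i0 \<le> i") auto
    then have H: "{i\<in>?H c. i < j} = ?H c" by auto
    have "inj_on (\<lambda>x. fst (T x)) (?S c)"
    proof (rule inj_onI)
      fix x y assume "x \<in> ?S c" "y \<in> ?S c" "fst (T x) = fst (T y)"
      then have "T x = T y" "x \<in> X" "y \<in> X" by (auto simp: prod_eq_iff)
      then show "x = y" by (rule inj_onD[OF filling_inj[OF X T]])
    qed
    moreover have "(\<lambda>x. fst (T x)) ` ?S c \<subseteq> ?H c" using filling_mem[OF T] by force
    ultimately show ?thesis unfolding H using card_inj_on_le[OF _ _ finH] by blast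
  qed
  have "{x\<in>X. B x < j} = (\<Union>c\<in>?N. ?S c)" using filling_mem[OF T] by force
  then have "card {x\<in>X. B x < j} \<le> (\<Sum>c\<in>?N. card (?S c))"
    using card_UN_le[of ?N ?S] by simp
  also have "\<dots> \<le> (\<Sum>c\<in>?N. card {i\<in>?H c. i < j})" by (intro sum_mono le)
  also have "\<dots> = card (Sigma ?N (\<lambda>c. {i\<in>?H c. i < j}))"
    using finH by (subst card_SigmaI) auto
  also have "\<dots> = card (Sigma {..<min j (length lam)} (\<lambda>i. {..<lam ! i}))"
  proof -
    have "prod.swap ` Sigma ?N (\<lambda>c. {i\<in>?H c. i < j}) = Sigma {..<min j (length lam)} (\<lambda>i. {..<lam ! i})"
      by (force simp: young_def image_iff)
    then show ?thesis using card_image[of prod.swap "Sigma ?N (\<lambda>c. {i\<in>?H c. i < j})"] by simp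
  qed
  also have "\<dots> = (\<Sum>i<min j (length lam). lam ! i)" by simp
  finally have "int (card {x\<in>X. B x < j}) \<le> int (\<Sum>i<min j (length lam). lam ! i)"
    by (simp only: zle_int)
  then show ?thesis by (simp add: prefix_eq_card[OF X B j])
qed

lemma young_function_psi_dominance:
  assumes X: "finite X" and lam: "is_partition lam"
    and nz: "(\<Sum>\<sigma> | \<sigma> permutes X. young_function X (young lam) \<sigma> * psi X m b \<sigma>) \<noteq> 0" and j: "j \<le> m"
  shows "(\<Sum>i<j. b i) \<le> (\<Sum>i<min j (length lam). int (lam ! i))"
proof -
  have "(\<Sum>\<sigma> | \<sigma> permutes X. young_function X (young lam) \<sigma> * psi X m b \<sigma>) =
     (\<Sum>T\<in>fillings X (young lam). \<Sum>\<sigma> | \<sigma> permutes X. symmetrizer X T \<sigma> * psi X m b \<sigma>)"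
    unfolding young_function_def sum_distrib_right by (rule sum.swap)
  with nz obtain T where T: "T \<in> fillings X (young lam)"
    "(\<Sum>\<sigma> | \<sigma> permutes X. symmetrizer X T \<sigma> * psi X m b \<sigma>) \<noteq> 0"
    by (metis (no_types, lifting) sum.not_neutral_contains_not_neutral)
  obtain B where "B \<in> type_colorings X {..<m} b"
    "\<forall>x\<in>X. \<forall>y\<in>X. x \<noteq> y \<longrightarrow> snd (T x) = snd (T y) \<longrightarrow> B x \<noteq> B y"
    using symmetrizer_psi_nonzero[OF X T(2)] by (elim bexE)
  then show ?thesis by (rule column_injective_dominance[OF X lam T(1) _ _ j])
qed

lemma young_function_sign_psi_dominance:
  assumes X: "finite X"
    and nz: "(\<Sum>\<sigma> | \<sigma> permutes X. young_function X (young lam) \<sigma> * (sign \<sigma> * psi X m b \<sigma>)) \<noteq> 0"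
    and j: "j \<le> m"
  shows "(\<Sum>i<j. b i) \<le> (\<Sum>i<length lam. min (int (lam ! i)) (int j))"
proof -
  have "(\<Sum>\<sigma> | \<sigma> permutes X. young_function X (young lam) \<sigma> * (sign \<sigma> * psi X m b \<sigma>)) =
     (\<Sum>T\<in>fillings X (young lam). \<Sum>\<sigma> | \<sigma> permutes X. symmetrizer X T \<sigma> * (sign \<sigma> * psi X m b \<sigma>))"
    unfolding young_function_def sum_distrib_right by (rule sum.swap)
  with nz obtain T where T: "T \<in> fillings X (young lam)"
    "(\<Sum>\<sigma> | \<sigma> permutes X. symmetrizer X T \<sigma> * (sign \<sigma> * psi X m b \<sigma>)) \<noteq> 0"
    by (metis (no_types, lifting) sum.not_neutral_contains_not_neutral)
  obtain B where "B \<in> type_colorings X {..<m} b"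
    "\<forall>x\<in>X. \<forall>y\<in>X. x \<noteq> y \<longrightarrow> fst (T x) = fst (T y) \<longrightarrow> B x \<noteq> B y"
    using symmetrizer_sign_psi_nonzero[OF X T(2)] by (elim bexE)
  then show ?thesis by (rule row_injective_dominance[OF X T(1) _ _ j])
qed

subsection \<open>Identification with the irreducible character\<close>

text \<open>The boxes in the first j columns, counted by columns and by rows.\<close>

lemma prefix_conjugate:
  fixes l :: nat
  assumes "\<And>i. i < l \<Longrightarrow> 0 \<le> a i"
  shows "(\<Sum>j'<j. int (card {i. i < l \<and> int j' < a i})) = (\<Sum>i<l. min (a i) (int j))"
proof (induction j)
  case 0
  then show ?case using assms by simp
next
  case (Suc j)
  have "(\<Sum>i<l. if int j < a i then 1 else 0) = (\<Sum>i\<in>{i\<in>{..<l}. int j < a i}. 1::int)"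
    by (rule sum.inter_filter[symmetric]) simp
  moreover have "{i\<in>{..<l}. int j < a i} = {i. i < l \<and> int j < a i}" by auto
  ultimately have "int (card {i. i < l \<and> int j < a i}) = (\<Sum>i<l. if int j < a i then 1 else 0)"
    by simp
  then have "(\<Sum>j'<Suc j. int (card {i. i < l \<and> int j' < a i})) =
     (\<Sum>i<l. min (a i) (int j) + (if int j < a i then 1 else 0))"
    using Suc.IH by (simp add: sum.distrib)
  also have "\<dots> = (\<Sum>i<l. min (a i) (int (Suc j)))" by (intro sum.cong refl) auto
  finally show ?case .
qed

text \<open>Padding by zeros lets partitions of different lengths be compared entry by
  entry.\<close>

definition part_at :: "nat list \<Rightarrow> nat \<Rightarrow> int" where
  "part_at nu i = (if i < length nu then int (nu ! i) else 0)"

lemma sum_part_at_prefix: "(\<Sum>i<j. part_at nu i) = (\<Sum>i<min j (length nu). int (nu ! i))"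
proof -
  have "(\<Sum>i<j. part_at nu i) = (\<Sum>i<min j (length nu). part_at nu i)"
    by (rule sum.mono_neutral_right) (auto simp: part_at_def)
  then show ?thesis by (simp add: part_at_def)
qed

lemma sum_part_at_min:
  assumes "length nu \<le> N"
  shows "(\<Sum>i<N. min (part_at nu i) (int j)) = (\<Sum>i<length nu. min (int (nu ! i)) (int j))"
proof -
  have "(\<Sum>i<N. min (part_at nu i) (int j)) = (\<Sum>i<length nu. min (part_at nu i) (int j))"
    by (rule sum.mono_neutral_right) (use assms in \<open>auto simp: part_at_def\<close>)
  then show ?thesis by (simp add: part_at_def)
qed

lemma part_at_inj:
  assumes "is_partition lam" "is_partition nu" "\<And>i. part_at lam i = part_at nu i"
  shows "lam = nu"
proof -
  have iff: "i < length kap \<longleftrightarrow> 0 < part_at kap i" if "is_partition kap" for kap i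
    using is_partition_nth_pos[OF that, of i] by (auto simp: part_at_def)
  then have "i < length lam \<longleftrightarrow> i < length nu" for i using assms by metis
  then have l: "length lam = length nu" by (metis linorder_neqE_nat less_irrefl)
  show ?thesis
  proof (rule nth_equalityI[OF l])
    fix i assume "i < length lam"
    then show "lam ! i = nu ! i" using assms(3)[of i] l by (simp add: part_at_def)
  qed
qed

text \<open>Conjugation reverses dominance, so \<open>lam\<close> can lie above \<open>nu\<close>
  both by rows and by columns only if they agree. Concretely, at the first row where they differ
  \<open>lam\<close> is longer, and cutting all rows at the length in \<open>nu\<close> contradicts
  the column condition.\<close>

lemma dominance_antisym_conjugate:
  assumes lam: "is_partition lam" "sum_list lam = n" and nu: "is_partition nu" "sum_list nu = n"
    and d1: "\<And>j. j \<le> length nu \<Longrightarrow> (\<Sum>i<j. int (nu ! i)) \<le> (\<Sum>i<min j (length lam). int (lam ! i))"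
    and d2: "\<And>j. j \<le> n \<Longrightarrow> (\<Sum>i<length nu. min (int (nu ! i)) (int j)) \<le>
      (\<Sum>i<length lam. min (int (lam ! i)) (int j))"
  shows "lam = nu"
proof (rule part_at_inj[OF lam(1) nu(1)], rule ccontr)
  let ?a = "part_at lam" and ?b = "part_at nu"
  fix i0 assume "?a i0 \<noteq> ?b i0"
  define p where "p = (LEAST i. ?a i \<noteq> ?b i)"
  have pne: "?a p \<noteq> ?b p" unfolding p_def by (rule LeastI) fact
  have peq: "?a i = ?b i" if "i < p" for i using not_less_Least[of i "\<lambda>i. ?a i \<noteq> ?b i"] that by (simp add: p_def)
  have a0: "0 \<le> ?a i" for i by (simp add: part_at_def)
  have "(\<Sum>i<j. ?b i) \<le> (\<Sum>i<j. ?a i)" for j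
  proof (cases "j \<le> length nu")
    case True
    then show ?thesis using d1[OF True] by (simp add: sum_part_at_prefix min_absorb1)
  next
    case False
    have "(\<Sum>i<j. ?b i) = (\<Sum>i<length nu. int (nu ! i))" using False by (simp add: sum_part_at_prefix min_absorb2)
    also have "\<dots> \<le> (\<Sum>i<length nu. ?a i)" using d1[of "length nu"] by (simp add: sum_part_at_prefix)
    also have "\<dots> \<le> (\<Sum>i<j. ?a i)" using False a0 by (intro sum_mono2) auto
    finally show ?thesis .
  qed
  from this[of "Suc p"] have lt: "?b p < ?a p" using peq pne by simp
  define N where "N = Suc (p + length lam + length nu)"
  have tot: "(\<Sum>i<N. ?a i) = int n" "(\<Sum>i<N. ?b i) = int n"
  proof -
    have "min N (length lam) = length lam" "min N (length nu) = length nu" by (simp_all add: N_def)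
    then show "(\<Sum>i<N. ?a i) = int n" "(\<Sum>i<N. ?b i) = int n"
      using sum_parts[of lam] sum_parts[of nu] lam nu by (simp_all add: sum_part_at_prefix)
  qed
  have split: "(\<Sum>i<N. g i) = (\<Sum>i<p. g i) + (\<Sum>i\<in>{p..<N}. g i)" for g :: "nat \<Rightarrow> int"
  proof -
    have "p \<le> N" by (simp add: N_def)
    then show ?thesis using sum.atLeastLessThan_concat[of 0 p N g] by (simp add: atLeast0LessThan)
  qed
  \<comment> \<open>Cut at the length of row p of \<open>nu\<close>: from p on the rows of
    \<open>nu\<close> survive in full and those of \<open>lam\<close> do not, although both tails
    have equal totals and the earlier rows agree.\<close>
  define v where "v = nat (?b p)"
  have v: "?b p = int v" by (simp add: v_def part_at_def)
  have bv: "?b i \<le> int v" if "p \<le> i" for i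
    using is_partition_nth_le[OF nu(1) that] that v[symmetric] by (auto simp: part_at_def)
  have "int v \<le> (\<Sum>i<N. ?b i)" unfolding v[symmetric]
    by (rule member_le_sum) (auto simp: N_def part_at_def)
  then have vn: "v \<le> n" using tot by simp
  have "(\<Sum>i<N. min (?b i) (int v)) \<le> (\<Sum>i<N. min (?a i) (int v))"
  proof -
    have "length lam \<le> N" "length nu \<le> N" by (simp_all add: N_def)
    then show ?thesis using d2[OF vn] by (simp add: sum_part_at_min)
  qed
  moreover have "(\<Sum>i<p. min (?b i) (int v)) = (\<Sum>i<p. min (?a i) (int v))"
    using peq by (intro sum.cong) auto
  moreover have "(\<Sum>i\<in>{p..<N}. min (?b i) (int v)) = (\<Sum>i\<in>{p..<N}. ?b i)"
    using bv by (intro sum.cong) auto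
  moreover have "(\<Sum>i\<in>{p..<N}. min (?a i) (int v)) < (\<Sum>i\<in>{p..<N}. ?a i)"
    using lt v by (intro sum_strict_mono_ex1 ballI bexI[of _ p]) (auto simp: N_def)
  moreover have "(\<Sum>i\<in>{p..<N}. ?b i) = (\<Sum>i\<in>{p..<N}. ?a i)"
  proof -
    have "(\<Sum>i<p. ?a i) = (\<Sum>i<p. ?b i)" using peq by (intro sum.cong) auto
    then show ?thesis using split[of ?a] split[of ?b] tot by simp
  qed
  ultimately show False using split[of "\<lambda>i. min (?b i) (int v)"] split[of "\<lambda>i. min (?a i) (int v)"] by simp
qed

text \<open>Differences of consecutive sums are the column lengths, and these determine the
  diagram.\<close>

lemma conjugate_sums_inj:
  assumes kap: "is_partition kap" "sum_list kap = n" and nu: "is_partition nu" "sum_list nu = n"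
    and eq: "\<And>j. j \<le> n \<Longrightarrow> (\<Sum>i<length kap. min (int (kap ! i)) (int j)) =
      (\<Sum>i<length nu. min (int (nu ! i)) (int j))"
  shows "kap = nu"
proof (rule young_inj[OF kap(1) nu(1)])
  have col: "(i, j) \<in> young lam \<longleftrightarrow> i < card {i. i < length lam \<and> int j < int (lam ! i)}"
    if lam: "is_partition lam" for lam i j
  proof -
    let ?S = "{i. i < length lam \<and> j < lam ! i}"
    have "?S = {..<card ?S}"
    proof -
      have "finite ?S" by simp
      moreover have "i' \<in> ?S" if "i \<in> ?S" "i' \<le> i" for i i'
        using young_down_closed[OF lam, of i j i' j] that by (auto simp: young_def)
      moreover have "S = {..<card S}"
        if fin: "finite S" and down: "\<And>i i'. i \<in> S \<Longrightarrow> i' \<le> i \<Longrightarrow> i' \<in> S" for S :: "nat set"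
      proof (cases "S = {}")
        case False
        have "S = {..Max S}"
        proof
          show "S \<subseteq> {..Max S}" using fin by auto
          show "{..Max S} \<subseteq> S" using down[OF Max_in[OF fin False]] by auto
        qed
        then have "S = {..<Suc (Max S)}" by (simp only: lessThan_Suc_atMost)
        then show ?thesis by (metis card_lessThan)
      qed simp
      ultimately show ?thesis by blast
    qed
    then have "i \<in> ?S \<longleftrightarrow> i < card ?S" by (metis (no_types, lifting) lessThan_iff)
    then show ?thesis by (simp add: young_def)
  qed
  have card_eq: "card {i. i < length kap \<and> int j < int (kap ! i)} = card {i. i < length nu \<and> int j < int (nu ! i)}" for j
  proof (cases "j < n")
    case True
    have "int (card {i. i < length lam \<and> int j < int (lam ! i)}) =
      (\<Sum>i<length lam. min (int (lam ! i)) (int (Suc j))) - (\<Sum>i<length lam. min (int (lam ! i)) (int j))"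
      for lam :: "nat list"
      using prefix_conjugate[of "length lam" "\<lambda>i. int (lam ! i)" "Suc j"]
        prefix_conjugate[of "length lam" "\<lambda>i. int (lam ! i)" j] by simp
    then have "int (card {i. i < length kap \<and> int j < int (kap ! i)}) =
      int (card {i. i < length nu \<and> int j < int (nu ! i)})"
      using eq[of j] eq[of "Suc j"] True by simp
    then show ?thesis by simp
  next
    case False
    have e: "{i. i < length lam \<and> int j < int (lam ! i)} = {}" if "sum_list lam = n" for lam
      using False that elem_le_sum_list[of _ lam] by fastforce
    show ?thesis unfolding e[OF kap(2)] e[OF nu(2)] ..
  qed
  show "young kap = young nu"
    using col[OF kap(1)] col[OF nu(1)] card_eq by (intro set_eqI) (metis surj_pair)
qed

lemma finite_partitions: "finite {nu. is_partition nu \<and> sum_list nu = n}"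
proof (rule finite_subset)
  show "{nu. is_partition nu \<and> sum_list nu = n} \<subseteq> {xs. set xs \<subseteq> {..n} \<and> length xs \<le> n}"
  proof clarify
    fix nu assume nu: "is_partition nu" and n: "n = sum_list nu"
    have "(\<Sum>i<length nu. 1) \<le> (\<Sum>i<length nu. nu ! i)"
      using is_partition_nth_pos[OF nu] by (intro sum_mono) (auto simp: Suc_le_eq)
    then have "length nu \<le> sum_list nu" by (simp add: sum_list_sum_nth atLeast0LessThan)
    then show "set nu \<subseteq> {..sum_list nu} \<and> length nu \<le> sum_list nu"
      using member_le_sum_list by fastforce
  qed
qed (rule finite_lists_length_le, simp)

lemma parts_to_partition:
  assumes "parts l a"
  shows "is_partition (map (\<lambda>i. nat (a i)) [0..<l])"
    and "int (sum_list (map (\<lambda>i. nat (a i)) [0..<l])) = (\<Sum>i<l. a i)"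
proof -
  show "is_partition (map (\<lambda>i. nat (a i)) [0..<l])"
    using assms by (intro is_partitionI) (auto simp: parts_def decreasing_def nat_mono)
  have "(\<Sum>i<l. int (nat (a i))) = (\<Sum>i<l. a i)"
    using assms by (intro sum.cong) (auto simp: parts_def less_imp_le)
  then show "int (sum_list (map (\<lambda>i. nat (a i)) [0..<l])) = (\<Sum>i<l. a i)"
    by (simp add: sum_list_sum_nth atLeast0LessThan)
qed

text \<open>The difference of the two sides is a class function orthogonal to all irreducible
  characters, hence zero. The factor \<open>fact n\<close> keeps the coefficients integral.\<close>

lemma class_function_expansion:
  assumes \<phi>: "class_function {1..n} \<phi>" and t: "t permutes {1..n}"
  shows "fact n * \<phi> t = (\<Sum>nu | is_partition nu \<and> sum_list nu = n.
    (\<Sum>\<sigma> | \<sigma> permutes {1..n}. irr_char nu \<sigma> * \<phi> \<sigma>) * irr_char nu t)"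
proof -
  let ?X = "{1..n}" and ?Par = "{nu. is_partition nu \<and> sum_list nu = n}"
  define c where "c nu = (\<Sum>\<sigma> | \<sigma> permutes ?X. irr_char nu \<sigma> * \<phi> \<sigma>)" for nu
  define \<psi> where "\<psi> \<sigma> = fact n * \<phi> \<sigma> - (\<Sum>nu\<in>?Par. c nu * irr_char nu \<sigma>)" for \<sigma>
  have cf: "class_function ?X (irr_char nu)" if "nu \<in> ?Par" for nu
    using class_function_chi[of ?X "length nu" "\<lambda>i. int (nu ! i)"] that
    unfolding class_function_def irr_char_eq_chi by simp
  have cf_psi: "class_function ?X \<psi>"
    unfolding class_function_def \<psi>_def
  proof (intro allI impI arg_cong2[where f = "(-)"] arg_cong2[where f = "(*)"] sum.cong refl)
    fix s g assume sg: "s permutes ?X" "g permutes ?X"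
    show "\<phi> (g \<circ> s \<circ> inv g) = \<phi> s" using \<phi> sg by (simp add: class_function_def)
    fix nu assume "nu \<in> ?Par"
    then show "irr_char nu (g \<circ> s \<circ> inv g) = irr_char nu s" using cf sg by (simp add: class_function_def)
  qed
  have orth: "(\<Sum>\<sigma> | \<sigma> permutes ?X. chi ?X l a \<sigma> * \<psi> \<sigma>) = 0"
    if pa: "parts l a" and sa: "(\<Sum>i<l. a i) = int (card ?X)" for l a
  proof -
    define kap where "kap = map (\<lambda>i. nat (a i)) [0..<l]"
    have kap: "is_partition kap" "sum_list kap = n"
      using parts_to_partition[OF pa] sa by (simp_all add: kap_def)
    have chi_kap: "chi ?X l a \<sigma> = irr_char kap \<sigma>" if "\<sigma> permutes ?X" for \<sigma>
    proof -
      have len: "length kap = l" by (simp add: kap_def)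
      show ?thesis unfolding irr_char_eq_chi kap(2) len
        by (rule chi_cong[OF that]) (use pa in \<open>auto simp: kap_def parts_def\<close>)
    qed
    have "(\<Sum>\<sigma> | \<sigma> permutes ?X. chi ?X l a \<sigma> * \<psi> \<sigma>) =
      (\<Sum>\<sigma> | \<sigma> permutes ?X. fact n * (irr_char kap \<sigma> * \<phi> \<sigma>) -
         (\<Sum>nu\<in>?Par. c nu * (irr_char kap \<sigma> * irr_char nu \<sigma>)))"
    proof (rule sum.cong[OF refl])
      fix \<sigma> assume "\<sigma> \<in> {\<sigma>. \<sigma> permutes ?X}"
      then have e: "chi ?X l a \<sigma> = irr_char kap \<sigma>" using chi_kap by blast
      show "chi ?X l a \<sigma> * \<psi> \<sigma> = fact n * (irr_char kap \<sigma> * \<phi> \<sigma>) -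
         (\<Sum>nu\<in>?Par. c nu * (irr_char kap \<sigma> * irr_char nu \<sigma>))"
        unfolding e \<psi>_def by (simp add: right_diff_distrib sum_distrib_left mult.left_commute)
    qed
    also have "\<dots> = fact n * c kap - (\<Sum>\<sigma> | \<sigma> permutes ?X. \<Sum>nu\<in>?Par. c nu * (irr_char kap \<sigma> * irr_char nu \<sigma>))"
      by (simp add: sum_subtractf sum_distrib_left c_def)
    also have "(\<Sum>\<sigma> | \<sigma> permutes ?X. \<Sum>nu\<in>?Par. c nu * (irr_char kap \<sigma> * irr_char nu \<sigma>)) =
      (\<Sum>nu\<in>?Par. c nu * (\<Sum>\<sigma> | \<sigma> permutes ?X. irr_char kap \<sigma> * irr_char nu \<sigma>))"
      unfolding sum_distrib_left by (rule sum.swap)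
    also have "\<dots> = (\<Sum>nu\<in>?Par. if nu = kap then c kap * fact n else 0)"
    proof (rule sum.cong[OF refl])
      fix nu assume "nu \<in> ?Par"
      then have nu: "is_partition nu" "sum_list nu = n" by simp_all
      show "c nu * (\<Sum>\<sigma> | \<sigma> permutes ?X. irr_char kap \<sigma> * irr_char nu \<sigma>) =
          (if nu = kap then c kap * fact n else 0)"
        unfolding irr_char_orthonormal[OF kap nu] by simp
    qed
    also have "\<dots> = c kap * fact n" using kap finite_partitions[of n] by (simp add: sum.delta)
    finally show ?thesis by simp
  qed
  have "\<psi> t = 0"
    by (rule class_function_zero_chi[OF finite_atLeastAtMost cf_psi orth t])
  then show ?thesis by (simp add: \<psi>_def c_def)
qed

text \<open>A shape \<open>nu\<close> with nonzero coefficient in the Young function is dominated by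
  \<open>lam\<close> (\<open>dom1\<close>, from psi), and its conjugate is dominated by that of
  \<open>lam\<close> (\<open>dom2\<close>, from sgn psi). Only \<open>lam\<close> itself
  survives.\<close>

theorem irr_char_young_function:
  assumes lam: "is_partition lam" "sum_list lam = n" and t: "t permutes {1..n}"
  shows "young_function {1..n} (young lam) t * int (f_shape lam) = fact n * irr_char lam t"
proof -
  let ?X = "{1..n}" and ?Par = "{nu. is_partition nu \<and> sum_list nu = n}"
  let ?Y = "young_function ?X (young lam)"
  define c where "c nu = (\<Sum>\<sigma> | \<sigma> permutes ?X. irr_char nu \<sigma> * ?Y \<sigma>)" for nu
  define K where "K nu j = (\<Sum>i<length nu. min (int (nu ! i)) (int j))" for nu :: "nat list" and j
  have tot: "(\<Sum>i<length nu. int (nu ! i)) = int (card ?X)" if "nu \<in> ?Par" for nu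
    using that by (simp add: sum_parts)
  have cf: "class_function ?X ?Y" by (rule class_function_young) simp
  have exp: "fact n * ?Y s = (\<Sum>nu\<in>?Par. c nu * irr_char nu s)" if "s permutes ?X" for s
    unfolding c_def by (rule class_function_expansion[OF cf that])
  have dom1: "(\<Sum>i<j. int (nu ! i)) \<le> (\<Sum>i<min j (length lam). int (lam ! i))"
    if nu: "nu \<in> ?Par" and nz: "c nu \<noteq> 0" and j: "j \<le> length nu" for nu j
  proof -
    have sn: "sum_list nu = n" using nu by simp
    have "c nu = alternant (length nu) (\<lambda>a. \<Sum>\<sigma> | \<sigma> permutes ?X. psi ?X (length nu) a \<sigma> * ?Y \<sigma>) (\<lambda>i. int (nu ! i))"
      unfolding c_def irr_char_eq_chi sn by (rule sum_chi_mult)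
    then obtain w where w: "w permutes {..<length nu}"
      "(\<Sum>\<sigma> | \<sigma> permutes ?X. psi ?X (length nu) (\<lambda>i. int (nu ! i) - int i + int (w i)) \<sigma> * ?Y \<sigma>) \<noteq> 0"
      using nz unfolding alternant_def
      by (metis (no_types, lifting) mem_Collect_eq mult_zero_right sum.not_neutral_contains_not_neutral)
    have "(\<Sum>i<j. int (nu ! i)) \<le> (\<Sum>i<j. int (nu ! i) - int i + int (w i))"
      by (rule prefix_shift_ge[OF w(1)])
    also have "\<dots> \<le> (\<Sum>i<min j (length lam). int (lam ! i))"
      by (rule young_function_psi_dominance[OF _ lam(1) _ j]) (use w(2) in \<open>simp_all add: mult.commute\<close>)
    finally show ?thesis .
  qed
  have dom2: "K nu j \<le> K lam j" if nu: "nu \<in> ?Par" and nz: "c nu \<noteq> 0" and j: "j \<le> n" for nu j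
  proof -
    \<comment> \<open>A sgn psi inner product may mix the coefficients of several shapes. A shape
      \<open>kap\<close> maximal in the conjugate order among those above \<open>nu\<close> isolates
      a single one; the sum \<open>M\<close> of all column prefix sums turns this partial order into
      a maximum.\<close>
    define M where "M kap = (\<Sum>j\<le>n. K kap j)" for kap
    let ?S = "{kap\<in>?Par. c kap \<noteq> 0 \<and> (\<forall>j\<le>n. K nu j \<le> K kap j)}"
    have finS: "finite ?S" by (rule finite_subset[OF _ finite_partitions[of n]]) auto
    have "nu \<in> ?S" using nu nz by simp
    then have "Max (M ` ?S) \<in> M ` ?S" using finS by (intro Max_in) auto
    then obtain kap where kap: "kap \<in> ?S" and "M kap = Max (M ` ?S)" by auto
    then have mx: "M kap2 \<le> M kap" if "kap2 \<in> ?S" for kap2 using finS that by simp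
    \<comment> \<open>The conjugate of \<open>kap\<close>, continued by zeros: the weight whose 0-1
      Kostka number with \<open>kap\<close> is 1.\<close>
    define b where "b j = int (card {i. i < length kap \<and> int j < int (kap ! i)})" for j
    have bK: "(\<Sum>i<j. b i) = K kap j" for j
      unfolding b_def K_def by (rule prefix_conjugate) simp
    have kos: "kostka {0, 1} (length kap2) n b (\<lambda>i. int (kap2 ! i)) * c kap2 = (if kap2 = kap then c kap else 0)"
      if k2: "kap2 \<in> ?Par" for kap2
    proof (cases "kap2 = kap")
      case True
      have "kostka {0, 1} (length kap) n b (\<lambda>i. int (kap ! i)) = 1"
        unfolding b_def
      proof (rule kostka_vertical_diag)
        show "decreasing (length kap) (\<lambda>i. int (kap ! i))"
          using parts_of_partition[of kap] kap by (simp add: parts_def)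
        show "int (kap ! i) \<le> int n" if "i < length kap" for i
          using elem_le_sum_list[OF that] kap by auto
      qed simp
      then show ?thesis using True by simp
    next
      case False
      have "kostka {0, 1} (length kap2) n b (\<lambda>i. int (kap2 ! i)) * c kap2 = 0"
      proof (rule ccontr)
        assume nz2: "\<not> ?thesis"
        have "decreasing (length kap2) (\<lambda>i. int (kap2 ! i))"
          using parts_of_partition[of kap2] k2 by (simp add: parts_def)
        then have ge: "K kap j \<le> K kap2 j" if "j \<le> n" for j
          using kostka_vertical_dominance[of "length kap2" "\<lambda>i. int (kap2 ! i)" n b] nz2 that bK
          by (simp add: K_def)
        then have "kap2 \<in> ?S" using kap k2 nz2 by force
        then have "M kap2 \<le> M kap" by (rule mx)
        have Keq: "K kap2 j = K kap j" if "j \<le> n" for j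
        proof (rule ccontr)
          assume "K kap2 j \<noteq> K kap j"
          then have "K kap j < K kap2 j" using ge[OF that] by simp
          then have "M kap < M kap2" unfolding M_def
            using ge that by (intro sum_strict_mono_ex1) auto
          then show False using \<open>M kap2 \<le> M kap\<close> by simp
        qed
        have "kap2 = kap"
          using Keq k2 kap by (intro conjugate_sums_inj[of kap2 n kap]) (auto simp: K_def)
        then show False using False by simp
      qed
      then show ?thesis using False by simp
    qed
    have "fact n * (\<Sum>\<sigma> | \<sigma> permutes ?X. ?Y \<sigma> * (sign \<sigma> * psi ?X n b \<sigma>)) =
       (\<Sum>\<sigma> | \<sigma> permutes ?X. \<Sum>kap2\<in>?Par. c kap2 * (irr_char kap2 \<sigma> * (sign \<sigma> * psi ?X n b \<sigma>)))"
      unfolding sum_distrib_left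
    proof (rule sum.cong[OF refl])
      fix \<sigma> assume "\<sigma> \<in> {\<sigma>. \<sigma> permutes ?X}"
      then have "fact n * ?Y \<sigma> = (\<Sum>nu\<in>?Par. c nu * irr_char nu \<sigma>)" using exp by simp
      then have "fact n * (?Y \<sigma> * (sign \<sigma> * psi ?X n b \<sigma>)) = (\<Sum>nu\<in>?Par. c nu * irr_char nu \<sigma>) * (sign \<sigma> * psi ?X n b \<sigma>)"
        by (simp only: mult.assoc[symmetric])
      then show "fact n * (?Y \<sigma> * (sign \<sigma> * psi ?X n b \<sigma>)) =
          (\<Sum>kap2\<in>?Par. c kap2 * (irr_char kap2 \<sigma> * (sign \<sigma> * psi ?X n b \<sigma>)))"
        by (simp only: sum_distrib_right mult.assoc)
    qed
    also have "\<dots> = (\<Sum>kap2\<in>?Par. c kap2 * (\<Sum>\<sigma> | \<sigma> permutes ?X. irr_char kap2 \<sigma> * (sign \<sigma> * psi ?X n b \<sigma>)))"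
      unfolding sum_distrib_left by (rule sum.swap)
    also have "\<dots> = (\<Sum>kap2\<in>?Par. if kap2 = kap then fact n * c kap else 0)"
    proof (rule sum.cong[OF refl])
      fix kap2 assume k2: "kap2 \<in> ?Par"
      then have s2: "sum_list kap2 = n" by simp
      have "(\<Sum>\<sigma> | \<sigma> permutes ?X. irr_char kap2 \<sigma> * (sign \<sigma> * psi ?X n b \<sigma>)) =
          fact n * kostka {0, 1} (length kap2) n b (\<lambda>i. int (kap2 ! i))"
        using chi_sign_psi_inner_product[OF _ tot[OF k2], of n b] unfolding irr_char_eq_chi s2 by simp
      then show "c kap2 * (\<Sum>\<sigma> | \<sigma> permutes ?X. irr_char kap2 \<sigma> * (sign \<sigma> * psi ?X n b \<sigma>)) =
          (if kap2 = kap then fact n * c kap else 0)"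
        using kos[OF k2] by (simp add: mult_ac split: if_splits)
    qed
    also have "\<dots> = fact n * c kap" using kap finite_partitions[of n] by (simp add: sum.delta)
    finally have "(\<Sum>\<sigma> | \<sigma> permutes ?X. ?Y \<sigma> * (sign \<sigma> * psi ?X n b \<sigma>)) \<noteq> 0" using kap by auto
    from young_function_sign_psi_dominance[OF _ this j] have "K kap j \<le> K lam j"
      unfolding bK by (simp add: K_def)
    moreover have "K nu j \<le> K kap j" using kap j by simp
    ultimately show ?thesis by simp
  qed
  have c0: "c nu = 0" if nu: "nu \<in> ?Par" and ne: "nu \<noteq> lam" for nu
  proof (rule ccontr)
    assume nz: "c nu \<noteq> 0"
    have "lam = nu"
      by (rule dominance_antisym_conjugate[OF lam])
        (use nu dom1[OF nu nz] dom2[OF nu nz] in \<open>auto simp: K_def\<close>)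
    then show False using ne by simp
  qed
  have single: "fact n * ?Y s = c lam * irr_char lam s" if "s permutes ?X" for s
  proof -
    have "fact n * ?Y s = (\<Sum>nu\<in>?Par. if nu = lam then c lam * irr_char lam s else 0)"
      unfolding exp[OF that] by (rule sum.cong) (use c0 in auto)
    also have "\<dots> = c lam * irr_char lam s" using lam finite_partitions[of n] by (simp add: sum.delta)
    finally show ?thesis .
  qed
  \<comment> \<open>Comparison at the identity gives
    \<open>c lam * f_shape lam = fact n * fact n\<close>, which eliminates the coefficient.\<close>
  have "?Y id = fact n" using young_function_id[of ?X "young lam"] lam by (simp add: card_young)
  then have "fact n * fact n = c lam * int (f_shape lam)"
    using single[OF permutes_id] by (simp add: irr_char_id[OF lam(1)])
  then have "fact n * (?Y t * int (f_shape lam)) = fact n * (fact n * irr_char lam t)"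
    using single[OF t] by (metis (no_types, lifting) mult.assoc mult.commute)
  then show ?thesis by simp
qed

section \<open>A uniform bound for normalised characters\<close>

text \<open>An extension is a filling of the remaining boxes by the remaining entries.\<close>

lemma card_fillings_extending:
  assumes X: "finite X" and Y: "finite Y" and eq: "card X = card Y" and S: "S \<subseteq> X"
  shows "card {T \<in> fillings X Y. restrict T S = f} \<le> fact (card X - card S)"
proof (cases "\<exists>T0 \<in> fillings X Y. restrict T0 S = f")
  case False
  then have e: "{T \<in> fillings X Y. restrict T S = f} = {}" by blast
  show ?thesis unfolding e by simp
next
  case True
  then obtain T0 where T0: "T0 \<in> fillings X Y" "restrict T0 S = f" by blast
  let ?A = "{T \<in> fillings X Y. restrict T S = f}"
  let ?Y' = "Y - T0 ` S"
  have fS: "finite S" using S X by (rule finite_subset)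
  have sub: "T0 ` S \<subseteq> Y" using filling_mem[OF T0(1)] S by auto
  have "card (T0 ` S) = card S"
    by (rule card_image) (rule inj_on_subset[OF filling_inj[OF X T0(1)] S])
  then have cY: "card ?Y' = card X - card S"
    using sub fS eq by (simp add: card_Diff_subset)
  have cX: "card (X - S) = card X - card S" using fS S by (simp add: card_Diff_subset)
  have onS: "T x = T0 x" if "T \<in> ?A" "x \<in> S" for T x
    using that T0(2) by (metis (mono_tags, lifting) mem_Collect_eq restrict_apply')
  have "restrict T (X - S) \<in> fillings (X - S) ?Y'" if T: "T \<in> ?A" for T
  proof -
    have Tf: "T \<in> fillings X Y" using T by simp
    have inj: "inj_on T X" by (rule filling_inj[OF X Tf])
    have ne: "T x \<noteq> T0 y" if "x \<in> X - S" "y \<in> S" for x y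
    proof
      assume "T x = T0 y"
      then have "T x = T y" using onS[OF T that(2)] by simp
      then have "x = y" using inj that S by (auto dest: inj_onD)
      then show False using that by simp
    qed
    have "card {x\<in>X - S. restrict T (X - S) x = k} = 1" if k: "k \<in> ?Y'" for k
    proof -
      have "{x\<in>X - S. restrict T (X - S) x = k} = {x\<in>X. T x = k}"
        using k onS[OF T] by auto
      then show ?thesis using Tf k by (simp add: fillings_def type_colorings_def)
    qed
    moreover have "restrict T (X - S) \<in> (X - S) \<rightarrow>\<^sub>E ?Y'"
      using ne filling_mem[OF Tf] by (auto simp: PiE_def Pi_def)
    ultimately show ?thesis by (simp add: fillings_def type_colorings_def)
  qed
  then have img: "(\<lambda>T. restrict T (X - S)) ` ?A \<subseteq> fillings (X - S) ?Y'" by blast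
  have inj: "inj_on (\<lambda>T. restrict T (X - S)) ?A"
  proof (rule inj_onI)
    fix T U assume T: "T \<in> ?A" and U: "U \<in> ?A" and e: "restrict T (X - S) = restrict U (X - S)"
    show "T = U"
    proof
      fix x
      consider "x \<in> S" | "x \<in> X - S" | "x \<notin> X" by blast
      then show "T x = U x"
      proof cases
        case 1 then show ?thesis using onS[OF T 1] onS[OF U 1] by simp
      next
        case 2 then show ?thesis using fun_cong[OF e, of x] by simp
      next
        case 3 then show ?thesis
          using T U by (auto simp: fillings_def type_colorings_def PiE_def extensional_def)
      qed
    qed
  qed
  have "finite (fillings (X - S) ?Y')" using X Y by (intro finite_fillings) auto
  from card_inj_on_le[OF inj img this]
  have "card ?A \<le> card (fillings (X - S) ?Y')" .
  moreover have "finite (X - S)" "finite ?Y'" "card (X - S) = card ?Y'"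
    using X Y cX cY by simp_all
  then have "card (fillings (X - S) ?Y') = fact (card (X - S))" by (rule card_fillings)
  ultimately show ?thesis unfolding cX by (simp only:)
qed

text \<open>The row factor p determines the column factor \<sigma> p^(-1), and by
  \<open>row_col_fixed\<close> it fixes every point that \<open>\<sigma>\<close> fixes. So the
  factorisations are indexed by permutations of the support only.\<close>

lemma abs_young_function_le:
  assumes X: "finite X" and Y: "finite Y" and \<sigma>: "\<sigma> permutes X" and S: "S = {x. \<sigma> x \<noteq> x}"
  shows "\<bar>young_function X Y \<sigma>\<bar> \<le> (\<Sum>p | p permutes S.
    int (card {T \<in> fillings X Y. p \<in> row_stab X T \<and> \<sigma> \<circ> inv p \<in> col_stab X T}))"
proof -
  have SX: "S \<subseteq> X" using \<sigma> permutes_not_in unfolding S by fastforce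
  have fS: "finite S" using SX X by (rule finite_subset)
  let ?P = "{p. p permutes S}"
  have fP: "finite ?P" using fS by (rule finite_permutations)
  have ff: "finite (fillings X Y)" using X Y by (rule finite_fillings)
  have symm: "\<bar>symmetrizer X T \<sigma>\<bar> \<le>
      (\<Sum>p\<in>?P. if p \<in> row_stab X T \<and> \<sigma> \<circ> inv p \<in> col_stab X T then 1 else 0)"
    if T: "T \<in> fillings X Y" for T
  proof -
    have inj: "inj_on T X" by (rule filling_inj[OF X T])
    have "\<bar>symmetrizer X T \<sigma>\<bar> \<le> (\<Sum>q\<in>col_stab X T. \<bar>\<Sum>p\<in>row_stab X T. if q \<circ> p = \<sigma> then sign q else 0\<bar>)"
      unfolding symmetrizer_def by (rule sum_abs)
    also have "\<dots> \<le> (\<Sum>q\<in>col_stab X T. \<Sum>p\<in>row_stab X T. \<bar>if q \<circ> p = \<sigma> then sign q else 0\<bar>)"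
      by (rule sum_mono) (rule sum_abs)
    also have "\<dots> = (\<Sum>q\<in>col_stab X T. \<Sum>p\<in>row_stab X T. if q \<circ> p = \<sigma> then 1 else 0)"
      by (intro sum.cong refl) simp
    also have "\<dots> = (\<Sum>p\<in>row_stab X T. \<Sum>q\<in>col_stab X T. if q \<circ> p = \<sigma> then 1 else 0)"
      by (rule sum.swap)
    also have "\<dots> = (\<Sum>p\<in>row_stab X T. if \<sigma> \<circ> inv p \<in> col_stab X T then 1 else 0)"
    proof (rule sum.cong[OF refl])
      fix p assume "p \<in> row_stab X T"
      then have p: "p permutes X" by (simp add: row_stab_def stab_def)
      have "q \<circ> p = \<sigma> \<longleftrightarrow> q = \<sigma> \<circ> inv p" for q
        using permutes_inv_o[OF p] by (metis comp_assoc comp_id)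
      then show "(\<Sum>q\<in>col_stab X T. if q \<circ> p = \<sigma> then 1 else 0) =
          (if \<sigma> \<circ> inv p \<in> col_stab X T then 1 else (0::int))"
        using finite_col_stab[OF X, of T] by (simp add: sum.delta)
    qed
    also have "\<dots> \<le> (\<Sum>p\<in>?P. if p \<in> row_stab X T \<and> \<sigma> \<circ> inv p \<in> col_stab X T then 1 else 0)"
    proof -
      let ?R = "{p\<in>row_stab X T. \<sigma> \<circ> inv p \<in> col_stab X T}"
      have "?R \<subseteq> ?P"
      proof
        fix p assume p: "p \<in> ?R"
        then have pX: "p permutes X" by (simp add: row_stab_def stab_def)
        have "p x = x" if "x \<in> X - S" for x
        proof (rule row_col_fixed[OF inj])
          show "\<sigma> \<circ> inv p \<in> col_stab X T" "p \<in> row_stab X T" using p by auto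
          show "(\<sigma> \<circ> inv p) (p x) = x" using that permutes_inverses(2)[OF pX] by (simp add: S)
        qed
        then show "p \<in> ?P" using permutes_superset[OF pX, of S] by blast
      qed
      then have "(\<Sum>p\<in>?R. 1) \<le> (\<Sum>p\<in>{p\<in>?P. p \<in> row_stab X T \<and> \<sigma> \<circ> inv p \<in> col_stab X T}. 1::int)"
        using fP by (intro sum_mono2) auto
      moreover have "(\<Sum>p\<in>row_stab X T. if \<sigma> \<circ> inv p \<in> col_stab X T then 1 else 0) = (\<Sum>p\<in>?R. 1::int)"
        by (rule sum.inter_filter[symmetric]) (rule finite_row_stab[OF X])
      moreover have "(\<Sum>p\<in>?P. if p \<in> row_stab X T \<and> \<sigma> \<circ> inv p \<in> col_stab X T then 1 else 0) =
          (\<Sum>p\<in>{p\<in>?P. p \<in> row_stab X T \<and> \<sigma> \<circ> inv p \<in> col_stab X T}. 1::int)"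
        by (rule sum.inter_filter[symmetric, OF fP])
      ultimately show ?thesis by simp
    qed
    finally show ?thesis .
  qed
  have "\<bar>young_function X Y \<sigma>\<bar> \<le> (\<Sum>T\<in>fillings X Y. \<bar>symmetrizer X T \<sigma>\<bar>)"
    unfolding young_function_def by (rule sum_abs)
  also have "\<dots> \<le> (\<Sum>T\<in>fillings X Y. \<Sum>p\<in>?P. if p \<in> row_stab X T \<and> \<sigma> \<circ> inv p \<in> col_stab X T then 1 else 0)"
    by (rule sum_mono) (rule symm)
  also have "\<dots> = (\<Sum>p\<in>?P. \<Sum>T\<in>fillings X Y. if p \<in> row_stab X T \<and> \<sigma> \<circ> inv p \<in> col_stab X T then 1 else 0)"
    by (rule sum.swap)
  also have "\<dots> = (\<Sum>p\<in>?P. \<Sum>T\<in>{T \<in> fillings X Y. p \<in> row_stab X T \<and> \<sigma> \<circ> inv p \<in> col_stab X T}. 1)"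
    by (intro sum.cong refl sum.inter_filter[symmetric, OF ff])
  finally show ?thesis by simp
qed

text \<open>With n = \<open>card X\<close>, a matched pair of cycles has n choices, that is sqrt n
  per cycle; an unmatched cycle has at most a = sqrt n * (a / sqrt n). At most
  \<open>ellT \<sigma>\<close> cycles are unmatched, and the exponent may be raised to this number
  because n \<le> a^2.\<close>

lemma card_compatible_fillings_le:
  assumes X: "finite X" and Y: "finite Y" and eq: "card X = card Y" and SX: "S \<subseteq> X"
    and p: "p permutes S" and \<sigma>: "\<sigma> permutes S"
    and a: "real (card (fst ` Y)) \<le> a" "real (card (snd ` Y)) \<le> a" "real (card X) \<le> a\<^sup>2" "0 < a"
    and n: "0 < card X"
  shows "real (card {T \<in> fillings X Y. p \<in> row_stab X T \<and> \<sigma> \<circ> inv p \<in> col_stab X T}) \<le>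
    fact (card X - card S) * (sqrt (card X) ^ (cyc S p + cyc S (\<sigma> \<circ> inv p)) * (a / sqrt (card X)) ^ ellT \<sigma>)"
proof -
  let ?q = "\<sigma> \<circ> inv p" and ?n = "card X"
  let ?A = "{T \<in> fillings X Y. p \<in> row_stab X T \<and> ?q \<in> col_stab X T}"
  let ?F = "{f \<in> S \<rightarrow>\<^sub>E Y. \<forall>x\<in>S. fst (f (p x)) = fst (f x) \<and> snd (f (?q x)) = snd (f x)}"
  have fS: "finite S" using SX X by (rule finite_subset)
  have p': "inv p permutes S" using p by (rule permutes_inv)
  have q: "?q permutes S" using p' \<sigma> by (rule permutes_compose)
  have pp: "permutation p" using permutes_imp_permutation[OF fS p] .
  have finA: "finite ?A" using finite_fillings[OF X Y] by simp
  have finF: "finite ?F" using fS Y by (intro finite_subset[OF _ finite_PiE[of S "\<lambda>_. Y"]]) auto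
  have "card ?A = (\<Sum>f\<in>?F. card {T\<in>?A. restrict T S = f})"
  proof -
    have img: "(\<lambda>T. restrict T S) ` ?A \<subseteq> ?F"
    proof (intro image_subsetI)
      fix T assume T: "T \<in> ?A"
      then have "T x \<in> Y" if "x \<in> S" for x using filling_mem[of T X Y x] SX that by auto
      then show "restrict T S \<in> ?F"
        using T SX permutes_in_image[OF p] permutes_in_image[OF q]
        by (auto simp: row_stab_def col_stab_def stab_def subset_iff)
    qed
    have "(\<Sum>f\<in>?F. \<Sum>T\<in>{T\<in>?A. restrict T S = f}. 1) = (\<Sum>T\<in>?A. 1::nat)"
      by (rule sum.group[OF finA finF img])
    then show ?thesis by simp
  qed
  also have "\<dots> \<le> (\<Sum>f\<in>?F. fact (?n - card S))"
  proof (rule sum_mono)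
    fix f
    have "card {T\<in>?A. restrict T S = f} \<le> card {T \<in> fillings X Y. restrict T S = f}"
      using finite_fillings[OF X Y] by (intro card_mono) auto
    also have "\<dots> \<le> fact (?n - card S)" by (rule card_fillings_extending[OF X Y eq SX])
    finally show "card {T\<in>?A. restrict T S = f} \<le> fact (?n - card S)" .
  qed
  finally have A_le: "card ?A \<le> card ?F * fact (?n - card S)" by simp
  obtain ts where ts: "set ts \<subseteq> S \<times> S" "apply_transps ts = \<sigma>" "length ts + cyc S \<sigma> = card S"
    using exists_transps_cyc[OF fS \<sigma>] by blast
  have len: "length ts = ellT \<sigma>" using ts(3) ellT_plus_cyc[OF fS \<sigma>] by simp
  \<comment> \<open>Applied to p^(-1) and \<sigma> p^(-1), which differ by the factor
    \<open>\<sigma>\<close> on the left; p^(-1) has the cycles of p.\<close>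
  obtain R where R: "R \<subseteq> S" "inj_on (orbit (inv p)) R" "inj_on (orbit ?q) R"
    "cyc S (inv p) + cyc S ?q \<le> ellT \<sigma> + 2 * card R"
    using common_transversal[OF fS p' ts(1)] unfolding ts(2) len by blast
  have op: "orbit (inv p) = orbit p" using orbit_inv_eq[OF pp] by (simp add: fun_eq_iff)
  define c1 c2 r where "c1 = cyc S p" and "c2 = cyc S ?q" and "r = card R"
  have le: "c1 + c2 \<le> ellT \<sigma> + 2 * r"
    using R(4) cyc_inv[OF fS p] by (simp add: c1_def c2_def r_def)
  have rc: "r \<le> c1" "r \<le> c2"
    using card_image[OF R(2)] card_image[OF R(3)] R(1) fS
      card_mono[of "orbit p ` S" "orbit p ` R"] card_mono[of "orbit ?q ` S" "orbit ?q ` R"]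
    unfolding op by (auto simp: c1_def c2_def r_def cyc_def image_mono)
  have "card ?F \<le> card Y ^ r * card (fst ` Y) ^ (c1 - r) * card (snd ` Y) ^ (c2 - r)"
    unfolding c1_def c2_def r_def
    by (rule card_constrained_maps[OF fS p q R(1) _ R(3) Y]) (use R(2) op in simp)
  then have "real (card ?F) \<le> real (card Y) ^ r * real (card (fst ` Y)) ^ (c1 - r) * real (card (snd ` Y)) ^ (c2 - r)"
    by (metis (mono_tags, lifting) of_nat_le_iff of_nat_mult of_nat_power)
  also have "\<dots> \<le> real ?n ^ r * a ^ (c1 - r) * a ^ (c2 - r)"
    using a eq by (intro mult_mono power_mono) auto
  also have "\<dots> = sqrt ?n ^ (2 * r) * a ^ (c1 + c2 - 2 * r)"
  proof -
    have "(c1 - r) + (c2 - r) = c1 + c2 - 2 * r" using rc by simp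
    then have "a ^ (c1 - r) * a ^ (c2 - r) = a ^ (c1 + c2 - 2 * r)" by (metis power_add)
    then show ?thesis by (simp add: power_mult mult.assoc)
  qed
  also have "\<dots> = sqrt ?n ^ (c1 + c2) * (a / sqrt ?n) ^ (c1 + c2 - 2 * r)"
  proof -
    have "sqrt ?n ^ (c1 + c2) = sqrt ?n ^ (2 * r) * sqrt ?n ^ (c1 + c2 - 2 * r)"
      using rc by (simp flip: power_add)
    then show ?thesis using n by (simp add: power_divide)
  qed
  also have "\<dots> \<le> sqrt ?n ^ (c1 + c2) * (a / sqrt ?n) ^ ellT \<sigma>"
  proof (intro mult_left_mono power_increasing)
    show "c1 + c2 - 2 * r \<le> ellT \<sigma>" using le by simp
    have "sqrt ?n \<le> a" using a by (simp add: real_le_lsqrt)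
    then show "1 \<le> a / sqrt ?n" using n by simp
  qed simp
  finally have F_le: "real (card ?F) \<le> sqrt ?n ^ (c1 + c2) * (a / sqrt ?n) ^ ellT \<sigma>" .
  have "real (card ?A) \<le> real (card ?F) * fact (?n - card S)"
    using of_nat_mono[OF A_le, where 'a = real] by (simp only: of_nat_mult of_nat_fact)
  also have "\<dots> \<le> (sqrt ?n ^ (c1 + c2) * (a / sqrt ?n) ^ ellT \<sigma>) * fact (?n - card S)"
    using F_le by (intro mult_right_mono) auto
  also have "\<dots> = fact (?n - card S) * (sqrt ?n ^ (c1 + c2) * (a / sqrt ?n) ^ ellT \<sigma>)"
    by (rule mult.commute)
  finally show ?thesis unfolding c1_def c2_def .
qed

text \<open>Replacing \<open>sqrt n\<close> by \<open>sqrt m\<close> is harmless because \<open>ellT\<close> is subadditive; with weight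
  \<open>sqrt m\<close>, the arithmetic-geometric mean inequality decouples the two factors.\<close>

lemma sum_sqrt_pow_cyc_le:
  assumes S: "finite S" and m: "card S = m" "0 < m" "m \<le> n" and \<sigma>: "\<sigma> permutes S"
  shows "(\<Sum>p | p permutes S. sqrt n ^ (cyc S p + cyc S (\<sigma> \<circ> inv p))) \<le>
    (2 * real n) ^ m * (sqrt m / sqrt n) ^ ellT \<sigma>"
proof -
  let ?P = "{p. p permutes S}"
  define s u where "s = sqrt (real n)" and "u = sqrt (real m)"
  have su: "0 < u" "u \<le> s" "s\<^sup>2 = real n" "u\<^sup>2 = real m" using m by (simp_all add: s_def u_def)
  have each: "s ^ (cyc S p + cyc S (\<sigma> \<circ> inv p)) \<le>
      (s / u) ^ (2 * m - ellT \<sigma>) * ((real m ^ cyc S p + real m ^ cyc S (\<sigma> \<circ> inv p)) / 2)"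
    if p: "p permutes S" for p
  proof -
    let ?q = "\<sigma> \<circ> inv p"
    define c where "c = cyc S p + cyc S ?q"
    have q: "?q permutes S" using permutes_inv[OF p] \<sigma> by (rule permutes_compose)
    have "?q \<circ> p = \<sigma>" using permutes_inv_o[OF p] by (simp add: comp_assoc)
    then have "ellT \<sigma> \<le> ellT ?q + ellT p" using ellT_compose_le[OF S q p] by simp
    then have c: "c \<le> 2 * m - ellT \<sigma>" using ellT_plus_cyc[OF S p] ellT_plus_cyc[OF S q] m by (simp add: c_def)
    have "s ^ c = (s / u) ^ c * u ^ c" using su by (simp add: power_divide)
    also have "\<dots> \<le> (s / u) ^ (2 * m - ellT \<sigma>) * u ^ c"
      using su c by (intro mult_right_mono power_increasing) auto
    also have "u ^ c \<le> (real m ^ cyc S p + real m ^ cyc S ?q) / 2"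
    proof -
      have "0 \<le> (u ^ cyc S p - u ^ cyc S ?q)\<^sup>2" by simp
      also have "\<dots> = (u\<^sup>2) ^ cyc S p + (u\<^sup>2) ^ cyc S ?q - 2 * u ^ c"
        by (simp add: c_def power2_diff power_add flip: power_mult) (simp add: mult.commute)
      finally show ?thesis using su by simp
    qed
    finally show ?thesis using su by (simp add: c_def mult_left_mono)
  qed
  \<comment> \<open>At weight m each of the m factors of the rising factorial is at most 2
    m.\<close>
  have sum1: "(\<Sum>p\<in>?P. real m ^ cyc S p) \<le> (2 * real m) ^ m"
  proof -
    have "(\<Sum>p\<in>?P. real m ^ cyc S p) = (\<Prod>j<m. real m + real j)" using sum_pow_cyc[OF S, of "real m"] m by simp
    also have "\<dots> \<le> (\<Prod>j<m. 2 * real m)" by (intro prod_mono) auto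
    finally show ?thesis by simp
  qed
  have sum2: "(\<Sum>p\<in>?P. real m ^ cyc S (\<sigma> \<circ> inv p)) = (\<Sum>p\<in>?P. real m ^ cyc S p)"
    using setum_permutations_compose_left[OF \<sigma>, of "\<lambda>p. real m ^ cyc S p"]
      sum_permutations_inverse[of "\<lambda>p. real m ^ cyc S (\<sigma> \<circ> p)" S] by simp
  have el: "ellT \<sigma> \<le> 2 * m" using ellT_plus_cyc[OF S \<sigma>] m by simp
  have "(\<Sum>p\<in>?P. s ^ (cyc S p + cyc S (\<sigma> \<circ> inv p))) \<le>
      (\<Sum>p\<in>?P. (s / u) ^ (2 * m - ellT \<sigma>) * ((real m ^ cyc S p + real m ^ cyc S (\<sigma> \<circ> inv p)) / 2))"
    by (rule sum_mono) (use each in auto)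
  also have "\<dots> = (s / u) ^ (2 * m - ellT \<sigma>) * (\<Sum>p\<in>?P. real m ^ cyc S p)"
    unfolding sum_distrib_left[symmetric] sum_divide_distrib[symmetric] sum.distrib sum2 by simp
  also have "\<dots> \<le> (s / u) ^ (2 * m - ellT \<sigma>) * (2 * real m) ^ m"
    using sum1 su by (intro mult_left_mono) auto
  also have "(s / u) ^ (2 * m - ellT \<sigma>) = (s / u) ^ (2 * m) * (u / s) ^ ellT \<sigma>"
  proof -
    have "(s / u) ^ (2 * m) = (s / u) ^ (2 * m - ellT \<sigma>) * (s / u) ^ ellT \<sigma>"
      using el by (simp flip: power_add)
    moreover have "(s / u) ^ ellT \<sigma> * (u / s) ^ ellT \<sigma> = 1"
      using su by (simp flip: power_mult_distrib)
    ultimately show ?thesis by simp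
  qed
  also have "(s / u) ^ (2 * m) = (real n / real m) ^ m"
    using su by (simp add: power_mult power_divide)
  also have "(real n / real m) ^ m * (u / s) ^ ellT \<sigma> * (2 * real m) ^ m = (2 * real n) ^ m * (u / s) ^ ellT \<sigma>"
    using m by (simp add: power_divide power_mult_distrib)
  finally show ?thesis unfolding s_def u_def .
qed

text \<open>m^m / m! is a single term of the series for exp m, and exp 1 \<le> 3.\<close>

lemma power_self_le_fact: "real m ^ m \<le> 3 ^ m * fact m"
proof -
  have "real m ^ m / fact m \<le> (\<Sum>k. real m ^ k / fact k)"
  proof -
    have "summable (\<lambda>k. real m ^ k / fact k)"
      using summable_exp[of "real m"] by (simp add: divide_inverse mult.commute)
    then have "(\<Sum>k\<in>{m}. real m ^ k / fact k) \<le> (\<Sum>k. real m ^ k / fact k)"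
      by (intro sum_le_suminf) auto
    then show ?thesis by simp
  qed
  also have "\<dots> = exp (real m)" by (simp add: exp_def divide_inverse mult.commute)
  also have "\<dots> = exp 1 ^ m" by (simp flip: exp_of_nat_mult)
  also have "\<dots> \<le> 3 ^ m" using exp_le by (intro power_mono) auto
  finally show ?thesis by (simp add: divide_le_eq)
qed

text \<open>The falling factorial n! / (n - m)! is at least (n / 3)^m, by the bound (n / m)^m for
  the binomial coefficient.\<close>

lemma power_fact_diff_le:
  assumes "m \<le> n" "0 < m"
  shows "real n ^ m * fact (n - m) \<le> 3 ^ m * fact n"
proof -
  have "(real n / real m) ^ m \<le> real (n choose m)"
    using binomial_ge_n_over_k_pow_k[OF assms(1), where 'a = real] by simp
  then have "real n ^ m \<le> real (n choose m) * real m ^ m"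
    using assms by (simp add: power_divide divide_le_eq)
  also have "\<dots> \<le> real (n choose m) * (3 ^ m * fact m)"
    by (intro mult_left_mono power_self_le_fact) auto
  finally have "real n ^ m * fact (n - m) \<le> real (n choose m) * (3 ^ m * fact m) * fact (n - m)"
    by (intro mult_right_mono) auto
  also have "\<dots> = 3 ^ m * fact n"
    using binomial_fact[OF assms(1), where 'a = real] by (simp add: field_simps)
  finally show ?thesis .
qed

lemma young_dimensions:
  assumes lam: "is_partition lam"
  shows "card (fst ` young lam) \<le> nrows lam" and "card (snd ` young lam) \<le> ncols lam"
    and "sum_list lam \<le> nrows lam * ncols lam"
proof -
  have le: "lam ! i \<le> ncols lam" if "i < length lam" for i
    using is_partition_nth_le[OF lam, of 0 i] that by (auto simp: ncols_def hd_conv_nth)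
  have f: "fst ` young lam \<subseteq> {..<nrows lam}" by (auto simp: young_def nrows_def)
  have s: "snd ` young lam \<subseteq> {..<ncols lam}" using le by (fastforce simp: young_def)
  show "card (fst ` young lam) \<le> nrows lam" using card_mono[OF _ f] by simp
  show "card (snd ` young lam) \<le> ncols lam" using card_mono[OF _ s] by simp
  have "sum_list lam = (\<Sum>i<length lam. lam ! i)" by (simp add: sum_list_sum_nth atLeast0LessThan)
  also have "\<dots> \<le> (\<Sum>i<length lam. ncols lam)" using le by (intro sum_mono) auto
  finally show "sum_list lam \<le> nrows lam * ncols lam" by (simp add: nrows_def)
qed

theorem normalised_character_bound:
  assumes lam: "is_partition lam" "sum_list lam = n"
    and a: "real (nrows lam) \<le> a" "real (ncols lam) \<le> a" "0 < a"
    and \<sigma>: "\<sigma> permutes {1..n}" and i: "0 < ellT \<sigma>"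
  shows "\<bar>real_of_int (irr_char lam \<sigma>) / real (f_shape lam)\<bar> \<le> (72 * a * sqrt (ellT \<sigma>) / n) ^ ellT \<sigma>"
proof -
  let ?X = "{1..n}" and ?Y = "young lam"
  define S where "S = {x. \<sigma> x \<noteq> x}"
  define m where "m = card S"
  define d where "d = ellT \<sigma>"
  have SX: "S \<subseteq> ?X" using \<sigma> permutes_not_in unfolding S_def by fastforce
  have fS: "finite S" using SX by (rule finite_subset) simp
  have \<sigma>S: "\<sigma> permutes S" by (rule permutes_superset[OF \<sigma>]) (auto simp: S_def)
  have mn: "m \<le> n" using card_mono[OF _ SX] by (simp add: m_def)
  have m2: "m \<le> 2 * d" using card_support_le_ellT[OF _ \<sigma>] by (simp add: m_def S_def d_def)
  have m0: "0 < m"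
  proof (rule ccontr)
    assume "\<not> 0 < m"
    then have "S = {}" using fS by (simp add: m_def)
    then have "\<sigma> = id" by (auto simp: S_def)
    then have "\<sigma> = apply_transps []" by simp
    then have "ellT \<sigma> \<le> 0" unfolding ellT_def by (intro Least_le exI[of _ "[]"]) simp
    then show False using i by simp
  qed
  then have n0: "0 < n" using mn by simp
  have cX: "card ?X = n" by simp
  have cY: "card ?X = card ?Y" using lam by (simp add: card_young)
  have af: "real (card (fst ` ?Y)) \<le> a" "real (card (snd ` ?Y)) \<le> a"
    using young_dimensions(1,2)[OF lam(1)] a by linarith+
  have "real n \<le> real (nrows lam) * real (ncols lam)"
    using young_dimensions(3)[OF lam(1)] lam(2) by (simp flip: of_nat_mult)
  also have "\<dots> \<le> a * a" using a by (intro mult_mono) auto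
  finally have an: "real (card ?X) \<le> a\<^sup>2" by (simp add: power2_eq_square)
  have Y_nz: "young_function ?X ?Y \<sigma> * int (f_shape lam) = fact n * irr_char lam \<sigma>"
    by (rule irr_char_young_function[OF lam \<sigma>])
  have "young_function ?X ?Y id * int (f_shape lam) = fact n * irr_char lam id"
    by (rule irr_char_young_function[OF lam permutes_id])
  \<comment> \<open>That tableaux exist is read off from a nonzero character value, which exists
    because the norm of the character is nonzero.\<close>
  have f0: "0 < f_shape lam"
  proof -
    have "young_function ?X ?Y id = fact n" using young_function_id[of ?X ?Y] cY by simp
    moreover have "(\<Sum>\<sigma> | \<sigma> permutes ?X. irr_char lam \<sigma> * irr_char lam \<sigma>) \<noteq> 0"
      using irr_char_orthonormal[OF lam lam] by simp
    then obtain t where t: "t permutes ?X" "irr_char lam t \<noteq> 0"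
      by (metis (no_types, lifting) mem_Collect_eq mult_zero_left sum.not_neutral_contains_not_neutral)
    then have "young_function ?X ?Y t * int (f_shape lam) \<noteq> 0"
      using irr_char_young_function[OF lam t(1)] by simp
    then show ?thesis by (metis gr0I mult_zero_right of_nat_0)
  qed
  have ratio: "real_of_int (irr_char lam \<sigma>) / real (f_shape lam) = real_of_int (young_function ?X ?Y \<sigma>) / fact n"
  proof -
    have "real_of_int (young_function ?X ?Y \<sigma> * int (f_shape lam)) = real_of_int (fact n * irr_char lam \<sigma>)"
      using Y_nz by simp
    then have "real_of_int (young_function ?X ?Y \<sigma>) * real (f_shape lam) = fact n * real_of_int (irr_char lam \<sigma>)"
      by simp
    then show ?thesis using f0 by (simp add: field_simps)
  qed
  have "\<bar>real_of_int (young_function ?X ?Y \<sigma>)\<bar> \<le> (\<Sum>p | p permutes S.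
    real (card {T \<in> fillings ?X ?Y. p \<in> row_stab ?X T \<and> \<sigma> \<circ> inv p \<in> col_stab ?X T}))"
  proof -
    have "\<bar>young_function ?X ?Y \<sigma>\<bar> \<le> (\<Sum>p | p permutes S.
      int (card {T \<in> fillings ?X ?Y. p \<in> row_stab ?X T \<and> \<sigma> \<circ> inv p \<in> col_stab ?X T}))"
      by (rule abs_young_function_le[OF _ _ \<sigma>]) (simp_all add: S_def)
    then have "real_of_int \<bar>young_function ?X ?Y \<sigma>\<bar> \<le> real_of_int (\<Sum>p | p permutes S.
      int (card {T \<in> fillings ?X ?Y. p \<in> row_stab ?X T \<and> \<sigma> \<circ> inv p \<in> col_stab ?X T}))"
      by (simp only: of_int_le_iff)
    then show ?thesis by (simp only: of_int_abs of_int_sum of_int_of_nat_eq)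
  qed
  also have "\<dots> \<le> (\<Sum>p | p permutes S. fact (n - m) *
      (sqrt n ^ (cyc S p + cyc S (\<sigma> \<circ> inv p)) * (a / sqrt n) ^ d))"
  proof (rule sum_mono)
    fix p assume "p \<in> {p. p permutes S}"
    then have p: "p permutes S" by simp
    show "real (card {T \<in> fillings ?X ?Y. p \<in> row_stab ?X T \<and> \<sigma> \<circ> inv p \<in> col_stab ?X T}) \<le>
       fact (n - m) * (sqrt n ^ (cyc S p + cyc S (\<sigma> \<circ> inv p)) * (a / sqrt n) ^ d)"
      using card_compatible_fillings_le[OF finite_atLeastAtMost finite_young cY SX p \<sigma>S af an a(3)] n0
      unfolding cX m_def d_def by blast
  qed
  also have "\<dots> = fact (n - m) * (a / sqrt n) ^ d * (\<Sum>p | p permutes S. sqrt n ^ (cyc S p + cyc S (\<sigma> \<circ> inv p)))"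
    by (simp add: sum_distrib_left mult_ac)
  also have "\<dots> \<le> fact (n - m) * (a / sqrt n) ^ d * ((2 * real n) ^ m * (sqrt m / sqrt n) ^ d)"
    unfolding d_def using a
    by (intro mult_left_mono sum_sqrt_pow_cyc_le[OF fS m_def[symmetric] m0 mn \<sigma>S]) auto
  also have "\<dots> = 2 ^ m * (real n ^ m * fact (n - m)) * (a * sqrt m / n) ^ d"
  proof -
    have "(a / sqrt n) ^ d * (sqrt m / sqrt n) ^ d = (a * sqrt m / n) ^ d"
      by (simp flip: power_mult_distrib)
    then show ?thesis by (simp add: power_mult_distrib mult_ac)
  qed
  also have "\<dots> \<le> 2 ^ m * (3 ^ m * fact n) * (a * sqrt m / n) ^ d"
    using a by (intro mult_right_mono mult_left_mono power_fact_diff_le[OF mn m0]) auto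
  also have "\<dots> = fact n * (6 ^ m * (a * sqrt m / n) ^ d)"
  proof -
    have "(2::real) ^ m * 3 ^ m = 6 ^ m" by (simp flip: power_mult_distrib)
    then show ?thesis by (simp add: mult_ac)
  qed
  \<comment> \<open>The base 6 = 2 * 3 collects the rising factorial and the factorial estimate; m
    \<le> 2 d turns 6^m into 36^d and sqrt m into at most 2 sqrt d, whence 72 = 36 * 2.\<close>
  also have "\<dots> \<le> fact n * (6 ^ (2 * d) * (a * (2 * sqrt d) / n) ^ d)"
  proof -
    have "sqrt m \<le> sqrt (4 * real d)" using m2 by (intro real_sqrt_le_mono) linarith
    then have "sqrt m \<le> 2 * sqrt d" by (simp add: real_sqrt_mult)
    then show ?thesis using a m2
      by (intro mult_left_mono mult_mono power_increasing power_mono divide_right_mono) auto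
  qed
  also have "(6::real) ^ (2 * d) * (a * (2 * sqrt d) / n) ^ d = (72 * a * sqrt d / n) ^ d"
  proof -
    have "(6::real) ^ (2 * d) = 36 ^ d" by (simp add: power_mult)
    then have "(6::real) ^ (2 * d) * (a * (2 * sqrt d) / n) ^ d = (36 * (a * (2 * sqrt d) / n)) ^ d"
      by (simp only: power_mult_distrib)
    also have "36 * (a * (2 * sqrt d) / n) = 72 * a * sqrt d / n" by simp
    finally show ?thesis .
  qed
  finally have "\<bar>real_of_int (young_function ?X ?Y \<sigma>)\<bar> \<le> fact n * (72 * a * sqrt d / n) ^ d" .
  then have "\<bar>real_of_int (young_function ?X ?Y \<sigma>)\<bar> / fact n \<le> (72 * a * sqrt d / n) ^ d"
    by (simp add: divide_le_eq mult.commute)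
  then show ?thesis unfolding ratio d_def by simp
qed

text \<open>A Chernoff bound: one coefficient of the rising factorial is estimated by the value of
  the whole polynomial at a suitable point. The factor i^i stays on the left to meet the two factors
  (sqrt i)^i from the character bounds.\<close>

lemma card_ellT_eq_le:
  assumes i: "0 < i"
  shows "real (card {\<sigma>. \<sigma> permutes {1..k} \<and> ellT \<sigma> = i}) * real i ^ i \<le> (3 * real k ^ 2) ^ i"
proof (cases "{\<sigma>. \<sigma> permutes {1..k} \<and> ellT \<sigma> = i} = {}")
  case True
  then show ?thesis by (simp only: card.empty) simp
next
  case False
  let ?X = "{1..k}" and ?E = "{\<sigma>. \<sigma> permutes {1..k} \<and> ellT \<sigma> = i}"
  have cyc: "cyc ?X \<sigma> = k - i \<and> i \<le> k" if "\<sigma> \<in> ?E" for \<sigma>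
    using ellT_plus_cyc[of ?X \<sigma>] that by auto
  have ik: "i \<le> k" using False cyc by blast
  then have k: "0 < k" using i by simp
  \<comment> \<open>This choice minimises N^i * exp (k^2 / N), the resulting bound for the number of
    permutations.\<close>
  define N where "N = real k ^ 2 / real i"
  have N: "0 < N" using k i by (simp add: N_def)
  have "real (card ?E) * N ^ (k - i) = (\<Sum>\<sigma>\<in>?E. N ^ cyc ?X \<sigma>)" using cyc by simp
  also have "\<dots> \<le> (\<Sum>\<sigma> | \<sigma> permutes ?X. N ^ cyc ?X \<sigma>)"
    using N by (intro sum_mono2 finite_permutations) auto
  also have "\<dots> = (\<Prod>j<k. N + real j)" by (subst sum_pow_cyc) auto
  also have "\<dots> \<le> (\<Prod>j<k. N * exp (real k / N))"
  proof (intro prod_mono conjI)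
    fix j assume j: "j \<in> {..<k}"
    show "0 \<le> N + real j" using N by simp
    have "N + real j \<le> N * (1 + real k / N)" using N j by (simp add: distrib_left)
    also have "\<dots> \<le> N * exp (real k / N)" using N by (intro mult_left_mono exp_ge_add_one_self) auto
    finally show "N + real j \<le> N * exp (real k / N)" .
  qed
  also have "\<dots> = N ^ k * exp (real k / N) ^ k" by (simp add: power_mult_distrib)
  also have "exp (real k / N) ^ k = exp (real i)"
    using k i by (simp add: N_def power2_eq_square flip: exp_of_nat_mult)
  also have "N ^ k = N ^ (k - i) * N ^ i" using ik by (simp flip: power_add)
  finally have "N ^ (k - i) * real (card ?E) \<le> N ^ (k - i) * (N ^ i * exp (real i))"
    by (simp add: mult_ac)
  then have "real (card ?E) \<le> N ^ i * exp (real i)" using N by (simp add: mult_le_cancel_left_pos)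
  also have "exp (real i) \<le> 3 ^ i"
  proof -
    have "exp (real i) = exp 1 ^ i" by (simp flip: exp_of_nat_mult)
    also have "\<dots> \<le> 3 ^ i" using exp_le by (intro power_mono) auto
    finally show ?thesis .
  qed
  finally have "real (card ?E) \<le> N ^ i * 3 ^ i" using N by (simp add: mult_left_mono)
  then have "real (card ?E) * real i ^ i \<le> (N ^ i * 3 ^ i) * real i ^ i" by (intro mult_right_mono) auto
  also have "\<dots> = (3 * real k ^ 2) ^ i"
  proof -
    have "N * 3 * real i = 3 * real k ^ 2" using i by (simp add: N_def)
    then show ?thesis by (simp only: power_mult_distrib[symmetric])
  qed
  finally show ?thesis .
qed

section \<open>The asymptotic expansion\<close>

lemma A_skew_expansion:
  assumes lam: "is_partition lam" and mu: "is_partition mu" and sub: "contained mu lam"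
  shows "A_skew lam mu = (\<Sum>\<sigma> | \<sigma> permutes {1..sum_list mu}.
    (real_of_int (irr_char lam \<sigma>) / real (f_shape lam)) * (real_of_int (irr_char mu \<sigma>) / real (f_shape mu)))"
proof -
  have le: "sum_list mu \<le> sum_list lam"
    using card_mono[of "young lam" "young mu"] sub by (simp add: contained_def card_young)
  have "real_of_int (\<Sum>\<sigma> | \<sigma> permutes {1..sum_list mu}. irr_char lam \<sigma> * irr_char mu \<sigma>) =
     real_of_int (fact (sum_list mu) * int (f_skew lam mu))"
    using restriction_multiplicity[OF lam mu le] sub by simp
  then have "(\<Sum>\<sigma> | \<sigma> permutes {1..sum_list mu}. real_of_int (irr_char lam \<sigma>) * real_of_int (irr_char mu \<sigma>)) =
     fact (sum_list mu) * real (f_skew lam mu)"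
    by (simp only: of_int_sum of_int_mult of_int_fact of_int_of_nat_eq)
  then show ?thesis
    unfolding A_skew_def by (simp only: times_divide_times_eq sum_divide_distrib[symmetric])
qed

lemma sum_ellT_layer_bound:
  assumes lam: "is_partition lam" "sum_list lam = n" "real (nrows lam) \<le> a" "real (ncols lam) \<le> a" "0 < a"
    and mu: "is_partition mu" "sum_list mu = k" "real (nrows mu) \<le> b" "real (ncols mu) \<le> b" "0 < b"
    and kn: "k \<le> n" and i: "0 < i"
  shows "(\<Sum>\<sigma> | \<sigma> permutes {1..k} \<and> ellT \<sigma> = i.
      \<bar>(real_of_int (irr_char lam \<sigma>) / real (f_shape lam)) * (real_of_int (irr_char mu \<sigma>) / real (f_shape mu))\<bar>)
    \<le> (15552 * (real k * b * a / real n)) ^ i"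
proof -
  let ?E = "{\<sigma>. \<sigma> permutes {1..k} \<and> ellT \<sigma> = i}"
  let ?t = "\<lambda>\<sigma>. (real_of_int (irr_char lam \<sigma>) / real (f_shape lam)) * (real_of_int (irr_char mu \<sigma>) / real (f_shape mu))"
  define c where "c = (72 * a * sqrt i / n) ^ i * (72 * b * sqrt i / k) ^ i"
  have "\<bar>?t \<sigma>\<bar> \<le> c" if \<sigma>: "\<sigma> \<in> ?E" for \<sigma>
  proof -
    have k: "\<sigma> permutes {1..k}" and n: "\<sigma> permutes {1..n}" and e: "ellT \<sigma> = i"
      using \<sigma> permutes_subset[of \<sigma> "{1..k}" "{1..n}"] kn by auto
    have "\<bar>real_of_int (irr_char lam \<sigma>) / real (f_shape lam)\<bar> \<le> (72 * a * sqrt i / n) ^ i"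
      using normalised_character_bound[OF lam n] i unfolding e by blast
    moreover have "\<bar>real_of_int (irr_char mu \<sigma>) / real (f_shape mu)\<bar> \<le> (72 * b * sqrt i / k) ^ i"
      using normalised_character_bound[OF mu k] i unfolding e by blast
    ultimately show ?thesis unfolding c_def abs_mult using lam(5)
      by (intro mult_mono) auto
  qed
  then have "(\<Sum>\<sigma>\<in>?E. \<bar>?t \<sigma>\<bar>) \<le> (\<Sum>\<sigma>\<in>?E. c)" by (rule sum_mono)
  also have "\<dots> = real (card ?E) * c" by simp
  \<comment> \<open>5184 = 72 * 72; the count of permutations will turn it into 15552 = 3 *
    5184.\<close>
  also have "c = real i ^ i * (5184 * a * b / (real n * real k)) ^ i"
  proof -
    have "(72 * a * sqrt i / n) * (72 * b * sqrt i / k) =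
        (sqrt (real i) * sqrt (real i)) * (5184 * a * b / (real n * real k))" by simp
    then have "(72 * a * sqrt i / n) * (72 * b * sqrt i / k) =
        real i * (5184 * a * b / (real n * real k))" by (simp only: real_sqrt_mult_self abs_of_nat)
    then show ?thesis unfolding c_def by (simp only: power_mult_distrib[symmetric])
  qed
  also have "real (card ?E) * (real i ^ i * (5184 * a * b / (real n * real k)) ^ i) =
    (real (card ?E) * real i ^ i) * (5184 * a * b / (real n * real k)) ^ i" by simp
  also have "\<dots> \<le> (3 * real k ^ 2) ^ i * (5184 * a * b / (real n * real k)) ^ i"
    using lam(5) mu(5) by (intro mult_right_mono card_ellT_eq_le[OF i]) auto
  also have "\<dots> = (15552 * (real k * b * a / real n)) ^ i"
  proof -
    \<comment> \<open>For k = 0 nothing can be cancelled, but both sides carry a factor k and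
      vanish.\<close>
    have "(3 * real k ^ 2) * (5184 * a * b / (real n * real k)) = 15552 * (real k * b * a / real n)"
      by (cases "k = 0") (simp_all add: power2_eq_square)
    then show ?thesis by (simp only: power_mult_distrib[symmetric])
  qed
  finally show ?thesis .
qed

lemma sum_power_tail_le:
  fixes y :: real
  assumes "0 \<le> y" "y \<le> 1 / 2"
  shows "(\<Sum>i\<in>{r<..k}. y ^ i) \<le> 2 * y ^ (r + 1)"
proof -
  have g: "(\<Sum>j<d. y ^ j) \<le> 2" for d
  proof -
    have "1 / 2 * (\<Sum>j<d. y ^ j) \<le> (1 - y) * (\<Sum>j<d. y ^ j)"
      using assms by (intro mult_right_mono sum_nonneg) auto
    also have "\<dots> = 1 - y ^ d" by (rule one_diff_power_eq[symmetric])
    also have "\<dots> \<le> 1" using assms by simp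
    finally show ?thesis by simp
  qed
  have "(\<Sum>i\<in>{r<..k}. y ^ i) = (\<Sum>j<k - r. y ^ (r + 1 + j))"
    by (rule sum.reindex_bij_witness[of _ "\<lambda>j. r + 1 + j" "\<lambda>i. i - (r + 1)"]) auto
  also have "\<dots> = y ^ (r + 1) * (\<Sum>j<k - r. y ^ j)" by (simp only: power_add sum_distrib_left)
  also have "\<dots> \<le> y ^ (r + 1) * 2"
    using assms(1) by (intro mult_left_mono g zero_le_power)
  finally show ?thesis by simp
qed

lemma A_skew_truncation_error:
  assumes lam: "is_partition lam" "sum_list lam = n" "real (nrows lam) \<le> a" "real (ncols lam) \<le> a" "0 < a"
    and mu: "is_partition mu" "sum_list mu = k" "real (nrows mu) \<le> b" "real (ncols mu) \<le> b" "0 < b"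
    and sub: "contained mu lam" and small: "15552 * (real k * b * a / real n) \<le> 1 / 2"
  shows "\<bar>A_skew lam mu - (\<Sum>\<sigma> \<in> {\<sigma>. \<sigma> permutes {1..k} \<and> ellT \<sigma> \<le> r}.
      (real_of_int (irr_char lam \<sigma>) / real (f_shape lam)) * (real_of_int (irr_char mu \<sigma>) / real (f_shape mu)))\<bar>
    \<le> 2 * 15552 ^ (r + 1) * (real k * b * a / real n) ^ (r + 1)"
proof -
  let ?P = "{\<sigma>. \<sigma> permutes {1..k}}"
  let ?L = "{\<sigma>. \<sigma> permutes {1..k} \<and> ellT \<sigma> \<le> r}"
  let ?t = "\<lambda>\<sigma>. (real_of_int (irr_char lam \<sigma>) / real (f_shape lam)) * (real_of_int (irr_char mu \<sigma>) / real (f_shape mu))"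
  let ?y = "15552 * (real k * b * a / real n)"
  have fP: "finite ?P" by (intro finite_permutations) simp
  have kn: "k \<le> n"
    using card_mono[of "young lam" "young mu"] sub lam mu by (simp add: contained_def card_young)
  have "A_skew lam mu = (\<Sum>\<sigma>\<in>?P. ?t \<sigma>)"
    using A_skew_expansion[OF lam(1) mu(1) sub] unfolding mu(2) .
  also have "\<dots> = (\<Sum>\<sigma>\<in>?L. ?t \<sigma>) + (\<Sum>\<sigma>\<in>?P - ?L. ?t \<sigma>)"
    using fP by (subst sum.subset_diff[of ?L]) auto
  finally have "A_skew lam mu - (\<Sum>\<sigma>\<in>?L. ?t \<sigma>) = (\<Sum>\<sigma>\<in>?P - ?L. ?t \<sigma>)"
    by (simp only: add_diff_cancel_left')
  then have "\<bar>A_skew lam mu - (\<Sum>\<sigma>\<in>?L. ?t \<sigma>)\<bar> \<le> (\<Sum>\<sigma>\<in>?P - ?L. \<bar>?t \<sigma>\<bar>)"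
    by (simp only: sum_abs)
  also have "\<dots> = (\<Sum>i\<in>{r<..k}. \<Sum>\<sigma>\<in>{\<sigma>\<in>?P - ?L. ellT \<sigma> = i}. \<bar>?t \<sigma>\<bar>)"
  proof (rule sum.group[symmetric])
    \<comment> \<open>Reflection length is at most k, being k minus a number of cycles.\<close>
    show "ellT ` (?P - ?L) \<subseteq> {r<..k}"
    proof (intro image_subsetI)
      fix \<sigma> assume "\<sigma> \<in> ?P - ?L"
      then have "\<sigma> permutes {1..k}" "r < ellT \<sigma>" by auto
      then show "ellT \<sigma> \<in> {r<..k}" using ellT_plus_cyc[of "{1..k}" \<sigma>] by simp
    qed
  qed (use fP in auto)
  also have "\<dots> = (\<Sum>i\<in>{r<..k}. \<Sum>\<sigma> | \<sigma> permutes {1..k} \<and> ellT \<sigma> = i. \<bar>?t \<sigma>\<bar>)"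
  proof (rule sum.cong[OF refl])
    fix i assume "i \<in> {r<..k}"
    then have "{\<sigma>\<in>?P - ?L. ellT \<sigma> = i} = {\<sigma>. \<sigma> permutes {1..k} \<and> ellT \<sigma> = i}" by auto
    then show "(\<Sum>\<sigma>\<in>{\<sigma>\<in>?P - ?L. ellT \<sigma> = i}. \<bar>?t \<sigma>\<bar>) = (\<Sum>\<sigma> | \<sigma> permutes {1..k} \<and> ellT \<sigma> = i. \<bar>?t \<sigma>\<bar>)"
      by (simp only:)
  qed
  also have "\<dots> \<le> (\<Sum>i\<in>{r<..k}. ?y ^ i)"
    by (rule sum_mono, rule sum_ellT_layer_bound[OF lam mu kn]) auto
  also have "\<dots> \<le> 2 * ?y ^ (r + 1)"
    using lam(5) mu(5) by (intro sum_power_tail_le small) auto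
  finally show ?thesis by (simp only: power_mult_distrib mult.assoc)
qed

text \<open>Arbitrary sequences of shapes express uniformity over all admissible pairs; the constant
  found depends on r only.\<close>

theorem theorem1p7:
  fixes \<alpha> \<beta> :: "nat \<Rightarrow> real" and r :: nat and lam mu :: "nat \<Rightarrow> nat list"
  assumes "\<forall>n. \<alpha> n > 0" and "\<forall>k. \<beta> k > 0"
    and "\<forall>\<^sub>F n in sequentially.
           is_partition (lam n) \<and> sum_list (lam n) = n \<and>
           real (nrows (lam n)) \<le> \<alpha> n \<and> real (ncols (lam n)) \<le> \<alpha> n \<and>
           is_partition (mu n) \<and>
           real (nrows (mu n)) \<le> \<beta> (sum_list (mu n)) \<and> real (ncols (mu n)) \<le> \<beta> (sum_list (mu n)) \<and>
           contained (mu n) (lam n)"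
    and "((\<lambda>n. real (sum_list (mu n)) * \<beta> (sum_list (mu n)) / (real n / \<alpha> n)) \<longlongrightarrow> 0) sequentially"
  shows "(\<lambda>n. A_skew (lam n) (mu n)
              - (\<Sum>\<sigma> \<in> {\<sigma>. \<sigma> permutes {1..sum_list (mu n)} \<and> ellT \<sigma> \<le> r}.
                   (real_of_int (irr_char (lam n) \<sigma>) / real (f_shape (lam n))) *
                   (real_of_int (irr_char (mu n) \<sigma>) / real (f_shape (mu n)))))
         \<in> O(\<lambda>n. (real (sum_list (mu n)) * \<beta> (sum_list (mu n)) * \<alpha> n / real n) ^ (r + 1))"
proof (rule bigoI[where c = "2 * 15552 ^ (r + 1)"])
  let ?x = "\<lambda>n. real (sum_list (mu n)) * \<beta> (sum_list (mu n)) * \<alpha> n / real n"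
  have "?x = (\<lambda>n. real (sum_list (mu n)) * \<beta> (sum_list (mu n)) / (real n / \<alpha> n))"
    by (simp add: fun_eq_iff)
  then have lim: "?x \<longlonglongrightarrow> 0" using assms(4) by simp
  \<comment> \<open>31104 = 2 * 15552, so eventually the ratio of the geometric tail is at most
    1/2.\<close>
  have "\<forall>\<^sub>F n in sequentially. ?x n < 1 / 31104"
    by (rule order_tendstoD(2)[OF lim]) simp
  then show "\<forall>\<^sub>F n in sequentially.
      norm (A_skew (lam n) (mu n)
              - (\<Sum>\<sigma> \<in> {\<sigma>. \<sigma> permutes {1..sum_list (mu n)} \<and> ellT \<sigma> \<le> r}.
                   (real_of_int (irr_char (lam n) \<sigma>) / real (f_shape (lam n))) *
                   (real_of_int (irr_char (mu n) \<sigma>) / real (f_shape (mu n)))))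
      \<le> 2 * 15552 ^ (r + 1) * norm (?x n ^ (r + 1))"
    using assms(3)
  proof eventually_elim
    case (elim n)
    have pos: "0 < \<alpha> n" "0 < \<beta> (sum_list (mu n))" using assms(1,2) by auto
    have "0 \<le> ?x n" using pos by simp
    then have "0 \<le> ?x n ^ (r + 1)" by (rule zero_le_power)
    then have nrm: "norm (?x n ^ (r + 1)) = ?x n ^ (r + 1)"
      by (simp only: real_norm_def abs_of_nonneg)
    have small: "15552 * ?x n \<le> 1 / 2" using elim(1) by linarith
    show ?case unfolding nrm unfolding real_norm_def
      by (rule A_skew_truncation_error[OF _ _ _ _ _ _ _ _ _ _ _ small]) (use elim pos in auto)
  qed
qed

end
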